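(* The überhomology is a bi-functor: the assignment $(X,R)\mapsto \ddot{\mathrm{H}}^*(X;R)$ is (the object part of) a bi-functor \[ \ddot{\mathrm{H}}^*(-;-)\colon \mathbf{RegSimpl}\times \mathbf{Ring}\longrightarrow \mathbf{grAb}, \] covariant in both variables, where $\mathbf{RegSimpl}$ is the category of (finite, connected) simplicial complexes and injective simplicial maps, $\mathbf{Ring}$ is the category of (commutative, unital) rings and ring homomorphisms, and $\mathbf{grAb}$ is the category of graded Abelian groups.
   Context: Let $X$ be a finite connected simplicial complex with ordered vertex set $V(X)=\{v_1,\dots,v_m\}$ and let $R$ be a commutative ring with unit. Bi-colourings and weight. A bi-colouring on $X$ is a map $\varepsilon\colon V(X)\to\{0,1\}$; put $\ell(\varepsilon)=\sum_j\varepsilon(v_j)$. For a simplex $\sigma$ of $X$, the weight $w_\varepsilon(\sigma)=\dim(\sigma)+1-\sum_{v\in V(\sigma)}\varepsilon(v)$ is the number of $0$-coloured vertices of $\sigma$. Horizontal homology. The simplicial differential $\partial$ on the simplicial chain complex $C_*(X;R)$ decomposes as the sum of a part $\partial_h$ preserving $w_\varepsilon$ and a part decreasing $w_\varepsilon$ by one. The horizontal chain complex $(C(X,\varepsilon;R),\partial_h)$ has underlying module $C_*(X;R)$, bi-graded by dimension and weight; its homology is the $\varepsilon$-horizontal homology $\mathrm{H}^h(X,\varepsilon;R)$. Connecting maps. Write $\varepsilon\,\widetilde{\triangleleft}\,\varepsilon'$ if $\varepsilon'$ is obtained from $\varepsilon$ by changing the value at exactly one vertex from $0$ to $1$. In that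 case $d_{\varepsilon,\varepsilon'}\colon \mathrm{H}^h(X,\varepsilon;R)\to \mathrm{H}^h(X,\varepsilon';R)$ is the map induced by the chain map sending a simplex $\sigma$ to $\sigma$ if $w_\varepsilon(\sigma)=w_{\varepsilon'}(\sigma)$ and to $0$ otherwise. Signs. The set of bi-colourings, identified with $\{0,1\}^m$, is the Boolean poset $B(m)$. A sign assignment is a choice of $s(\varepsilon,\varepsilon')\in\mathbb{Z}/2$ for every covering relation such that $s(\varepsilon,\varepsilon_1)+s(\varepsilon_1,\varepsilon'')\equiv s(\varepsilon,\varepsilon_2)+s(\varepsilon_2,\varepsilon'')+1 \pmod 2$ for every square $\varepsilon\,\widetilde{\triangleleft}\,\varepsilon_1,\varepsilon_2\,\widetilde{\triangleleft}\,\varepsilon''$ with $\varepsilon_1\ne\varepsilon_2$. Sign assignments on $B(m)$ exist, and the isomorphism type of the complex below does not depend on the choice. Überhomology. $\ddot{\mathrm{C}}^j(X;R)=\bigoplus_{\ell(\varepsilon)=j}\mathrm{H}^h(X,\varepsilon;R)$ with differential $d^j=\sum_{\ell(\varepsilon)=j}\sum_{\varepsilon\,\widetilde{\triangleleft}\,\varepsilon'}(-1)^{s(\varepsilon,\varepsilon')}d_{\varepsilon,\varepsilon'}$. The überhomology $\ddot{\mathrm{H}}^*(X;R)$ is the homology of this complex. A simplicial map is a map on vertices such that the image of the vertices of any simplex spans a simplex; it is injective if it is injective on vertices. *)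

theory Defs
  imports "HOL-Algebra.Product_Groups" "HOL-Algebra.RingHom" "HOL-Library.Z2"
begin

section \<open>Categories and functors\<close>

text \<open>In \<open>Comp C X Y Z g f\<close> the arrow \<open>f\<close> goes from \<open>X\<close> to \<open>Y\<close> and \<open>g\<close> from \<open>Y\<close> to \<open>Z\<close>.\<close>

record ('o, 'm) cat =
  Obj :: "'o set"
  Hom :: "'o \<Rightarrow> 'o \<Rightarrow> 'm set"
  Idt :: "'o \<Rightarrow> 'm"
  Comp :: "'o \<Rightarrow> 'o \<Rightarrow> 'o \<Rightarrow> 'm \<Rightarrow> 'm \<Rightarrow> 'm"

locale category =
  fixes C :: "('o, 'm) cat"
  assumes Idt_in_Hom: "X \<in> Obj C \<Longrightarrow> Idt C X \<in> Hom C X X"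
    and Comp_in_Hom:
      "\<lbrakk>X \<in> Obj C; Y \<in> Obj C; Z \<in> Obj C; f \<in> Hom C X Y; g \<in> Hom C Y Z\<rbrakk>
        \<Longrightarrow> Comp C X Y Z g f \<in> Hom C X Z"
    and Comp_Idt_right:
      "\<lbrakk>X \<in> Obj C; Y \<in> Obj C; f \<in> Hom C X Y\<rbrakk> \<Longrightarrow> Comp C X X Y f (Idt C X) = f"
    and Comp_Idt_left:
      "\<lbrakk>X \<in> Obj C; Y \<in> Obj C; f \<in> Hom C X Y\<rbrakk> \<Longrightarrow> Comp C X Y Y (Idt C Y) f = f"
    and Comp_assoc:
      "\<lbrakk>W \<in> Obj C; X \<in> Obj C; Y \<in> Obj C; Z \<in> Obj C;
        f \<in> Hom C W X; g \<in> Hom C X Y; h \<in> Hom C Y Z\<rbrakk>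
        \<Longrightarrow> Comp C W X Z (Comp C X Y Z h g) f = Comp C W Y Z h (Comp C W X Y g f)"

locale cat_functor = dom: category C + cod: category D
  for C :: "('o, 'm) cat" and D :: "('p, 'n) cat" +
  fixes Fo :: "'o \<Rightarrow> 'p" and Fm :: "'o \<Rightarrow> 'o \<Rightarrow> 'm \<Rightarrow> 'n"
  assumes Fo_in_Obj: "X \<in> Obj C \<Longrightarrow> Fo X \<in> Obj D"
    and Fm_in_Hom:
      "\<lbrakk>X \<in> Obj C; Y \<in> Obj C; f \<in> Hom C X Y\<rbrakk> \<Longrightarrow> Fm X Y f \<in> Hom D (Fo X) (Fo Y)"
    and Fm_Idt: "X \<in> Obj C \<Longrightarrow> Fm X X (Idt C X) = Idt D (Fo X)"
    and Fm_Comp: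
      "\<lbrakk>X \<in> Obj C; Y \<in> Obj C; Z \<in> Obj C; f \<in> Hom C X Y; g \<in> Hom C Y Z\<rbrakk>
        \<Longrightarrow> Fm X Z (Comp C X Y Z g f) = Comp D (Fo X) (Fo Y) (Fo Z) (Fm Y Z g) (Fm X Y f)"

definition prod_cat :: "('o, 'm) cat \<Rightarrow> ('p, 'n) cat \<Rightarrow> ('o \<times> 'p, 'm \<times> 'n) cat"
  where "prod_cat C D =
    \<lparr>Obj = Obj C \<times> Obj D,
     Hom = (\<lambda>X Y. Hom C (fst X) (fst Y) \<times> Hom D (snd X) (snd Y)),
     Idt = (\<lambda>X. (Idt C (fst X), Idt D (snd X))),
     Comp = (\<lambda>X Y Z g f. (Comp C (fst X) (fst Y) (fst Z) (fst g) (fst f),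
                          Comp D (snd X) (snd Y) (snd Z) (snd g) (snd f)))\<rparr>"

section \<open>The categories RegSimpl, Ring and grAb\<close>

text \<open>The list of vertices carries the order of the vertex set; only nonempty simplices
  are recorded.\<close>

record 'v scomplex =
  verts :: "'v list"
  simps :: "'v set set"

definition fin_conn_complex :: "'v scomplex \<Rightarrow> bool"
  where "fin_conn_complex X \<longleftrightarrow>
    distinct (verts X) \<and> verts X \<noteq> [] \<and>
    (\<forall>\<sigma>\<in>simps X. \<sigma> \<noteq> {} \<and> \<sigma> \<subseteq> set (verts X)) \<and>
    (\<forall>v\<in>set (verts X). {v} \<in> simps X) \<and>
    (\<forall>\<sigma>\<in>simps X. \<forall>\<tau>. \<tau> \<subseteq> \<sigma> \<and> \<tau> \<noteq> {} \<longrightarrow> \<tau> \<in> simps X) \<and>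
    (\<forall>u\<in>set (verts X). \<forall>v\<in>set (verts X). (u, v) \<in> {(a, b). {a, b} \<in> simps X}\<^sup>*)"

text \<open>All arrows are extensional functions, so that equality of arrows is equality of
  functions on the respective carriers.\<close>

definition RegSimpl :: "('v scomplex, 'v \<Rightarrow> 'v) cat"
  where "RegSimpl =
    \<lparr>Obj = {X. fin_conn_complex X},
     Hom = (\<lambda>X Y. {f \<in> set (verts X) \<rightarrow>\<^sub>E set (verts Y).
                     inj_on f (set (verts X)) \<and> (\<forall>\<sigma>\<in>simps X. f ` \<sigma> \<in> simps Y)}),
     Idt = (\<lambda>X. \<lambda>v\<in>set (verts X). v),
     Comp = (\<lambda>X Y Z g f. compose (set (verts X)) g f)\<rparr>"

definition CRing :: "('r ring, 'r \<Rightarrow> 'r) cat"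
  where "CRing =
    \<lparr>Obj = {R. cring R},
     Hom = (\<lambda>R S. ring_hom R S \<inter> extensional (carrier R)),
     Idt = (\<lambda>R. \<lambda>x\<in>carrier R. x),
     Comp = (\<lambda>R S T g f. compose (carrier R) g f)\<rparr>"

text \<open>Graded Abelian groups are families of Abelian groups, written multiplicatively as
  everywhere in HOL-Algebra, indexed by the integers. In \<open>GrAb\<close> the arrows preserve the
  degree.\<close>

definition GrAb :: "(int \<Rightarrow> 'g monoid, int \<Rightarrow> 'g \<Rightarrow> 'g) cat"
  where "GrAb =
    \<lparr>Obj = {G. \<forall>j. comm_group (G j)},
     Hom = (\<lambda>G H. {h. \<forall>j. h j \<in> hom (G j) (H j) \<inter> extensional (carrier (G j))}),
     Idt = (\<lambda>G j. \<lambda>x\<in>carrier (G j). x),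
     Comp = (\<lambda>G H K h' h j. compose (carrier (G j)) (h' j) (h j))\<rparr>"

text \<open>\<open>GrAbHomog\<close> has the same objects, but its arrows are homogeneous of an arbitrary
  degree \<open>d\<close>, recorded in the pair \<open>(d, h)\<close>.\<close>

definition GrAbHomog :: "(int \<Rightarrow> 'g monoid, int \<times> (int \<Rightarrow> 'g \<Rightarrow> 'g)) cat"
  where "GrAbHomog =
    \<lparr>Obj = {G. \<forall>j. comm_group (G j)},
     Hom = (\<lambda>G H. {(d, h). \<forall>j. h j \<in> hom (G j) (H (j + d)) \<inter> extensional (carrier (G j))}),
     Idt = (\<lambda>G. (0, \<lambda>j. \<lambda>x\<in>carrier (G j). x)),
     Comp = (\<lambda>G H K h' h. (fst h + fst h',
                \<lambda>j. compose (carrier (G j)) (snd h' (j + fst h)) (snd h j)))\<rparr>"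

definition degree_zero_part ::
    "(int \<Rightarrow> 'g monoid) \<Rightarrow> (int \<Rightarrow> 'g monoid) \<Rightarrow> int \<times> (int \<Rightarrow> 'g \<Rightarrow> 'g) \<Rightarrow> int \<Rightarrow> 'g \<Rightarrow> 'g"
  where "degree_zero_part G H h =
    (\<lambda>j. if fst h = 0 then snd h j else (\<lambda>x\<in>carrier (G j). \<one>\<^bsub>H j\<^esub>))"

section \<open>Signs and subquotients\<close>

definition signed :: "('g, 'm) monoid_scheme \<Rightarrow> bit \<Rightarrow> 'g \<Rightarrow> 'g"
  where "signed G b x = (if b = 0 then x else inv\<^bsub>G\<^esub> x)"

definition subquotient :: "'g monoid \<Rightarrow> 'g set \<Rightarrow> 'g set \<Rightarrow> 'g set monoid"
  where "subquotient G Z B = (G\<lparr>carrier := Z\<rparr>) Mod B"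

text \<open>The map between subquotients of \<open>G\<close> and \<open>H\<close> induced by \<open>f\<close>: the coset \<open>B z\<close> goes to
  the coset \<open>B' (f z)\<close>.\<close>

definition subquotient_map ::
    "'g monoid \<Rightarrow> 'g set \<Rightarrow> 'g set \<Rightarrow> 'h monoid \<Rightarrow> 'h set \<Rightarrow> ('g \<Rightarrow> 'h) \<Rightarrow> 'g set \<Rightarrow> 'h set"
  where "subquotient_map G Z B H B' f =
    (\<lambda>A\<in>carrier (subquotient G Z B). the_elem ((\<lambda>z. B' #>\<^bsub>H\<^esub> f z) ` A))"

section \<open>Horizontal homology\<close>

definition colourings :: "'v scomplex \<Rightarrow> ('v \<Rightarrow> nat) set"
  where "colourings X = set (verts X) \<rightarrow>\<^sub>E {0, 1}"

definition ell :: "'v scomplex \<Rightarrow> ('v \<Rightarrow> nat) \<Rightarrow> int"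
  where "ell X \<epsilon> = (\<Sum>v\<in>set (verts X). int (\<epsilon> v))"

definition sdim :: "'v set \<Rightarrow> int"
  where "sdim \<sigma> = int (card \<sigma>) - 1"

definition weight :: "('v \<Rightarrow> nat) \<Rightarrow> 'v set \<Rightarrow> int"
  where "weight \<epsilon> \<sigma> = sdim \<sigma> + 1 - (\<Sum>v\<in>\<sigma>. int (\<epsilon> v))"

definition before :: "'v scomplex \<Rightarrow> 'v \<Rightarrow> 'v \<Rightarrow> bool"
  where "before X u v \<longleftrightarrow>
    (\<exists>i j. i < j \<and> j < length (verts X) \<and> verts X ! i = u \<and> verts X ! j = v)"

text \<open>A chain is the function giving its coefficients on the simplices; the simplex \<open>\<sigma>\<close> is
  the basis element oriented by the order of the vertices.\<close>

definition chain_group :: "'v scomplex \<Rightarrow> 'r ring \<Rightarrow> ('v set \<Rightarrow> 'r) monoid"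
  where "chain_group X R = product_group (simps X) (\<lambda>\<sigma>. add_monoid R)"

text \<open>The coefficient of \<open>\<sigma> - {v}\<close> in the simplicial boundary of \<open>\<sigma>\<close> is \<open>-1\<close> to the number
  of vertices of \<open>\<sigma>\<close> before \<open>v\<close>; \<open>\<partial>\<^sub>h\<close> keeps the faces of the same weight.\<close>

definition horizontal_boundary ::
    "'v scomplex \<Rightarrow> 'r ring \<Rightarrow> ('v \<Rightarrow> nat) \<Rightarrow> ('v set \<Rightarrow> 'r) \<Rightarrow> 'v set \<Rightarrow> 'r"
  where "horizontal_boundary X R \<epsilon> c =
    (\<lambda>\<tau>\<in>simps X.
      \<Oplus>\<^bsub>R\<^esub>v\<in>{v \<in> set (verts X) - \<tau>. insert v \<tau> \<in> simps X \<and> weight \<epsilon> (insert v \<tau>) = weight \<epsilon> \<tau>}.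
        signed (add_monoid R) (of_nat (card {u \<in> \<tau>. before X u v})) (c (insert v \<tau>)))"

definition h_cycles :: "'v scomplex \<Rightarrow> 'r ring \<Rightarrow> ('v \<Rightarrow> nat) \<Rightarrow> ('v set \<Rightarrow> 'r) set"
  where "h_cycles X R \<epsilon> =
    kernel (chain_group X R) (chain_group X R) (horizontal_boundary X R \<epsilon>)"

definition h_boundaries :: "'v scomplex \<Rightarrow> 'r ring \<Rightarrow> ('v \<Rightarrow> nat) \<Rightarrow> ('v set \<Rightarrow> 'r) set"
  where "h_boundaries X R \<epsilon> = horizontal_boundary X R \<epsilon> ` carrier (chain_group X R)"

text \<open>The total horizontal homology, i.e. the direct sum over all dimensions and weights.\<close>

definition h_homology :: "'v scomplex \<Rightarrow> 'r ring \<Rightarrow> ('v \<Rightarrow> nat) \<Rightarrow> ('v set \<Rightarrow> 'r) set monoid"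
  where "h_homology X R \<epsilon> = subquotient (chain_group X R) (h_cycles X R \<epsilon>) (h_boundaries X R \<epsilon>)"

definition covers :: "'v scomplex \<Rightarrow> ('v \<Rightarrow> nat) \<Rightarrow> ('v \<Rightarrow> nat) \<Rightarrow> bool"
  where "covers X \<epsilon> \<epsilon>' \<longleftrightarrow>
    \<epsilon> \<in> colourings X \<and> \<epsilon>' \<in> colourings X \<and>
    (\<exists>v\<in>set (verts X). \<epsilon> v = 0 \<and> \<epsilon>' = \<epsilon>(v := 1))"

definition connecting_chain ::
    "'v scomplex \<Rightarrow> 'r ring \<Rightarrow> ('v \<Rightarrow> nat) \<Rightarrow> ('v \<Rightarrow> nat) \<Rightarrow> ('v set \<Rightarrow> 'r) \<Rightarrow> 'v set \<Rightarrow> 'r"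
  where "connecting_chain X R \<epsilon> \<epsilon>' c =
    (\<lambda>\<sigma>\<in>simps X. if weight \<epsilon> \<sigma> = weight \<epsilon>' \<sigma> then c \<sigma> else \<zero>\<^bsub>R\<^esub>)"

definition connecting_map ::
    "'v scomplex \<Rightarrow> 'r ring \<Rightarrow> ('v \<Rightarrow> nat) \<Rightarrow> ('v \<Rightarrow> nat) \<Rightarrow> ('v set \<Rightarrow> 'r) set \<Rightarrow> ('v set \<Rightarrow> 'r) set"
  where "connecting_map X R \<epsilon> \<epsilon>' =
    subquotient_map (chain_group X R) (h_cycles X R \<epsilon>) (h_boundaries X R \<epsilon>)
      (chain_group X R) (h_boundaries X R \<epsilon>') (connecting_chain X R \<epsilon> \<epsilon>')"

section \<open>Ueberhomology\<close>

definition sign_assignment :: "'v scomplex \<Rightarrow> (('v \<Rightarrow> nat) \<Rightarrow> ('v \<Rightarrow> nat) \<Rightarrow> bit) \<Rightarrow> bool"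
  where "sign_assignment X s \<longleftrightarrow>
    (\<forall>\<epsilon> \<epsilon>1 \<epsilon>2 \<epsilon>''. covers X \<epsilon> \<epsilon>1 \<and> covers X \<epsilon> \<epsilon>2 \<and> covers X \<epsilon>1 \<epsilon>'' \<and> covers X \<epsilon>2 \<epsilon>'' \<and> \<epsilon>1 \<noteq> \<epsilon>2 \<longrightarrow>
      s \<epsilon> \<epsilon>1 + s \<epsilon>1 \<epsilon>'' = s \<epsilon> \<epsilon>2 + s \<epsilon>2 \<epsilon>'' + 1)"

type_synonym ('v, 'r) uchain = "('v \<Rightarrow> nat) \<Rightarrow> ('v set \<Rightarrow> 'r) set"

definition uber_chains :: "'v scomplex \<Rightarrow> 'r ring \<Rightarrow> int \<Rightarrow> ('v, 'r) uchain monoid"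
  where "uber_chains X R j =
    product_group {\<epsilon> \<in> colourings X. ell X \<epsilon> = j} (\<lambda>\<epsilon>. h_homology X R \<epsilon>)"

definition uber_diff ::
    "(('v \<Rightarrow> nat) \<Rightarrow> ('v \<Rightarrow> nat) \<Rightarrow> bit) \<Rightarrow> 'v scomplex \<Rightarrow> 'r ring \<Rightarrow> int
      \<Rightarrow> ('v, 'r) uchain \<Rightarrow> ('v, 'r) uchain"
  where "uber_diff s X R j x =
    (\<lambda>\<epsilon>'\<in>{\<epsilon>' \<in> colourings X. ell X \<epsilon>' = j + 1}.
      finprod (h_homology X R \<epsilon>')
        (\<lambda>\<epsilon>. signed (h_homology X R \<epsilon>') (s \<epsilon> \<epsilon>') (connecting_map X R \<epsilon> \<epsilon>' (x \<epsilon>)))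
        {\<epsilon>. covers X \<epsilon> \<epsilon>'})"

definition uber_cycles ::
    "(('v \<Rightarrow> nat) \<Rightarrow> ('v \<Rightarrow> nat) \<Rightarrow> bit) \<Rightarrow> 'v scomplex \<Rightarrow> 'r ring \<Rightarrow> int \<Rightarrow> ('v, 'r) uchain set"
  where "uber_cycles s X R j =
    kernel (uber_chains X R j) (uber_chains X R (j + 1)) (uber_diff s X R j)"

definition uber_boundaries ::
    "(('v \<Rightarrow> nat) \<Rightarrow> ('v \<Rightarrow> nat) \<Rightarrow> bit) \<Rightarrow> 'v scomplex \<Rightarrow> 'r ring \<Rightarrow> int \<Rightarrow> ('v, 'r) uchain set"
  where "uber_boundaries s X R j =
    uber_diff s X R (j - 1) ` carrier (uber_chains X R (j - 1))"

definition uberhomology ::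
    "(('v \<Rightarrow> nat) \<Rightarrow> ('v \<Rightarrow> nat) \<Rightarrow> bit) \<Rightarrow> 'v scomplex \<Rightarrow> 'r ring \<Rightarrow> int \<Rightarrow> ('v, 'r) uchain set monoid"
  where "uberhomology s X R j =
    subquotient (uber_chains X R j) (uber_cycles s X R j) (uber_boundaries s X R j)"

section \<open>Induced maps\<close>

text \<open>\<open>f\<^sub>#\<close> sends \<open>r \<sigma>\<close> to \<open>\<phi> r\<close> times the oriented image \<open>f ` \<sigma>\<close>. Since \<open>f\<close> need not preserve
  the orders of the vertices, the sign is that of the permutation sorting the image.\<close>

definition induced_chain ::
    "'v scomplex \<Rightarrow> 'v scomplex \<Rightarrow> 'r ring \<Rightarrow> ('v \<Rightarrow> 'v) \<Rightarrow> ('r \<Rightarrow> 'r) \<Rightarrow> ('v set \<Rightarrow> 'r) \<Rightarrow> 'v set \<Rightarrow> 'r"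
  where "induced_chain X Y S f \<phi> c =
    (\<lambda>\<tau>\<in>simps Y.
      \<Oplus>\<^bsub>S\<^esub>\<sigma>\<in>{\<sigma> \<in> simps X. f ` \<sigma> = \<tau>}.
        signed (add_monoid S)
          (of_nat (card {(u, v) \<in> \<sigma> \<times> \<sigma>. before X u v \<and> before Y (f v) (f u)})) (\<phi> (c \<sigma>)))"

text \<open>Colourings are extended by the colour 1 outside the image. With the colour 0 the
  resulting map would not commute with the differential, because of the components that
  recolour a vertex outside the image.\<close>

definition push_colouring :: "'v scomplex \<Rightarrow> 'v scomplex \<Rightarrow> ('v \<Rightarrow> 'v) \<Rightarrow> ('v \<Rightarrow> nat) \<Rightarrow> 'v \<Rightarrow> nat"
  where "push_colouring X Y f \<epsilon> =
    (\<lambda>w\<in>set (verts Y). if w \<in> f ` set (verts X) then \<epsilon> (inv_into (set (verts X)) f w) else 1)"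

definition induced_h ::
    "'v scomplex \<Rightarrow> 'v scomplex \<Rightarrow> 'r ring \<Rightarrow> 'r ring \<Rightarrow> ('v \<Rightarrow> 'v) \<Rightarrow> ('r \<Rightarrow> 'r) \<Rightarrow> ('v \<Rightarrow> nat)
      \<Rightarrow> ('v set \<Rightarrow> 'r) set \<Rightarrow> ('v set \<Rightarrow> 'r) set"
  where "induced_h X Y R S f \<phi> \<epsilon> =
    subquotient_map (chain_group X R) (h_cycles X R \<epsilon>) (h_boundaries X R \<epsilon>)
      (chain_group Y S) (h_boundaries Y S (push_colouring X Y f \<epsilon>)) (induced_chain X Y S f \<phi>)"

text \<open>The sign assignments chosen on \<open>X\<close> and on \<open>Y\<close> are unrelated. Transported along
  \<open>push_colouring\<close>, they differ by the coboundary of a function on the Boolean poset of \<open>X\<close>,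
  unique once it is normalised at the top element.\<close>

definition sign_correction ::
    "(('v \<Rightarrow> nat) \<Rightarrow> ('v \<Rightarrow> nat) \<Rightarrow> bit) \<Rightarrow> (('v \<Rightarrow> nat) \<Rightarrow> ('v \<Rightarrow> nat) \<Rightarrow> bit)
      \<Rightarrow> 'v scomplex \<Rightarrow> 'v scomplex \<Rightarrow> ('v \<Rightarrow> 'v) \<Rightarrow> ('v \<Rightarrow> nat) \<Rightarrow> bit"
  where "sign_correction s t X Y f =
    (THE \<eta>. \<eta> \<in> extensional (colourings X) \<and>
      \<eta> (\<lambda>v\<in>set (verts X). 1) = 0 \<and>
      (\<forall>\<epsilon> \<epsilon>'. covers X \<epsilon> \<epsilon>' \<longrightarrow>
        \<eta> \<epsilon> + \<eta> \<epsilon>' = s \<epsilon> \<epsilon>' + t (push_colouring X Y f \<epsilon>) (push_colouring X Y f \<epsilon>')))"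

definition vertex_excess :: "'v scomplex \<Rightarrow> 'v scomplex \<Rightarrow> int"
  where "vertex_excess X Y = int (length (verts Y)) - int (length (verts X))"

definition induced_uchain ::
    "(('v \<Rightarrow> nat) \<Rightarrow> ('v \<Rightarrow> nat) \<Rightarrow> bit) \<Rightarrow> (('v \<Rightarrow> nat) \<Rightarrow> ('v \<Rightarrow> nat) \<Rightarrow> bit)
      \<Rightarrow> 'v scomplex \<Rightarrow> 'v scomplex \<Rightarrow> 'r ring \<Rightarrow> 'r ring \<Rightarrow> ('v \<Rightarrow> 'v) \<Rightarrow> ('r \<Rightarrow> 'r) \<Rightarrow> int
      \<Rightarrow> ('v, 'r) uchain \<Rightarrow> ('v, 'r) uchain"
  where "induced_uchain s t X Y R S f \<phi> j x =
    (\<lambda>\<epsilon>'\<in>{\<epsilon>' \<in> colourings Y. ell Y \<epsilon>' = j + vertex_excess X Y}.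
      finprod (h_homology Y S \<epsilon>')
        (\<lambda>\<epsilon>. signed (h_homology Y S \<epsilon>') (sign_correction s t X Y f \<epsilon>) (induced_h X Y R S f \<phi> \<epsilon> (x \<epsilon>)))
        {\<epsilon> \<in> colourings X. push_colouring X Y f \<epsilon> = \<epsilon>'})"

text \<open>The object and arrow parts of the functor, for a choice \<open>s\<close> of a sign assignment on
  every complex.\<close>

definition uber_obj ::
    "('v scomplex \<Rightarrow> ('v \<Rightarrow> nat) \<Rightarrow> ('v \<Rightarrow> nat) \<Rightarrow> bit) \<Rightarrow> 'v scomplex \<times> 'r ring
      \<Rightarrow> int \<Rightarrow> ('v, 'r) uchain set monoid"
  where "uber_obj s = (\<lambda>(X, R). uberhomology (s X) X R)"

definition uber_map ::
    "('v scomplex \<Rightarrow> ('v \<Rightarrow> nat) \<Rightarrow> ('v \<Rightarrow> nat) \<Rightarrow> bit)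
      \<Rightarrow> 'v scomplex \<times> 'r ring \<Rightarrow> 'v scomplex \<times> 'r ring \<Rightarrow> ('v \<Rightarrow> 'v) \<times> ('r \<Rightarrow> 'r)
      \<Rightarrow> int \<times> (int \<Rightarrow> ('v, 'r) uchain set \<Rightarrow> ('v, 'r) uchain set)"
  where "uber_map s = (\<lambda>(X, R) (Y, S) (f, \<phi>).
    (vertex_excess X Y,
     \<lambda>j. subquotient_map (uber_chains X R j) (uber_cycles (s X) X R j) (uber_boundaries (s X) X R j)
           (uber_chains Y S (j + vertex_excess X Y))
           (uber_boundaries (s Y) Y S (j + vertex_excess X Y))
           (induced_uchain (s X) (s Y) X Y R S f \<phi> j)))"

end

theory Submission
  imports Defs
begin

text \<open>The induced map is built in two stages, and each stage is an instance of the same linear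
  algebra.

  At the level of horizontal homology, the chain map \<open>f\<^sub>#\<close> sends a simplex to its
  image, with the sign of the sorting permutation and with coefficients mapped by \<open>\<phi>\<close>.
  If a colouring \<open>\<epsilon>\<close> of \<open>X\<close> is transported to the image of
  \<open>f\<close> and extended by the colour 1 to a colouring \<open>push \<epsilon>\<close> of
  \<open>Y\<close>, then \<open>f\<^sub>#\<close> preserves weights, hence commutes with the horizontal
  boundaries (\<open>induced_chain_boundary\<close>) and with the connecting maps
  (\<open>induced_h_connecting\<close>). The signs work out because inversions can be counted pair by
  pair (\<open>shuffle_sign_insert\<close>, \<open>shuffle_sign_comp\<close>).

  At the level of ueber-chains, the summand of \<open>\<epsilon>\<close> is sent to that of
  \<open>push \<epsilon>\<close>. Since every vertex of colour 0 of \<open>push \<epsilon>\<close> lies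
  in the image of \<open>f\<close>, the colourings that cover \<open>push \<epsilon>\<close> are exactly
  the extensions of those that cover \<open>\<epsilon>\<close> (\<open>covers_push\<close>), so the
  differential does not lead out of the image. The sign assignments on \<open>X\<close> and
  \<open>Y\<close> differ by a cocycle on the Boolean poset, which is a coboundary
  (\<open>cocycle_potential\<close>); its potential, normalised at the top, is unique, and multiplying
  by it turns the transport of homology classes into a chain map (\<open>induced_uchain_diff\<close>).
  Uniqueness also makes the corrections of composable maps add up (\<open>sign_correction_comp\<close>),
  which gives functoriality.

  Both stages concern maps between products of groups that are given by matrices of homomorphisms. That
  a matrix squares to zero follows from a sign-reversing involution on two-step paths
  (\<open>matrix_map_square_zero\<close>), and the induced maps are monomial matrices, for which the
  identity and composition laws and the compatibility with the differential are proved once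
  (\<open>monomial_map_id\<close>, \<open>monomial_map_comp\<close>,
  \<open>monomial_map_commute\<close>).

  The map raises the degree by the number of vertices of \<open>Y\<close> outside the image. This excess
  is additive and never negative, so the components of degree zero also form a functor
  (\<open>degree_zero_part_functor\<close>).\<close>

section \<open>Finite products and signs in commutative groups\<close>

lemma comm_group_imp_group: "comm_group G \<Longrightarrow> group G"
  by (simp add: comm_group_def)

lemma hom_finprod:
  assumes "comm_group G" "comm_group H" "h \<in> hom G H" "f \<in> A \<rightarrow> carrier G"
  shows "h (finprod G f A) = finprod H (\<lambda>a. h (f a)) A"
proof -
  interpret G: comm_group G by fact
  interpret H: comm_group H by fact
  interpret group_hom G H h using assms(3) by unfold_locales
  show ?thesis
    using assms(4)
  proof (induct A rule: infinite_finite_induct)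
    case (insert a A)
    then have "f \<in> A \<rightarrow> carrier G" "f a \<in> carrier G" by auto
    moreover from this have "(\<lambda>a. h (f a)) \<in> A \<rightarrow> carrier H" "h (f a) \<in> carrier H"
      by (auto simp: Pi_iff)
    ultimately show ?case using insert by simp
  qed simp_all
qed

lemma (in comm_monoid) finprod_Sigma:
  assumes "finite A" "\<And>a. a \<in> A \<Longrightarrow> finite (B a)"
    and "\<And>a b. a \<in> A \<Longrightarrow> b \<in> B a \<Longrightarrow> f a b \<in> carrier G"
  shows "finprod G (\<lambda>a. finprod G (f a) (B a)) A = finprod G (\<lambda>(a, b). f a b) (Sigma A B)"
  using assms
proof (induct A rule: finite_induct)
  case (insert a A)
  have 1: "finprod G (f a) (B a) = finprod G (\<lambda>(a, b). f a b) ({a} \<times> B a)"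
  proof -
    have "finprod G (\<lambda>(a, b). f a b) (Pair a ` B a) = finprod G (\<lambda>b. (\<lambda>(a, b). f a b) (a, b)) (B a)"
      using insert.prems by (intro finprod_reindex) (auto simp: inj_on_def)
    moreover have "Pair a ` B a = {a} \<times> B a" by auto
    ultimately show ?thesis by simp
  qed
  have "Sigma (insert a A) B = {a} \<times> B a \<union> Sigma A B" by auto
  then have "finprod G (\<lambda>(a, b). f a b) (Sigma (insert a A) B)
      = finprod G (\<lambda>(a, b). f a b) ({a} \<times> B a) \<otimes> finprod G (\<lambda>(a, b). f a b) (Sigma A B)"
    using insert by (simp only:) (rule finprod_Un_disjoint; auto)
  moreover have "finprod G (\<lambda>a. finprod G (f a) (B a)) (insert a A)
    = finprod G (f a) (B a) \<otimes> finprod G (\<lambda>a. finprod G (f a) (B a)) A"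
    using insert by (intro finprod_insert) (auto intro!: finprod_closed)
  ultimately show ?case using insert 1 by simp
qed simp

text \<open>Every proof of \<open>d\<^sup>2 = 0\<close> below ends here. Cancelling along a free
  involution, rather than comparing the product with its own inverse, is what makes the argument valid
  in the presence of 2-torsion.\<close>

lemma (in comm_group) finprod_involution:
  assumes "finite A" "f \<in> A \<rightarrow> carrier G"
    and "\<And>a. a \<in> A \<Longrightarrow> \<iota> a \<in> A" "\<And>a. a \<in> A \<Longrightarrow> \<iota> (\<iota> a) = a" "\<And>a. a \<in> A \<Longrightarrow> \<iota> a \<noteq> a"
    and "\<And>a. a \<in> A \<Longrightarrow> f a \<otimes> f (\<iota> a) = \<one>"
  shows "finprod G f A = \<one>"
  using assms
proof (induct A rule: finite_psubset_induct)
  case (psubset A)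
  show ?case
  proof (cases "A = {}")
    case False
    then obtain a where a: "a \<in> A" by auto
    note fA = psubset.prems(1) and inA = psubset.prems(2) and inv = psubset.prems(3)
      and nofix = psubset.prems(4) and cancel = psubset.prems(5)
    define A' where "A' = A - {a, \<iota> a}"
    have a': "\<iota> a \<in> A" "\<iota> a \<noteq> a" using inA[OF a] nofix[OF a] .
    have A: "A = insert a (insert (\<iota> a) A')" using a a' by (auto simp: A'_def)
    have ins: "\<iota> b \<in> A'" if "b \<in> A'" for b
      using that inA[of b] inv[of b] inv[OF a] unfolding A'_def by (metis Diff_iff empty_iff insert_iff)
    have sub: "A' \<subseteq> A" by (auto simp: A'_def)
    have "finprod G f A' = \<one>"
    proof (rule psubset.hyps)
      show "A' \<subset> A" using a by (auto simp: A'_def)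
      show "f \<in> A' \<rightarrow> carrier G" using fA sub by (simp add: Pi_iff subset_iff)
      show "\<iota> b \<in> A'" "\<iota> (\<iota> b) = b" "\<iota> b \<noteq> b" "f b \<otimes> f (\<iota> b) = \<one>" if "b \<in> A'" for b
        using ins[OF that] inv[of b] nofix[of b] cancel[of b] that sub by blast+
    qed
    moreover have "f \<in> A' \<rightarrow> carrier G" using fA sub by (simp add: Pi_iff subset_iff)
    moreover have "f a \<in> carrier G" "f (\<iota> a) \<in> carrier G"
      using fA a a' by (simp_all add: Pi_iff)
    moreover have "finite A'" using finite_subset[OF sub psubset.hyps(1)] .
    moreover have "a \<notin> insert (\<iota> a) A'" "\<iota> a \<notin> A'" using a' by (auto simp: A'_def)
    ultimately show ?thesis unfolding A using cancel[OF a] by simp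
  qed simp
qed

lemma signed_zero [simp]: "signed G 0 x = x"
  by (simp add: signed_def)

lemma bit_cases: "(b::bit) = 0 \<or> b = 1"
  by (cases b) auto

lemma signed_closed [simp]: "group G \<Longrightarrow> x \<in> carrier G \<Longrightarrow> signed G b x \<in> carrier G"
  by (simp add: signed_def)

lemma signed_one [simp]: "group G \<Longrightarrow> signed G b \<one>\<^bsub>G\<^esub> = \<one>\<^bsub>G\<^esub>"
  by (simp add: signed_def group.is_monoid monoid.inv_one)

lemma signed_hom: "comm_group G \<Longrightarrow> signed G b \<in> hom G G"
  by (auto simp: signed_def hom_def comm_group.inv_mult comm_group_imp_group)

lemma signed_signed:
  assumes "group G" "x \<in> carrier G"
  shows "signed G a (signed G b x) = signed G (a + b) x"
  using bit_cases[of a] bit_cases[of b] assms by (auto simp: signed_def)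

lemma signed_cancel:
  assumes "group G" "x \<in> carrier G"
  shows "signed G b x \<otimes>\<^bsub>G\<^esub> signed G (b + 1) x = \<one>\<^bsub>G\<^esub>"
  using bit_cases[of b] assms by (auto simp: signed_def group.r_inv group.l_inv)

lemma hom_signed:
  assumes "group G" "group H" "h \<in> hom G H" "x \<in> carrier G"
  shows "h (signed G b x) = signed H b (h x)"
proof -
  interpret group_hom G H h
    by (rule group_hom.intro) (use assms in \<open>auto simp: group_hom_axioms_def\<close>)
  show ?thesis using assms by (simp add: signed_def)
qed

section \<open>Subquotients\<close>

locale subquotient_pair = comm_group G for G :: "'g monoid" (structure) and Z B +
  assumes subgroup_Z: "subgroup Z G" and subgroup_B: "subgroup B G" and B_subset: "B \<subseteq> Z"
begin

lemma Z_carrier: "z \<in> Z \<Longrightarrow> z \<in> carrier G"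
  using subgroup_Z by (rule subgroup.mem_carrier)

lemma comm_group_Z: "comm_group (G\<lparr>carrier := Z\<rparr>)"
proof (rule group.group_comm_groupI)
  show "group (G\<lparr>carrier := Z\<rparr>)"
    using subgroup_Z group_axioms by (rule subgroup.subgroup_is_group)
  show "x \<otimes>\<^bsub>G\<lparr>carrier := Z\<rparr>\<^esub> y = y \<otimes>\<^bsub>G\<lparr>carrier := Z\<rparr>\<^esub> x"
    if "x \<in> carrier (G\<lparr>carrier := Z\<rparr>)" "y \<in> carrier (G\<lparr>carrier := Z\<rparr>)" for x y
    using m_comm[of x y] that Z_carrier by simp
qed

lemma normal_B: "B \<lhd> G\<lparr>carrier := Z\<rparr>"
proof -
  interpret Z: comm_group "G\<lparr>carrier := Z\<rparr>" by (rule comm_group_Z)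
  show ?thesis
    by (rule Z.subgroup_imp_normal)
      (use subgroup_B subgroup_Z B_subset in \<open>simp add: subgroup_incl\<close>)
qed

lemma comm_group_subquotient: "comm_group (subquotient G Z B)"
proof -
  interpret Z: comm_group "G\<lparr>carrier := Z\<rparr>" by (rule comm_group_Z)
  show ?thesis
    unfolding subquotient_def
    by (rule Z.abelian_FactGroup)
      (use normal_B in \<open>simp add: normal_imp_subgroup\<close>)
qed

lemma carrier_subquotient: "carrier (subquotient G Z B) = (\<lambda>z. B #> z) ` Z"
  by (simp add: subquotient_def carrier_FactGroup)

lemma class_hom: "(\<lambda>z. B #> z) \<in> hom (G\<lparr>carrier := Z\<rparr>) (subquotient G Z B)"
  using normal.r_coset_hom_Mod[OF normal_B] by (simp add: subquotient_def)

lemma class_mult: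
  "z \<in> Z \<Longrightarrow> z' \<in> Z \<Longrightarrow> (B #> z) \<otimes>\<^bsub>subquotient G Z B\<^esub> (B #> z') = B #> (z \<otimes> z')"
  using hom_mult[OF class_hom] by simp

lemma subquotient_map_class:
  assumes "subquotient_pair H Z' B'" "f \<in> hom G H" "f ` B \<subseteq> B'" "z \<in> Z"
  shows "subquotient_map G Z B H B' f (B #> z) = B' #>\<^bsub>H\<^esub> f z"
proof -
  interpret H: subquotient_pair H Z' B' by fact
  have z: "z \<in> carrier G" using assms(4) Z_carrier by blast
  have "B' #>\<^bsub>H\<^esub> f y = B' #>\<^bsub>H\<^esub> f z" if y: "y \<in> B #> z" for y
  proof -
    obtain b where b: "b \<in> B" "y = b \<otimes> z" using y unfolding r_coset_def by blast
    then have bc: "b \<in> carrier G" using B_subset Z_carrier by blast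
    have "f y = f b \<otimes>\<^bsub>H\<^esub> f z" using b bc z assms(2) by (simp add: hom_mult)
    then have "f y \<in> B' #>\<^bsub>H\<^esub> f z" using b assms(3) by (auto simp: r_coset_def)
    then show ?thesis
      using H.repr_independence[of "f y" B' "f z"] hom_in_carrier[OF assms(2) z] H.subgroup_B
      by simp
  qed
  moreover have "z \<in> B #> z"
    using z subgroup_B by (simp add: rcos_self)
  ultimately have "(\<lambda>z. B' #>\<^bsub>H\<^esub> f z) ` (B #> z) = {B' #>\<^bsub>H\<^esub> f z}" by blast
  then show ?thesis
    using assms(4) by (simp add: subquotient_map_def carrier_subquotient)
qed

lemma subquotient_map_hom:
  assumes "subquotient_pair H Z' B'" "f \<in> hom G H" "f ` Z \<subseteq> Z'" "f ` B \<subseteq> B'"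
  shows "subquotient_map G Z B H B' f \<in> hom (subquotient G Z B) (subquotient H Z' B')"
proof -
  interpret H: subquotient_pair H Z' B' by fact
  note cl = subquotient_map_class[OF assms(1,2,4)]
  show ?thesis
  proof (rule homI)
    fix x assume "x \<in> carrier (subquotient G Z B)"
    then show "subquotient_map G Z B H B' f x \<in> carrier (subquotient H Z' B')"
      using assms(3) by (auto simp: carrier_subquotient H.carrier_subquotient cl)
  next
    fix x y assume "x \<in> carrier (subquotient G Z B)" "y \<in> carrier (subquotient G Z B)"
    then obtain a b where ab: "x = B #> a" "y = B #> b" "a \<in> Z" "b \<in> Z"
      by (auto simp: carrier_subquotient)
    have "f (a \<otimes> b) = f a \<otimes>\<^bsub>H\<^esub> f b" using assms(2) ab Z_carrier by (simp add: hom_mult)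
    moreover have "a \<otimes> b \<in> Z" using ab subgroup_Z by (simp add: subgroup.m_closed)
    moreover have "f a \<in> Z'" "f b \<in> Z'" using ab assms(3) by auto
    ultimately show "subquotient_map G Z B H B' f (x \<otimes>\<^bsub>subquotient G Z B\<^esub> y)
        = subquotient_map G Z B H B' f x \<otimes>\<^bsub>subquotient H Z' B'\<^esub> subquotient_map G Z B H B' f y"
      using ab by (simp add: class_mult cl H.class_mult)
  qed
qed

lemma subquotient_map_id:
  assumes "\<And>z. z \<in> carrier G \<Longrightarrow> f z = z" "x \<in> carrier (subquotient G Z B)"
  shows "subquotient_map G Z B G B f x = x"
proof -
  have "f \<in> hom G G" using assms(1) by (simp add: hom_def)
  moreover have "f ` B \<subseteq> B"
    using assms(1) B_subset Z_carrier by (simp add: image_subset_iff subset_iff)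
  ultimately have "subquotient_map G Z B G B f (B #> z) = B #> f z" if "z \<in> Z" for z
    using subquotient_map_class[OF subquotient_pair_axioms] that by blast
  moreover obtain z where "z \<in> Z" "x = B #> z" using assms(2) by (auto simp: carrier_subquotient)
  ultimately show ?thesis using assms(1) Z_carrier by simp
qed

end

text \<open>The composite enters as a third map \<open>h\<close> that need agree with it only on the
  carrier, so that the map of a composite arrow may be inserted for it. For the same reason the lemma
  also serves to compare two factorisations of one \<open>h\<close>, which is how commuting squares of
  chain maps become commuting squares in homology.\<close>

lemma subquotient_map_comp:
  assumes "subquotient_pair G Z B" "subquotient_pair H Z' B'" "subquotient_pair K Z'' B''"
    and f: "f \<in> hom G H" "f ` Z \<subseteq> Z'" "f ` B \<subseteq> B'"
    and g: "g \<in> hom H K" "g ` B' \<subseteq> B''"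
    and h: "\<And>z. z \<in> carrier G \<Longrightarrow> h z = g (f z)"
    and x: "x \<in> carrier (subquotient G Z B)"
  shows "subquotient_map G Z B K B'' h x
    = subquotient_map H Z' B' K B'' g (subquotient_map G Z B H B' f x)"
proof -
  interpret G: subquotient_pair G Z B by fact
  interpret H: subquotient_pair H Z' B' by fact
  have "h (x \<otimes>\<^bsub>G\<^esub> y) = h x \<otimes>\<^bsub>K\<^esub> h y" "h x \<in> carrier K"
    if "x \<in> carrier G" "y \<in> carrier G" for x y
    using that by (simp_all add: h hom_mult[OF f(1)] hom_mult[OF g(1)] hom_in_carrier[OF f(1)]
        hom_in_carrier[OF g(1)])
  then have hh: "h \<in> hom G K" by (intro homI) auto
  have "h b \<in> B''" if "b \<in> B" for b
    using that h[of b] f(3) g(2) G.B_subset G.Z_carrier[of b] by (simp add: image_subset_iff subset_iff)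
  then have hB: "h ` B \<subseteq> B''" by auto
  obtain z where z: "z \<in> Z" "x = B #>\<^bsub>G\<^esub> z" using x by (auto simp: G.carrier_subquotient)
  then have fz: "f z \<in> Z'" using f by auto
  have "subquotient_map G Z B K B'' h x = B'' #>\<^bsub>K\<^esub> h z"
    using z G.subquotient_map_class[OF assms(3) hh hB] by simp
  moreover have "subquotient_map G Z B H B' f x = B' #>\<^bsub>H\<^esub> f z"
    using z G.subquotient_map_class[OF assms(2) f(1,3)] by simp
  ultimately show ?thesis
    using h[OF G.Z_carrier[OF z(1)]] H.subquotient_map_class[OF assms(3) g fz] by simp
qed

lemma subquotient_pair_complex:
  assumes "comm_group F" "comm_group G" "comm_group H"
    and "d \<in> hom F G" "e \<in> hom G H" "\<And>x. x \<in> carrier F \<Longrightarrow> e (d x) = \<one>\<^bsub>H\<^esub>"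
  shows "subquotient_pair G (kernel G H e) (d ` carrier F)"
proof -
  interpret F: comm_group F by fact
  interpret G: comm_group G by fact
  interpret H: comm_group H by fact
  interpret d: group_hom F G d using assms by unfold_locales
  interpret e: group_hom G H e using assms by unfold_locales
  show ?thesis
    by (intro subquotient_pair.intro subquotient_pair_axioms.intro)
      (use assms(2,6) e.subgroup_kernel d.img_is_subgroup in \<open>auto simp: kernel_def\<close>)
qed

lemma chain_map_kernel:
  assumes "comm_group H" "comm_group H'" "f \<in> hom G G'" "g \<in> hom H H'"
    and "\<And>x. x \<in> carrier G \<Longrightarrow> g (e x) = e' (f x)"
  shows "f ` kernel G H e \<subseteq> kernel G' H' e'"
proof -
  have "g \<one>\<^bsub>H\<^esub> = \<one>\<^bsub>H'\<^esub>"
    using assms by (intro hom_one) (auto simp: comm_group_imp_group)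
  then have "e' (f x) = \<one>\<^bsub>H'\<^esub>" if "x \<in> kernel G H e" for x
    using that assms(5)[of x] by (simp add: kernel_def)
  moreover have "f x \<in> carrier G'" if "x \<in> kernel G H e" for x
    using that assms(3) by (simp add: kernel_def hom_in_carrier)
  ultimately show ?thesis by (auto simp: kernel_def)
qed

lemma chain_map_image:
  assumes "h \<in> hom F F'"
    and "\<And>x. x \<in> carrier F \<Longrightarrow> f (d x) = d' (h x)"
  shows "f ` (d ` carrier F) \<subseteq> d' ` carrier F'"
  using assms by (auto simp: hom_in_carrier)

section \<open>Homomorphisms given by matrices\<close>

lemma comm_group_product_group:
  assumes "\<And>i. i \<in> I \<Longrightarrow> comm_group (G i)"
  shows "comm_group (product_group I G)"
proof (rule group.group_comm_groupI)
  show "group (product_group I G)"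
    using assms by (simp add: comm_group_imp_group)
  show "x \<otimes>\<^bsub>product_group I G\<^esub> y = y \<otimes>\<^bsub>product_group I G\<^esub> x"
    if "x \<in> carrier (product_group I G)" "y \<in> carrier (product_group I G)" for x y
    using that assms by (auto simp: PiE_iff comm_group_def comm_monoid.m_comm intro!: restrict_ext)
qed

text \<open>Each differential and each induced map of the theory is a matrix of homomorphisms between
  product groups. The entries of the row \<open>j\<close> are indexed by a set \<open>K j\<close> of
  labels, and \<open>src j k\<close> is the column of the entry labelled \<open>k\<close>. Labels
  instead of columns allow a face \<open>\<tau>\<close> of a simplex to be paired with the missing
  vertex, which is how the simplicial boundary is written.\<close>

definition matrix_map ::
    "'j set \<Rightarrow> ('j \<Rightarrow> 'k set) \<Rightarrow> ('j \<Rightarrow> 'k \<Rightarrow> 'i) \<Rightarrow> ('j \<Rightarrow> 'k \<Rightarrow> 'g \<Rightarrow> 'h) \<Rightarrow> ('j \<Rightarrow> ('h, 'm) monoid_scheme)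
      \<Rightarrow> ('i \<Rightarrow> 'g) \<Rightarrow> 'j \<Rightarrow> 'h"
  where "matrix_map J K src D H x = (\<lambda>j\<in>J. finprod (H j) (\<lambda>k. D j k (x (src j k))) (K j))"

locale group_matrix =
  fixes I :: "'i set" and G :: "'i \<Rightarrow> ('g, 'a) monoid_scheme"
    and J :: "'j set" and H :: "'j \<Rightarrow> ('h, 'b) monoid_scheme"
    and K :: "'j \<Rightarrow> 'k set" and src :: "'j \<Rightarrow> 'k \<Rightarrow> 'i" and D :: "'j \<Rightarrow> 'k \<Rightarrow> 'g \<Rightarrow> 'h"
  assumes comm_dom: "i \<in> I \<Longrightarrow> comm_group (G i)"
    and comm_cod: "j \<in> J \<Longrightarrow> comm_group (H j)"
    and finite_K: "j \<in> J \<Longrightarrow> finite (K j)"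
    and src: "j \<in> J \<Longrightarrow> k \<in> K j \<Longrightarrow> src j k \<in> I"
    and entry_hom: "j \<in> J \<Longrightarrow> k \<in> K j \<Longrightarrow> D j k \<in> hom (G (src j k)) (H j)"
begin

abbreviation "mmap \<equiv> matrix_map J K src D H"

lemma entry_closed:
  assumes "x \<in> carrier (product_group I G)" "j \<in> J" "k \<in> K j"
  shows "D j k (x (src j k)) \<in> carrier (H j)"
  using assms src[of j k] hom_in_carrier[OF entry_hom[of j k]] by (auto simp: PiE_iff)

lemma matrix_map_at:
  "j \<in> J \<Longrightarrow> mmap x j = finprod (H j) (\<lambda>k. D j k (x (src j k))) (K j)"
  by (simp add: matrix_map_def)

lemma matrix_map_closed:
  assumes "x \<in> carrier (product_group I G)"
  shows "mmap x \<in> carrier (product_group J H)"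
  using entry_closed[OF assms] comm_cod
  by (auto simp: matrix_map_def comm_group_def intro!: comm_monoid.finprod_closed)

lemma matrix_map_hom: "mmap \<in> hom (product_group I G) (product_group J H)"
proof (rule homI)
  fix x y assume x: "x \<in> carrier (product_group I G)" and y: "y \<in> carrier (product_group I G)"
  have "mmap (x \<otimes>\<^bsub>product_group I G\<^esub> y) j = mmap x j \<otimes>\<^bsub>H j\<^esub> mmap y j" if j: "j \<in> J" for j
  proof -
    interpret H: comm_group "H j" using j by (rule comm_cod)
    have "D j k ((x \<otimes>\<^bsub>product_group I G\<^esub> y) (src j k))
        = D j k (x (src j k)) \<otimes>\<^bsub>H j\<^esub> D j k (y (src j k))" if k: "k \<in> K j" for k
      using x y src[OF j k] hom_mult[OF entry_hom[OF j k], of "x (src j k)" "y (src j k)"]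
      by (auto simp: PiE_iff)
    then have "mmap (x \<otimes>\<^bsub>product_group I G\<^esub> y) j
        = finprod (H j) (\<lambda>k. D j k (x (src j k)) \<otimes>\<^bsub>H j\<^esub> D j k (y (src j k))) (K j)"
      unfolding matrix_map_at[OF j]
      using entry_closed[OF x j] entry_closed[OF y j] by (intro H.finprod_cong') auto
    moreover have "(\<lambda>k. D j k (x (src j k))) \<in> K j \<rightarrow> carrier (H j)"
        "(\<lambda>k. D j k (y (src j k))) \<in> K j \<rightarrow> carrier (H j)"
      using entry_closed[OF x j] entry_closed[OF y j] by auto
    ultimately show ?thesis
      by (simp only: matrix_map_at[OF j] H.finprod_multf)
  qed
  then have "mmap (x \<otimes>\<^bsub>product_group I G\<^esub> y) = (\<lambda>j\<in>J. mmap x j \<otimes>\<^bsub>H j\<^esub> mmap y j)"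
    by (intro extensionalityI[of _ J]) (auto simp: matrix_map_def)
  then show "mmap (x \<otimes>\<^bsub>product_group I G\<^esub> y) = mmap x \<otimes>\<^bsub>product_group J H\<^esub> mmap y"
    by simp
qed (rule matrix_map_closed)

end

text \<open>A product of two matrices vanishes if the two-step paths that end in a given row can be
  paired so that paired paths start in the same column and have opposite composites. For the simplicial
  boundary the paths are the two orders of removing two vertices; for ueberhomology they are the two
  ways around a square of colourings.\<close>

lemma matrix_map_square_zero:
  assumes "group_matrix I G J H K src D" "group_matrix J H L M K' src' E"
    and inv: "\<And>l k' k. l \<in> L \<Longrightarrow> k' \<in> K' l \<Longrightarrow> k \<in> K (src' l k') \<Longrightarrow>
      \<exists>m' m. \<iota> l (k', k) = (m', m) \<and> \<iota> l (m', m) = (k', k) \<and> (m', m) \<noteq> (k', k) \<and> m' \<in> K' l \<and> m \<in> K (src' l m')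
        \<and> src (src' l m') m = src (src' l k') k
        \<and> (\<forall>g \<in> carrier (G (src (src' l k') k)).
             E l k' (D (src' l k') k g) \<otimes>\<^bsub>M l\<^esub> E l m' (D (src' l m') m g) = \<one>\<^bsub>M l\<^esub>)"
    and x: "x \<in> carrier (product_group I G)"
  shows "matrix_map L K' src' E M (matrix_map J K src D H x) = \<one>\<^bsub>product_group L M\<^esub>"
proof -
  interpret D: group_matrix I G J H K src D by fact
  interpret E: group_matrix J H L M K' src' E by fact
  have "finprod (M l) (\<lambda>k'. E l k' (D.mmap x (src' l k'))) (K' l) = \<one>\<^bsub>M l\<^esub>" if l: "l \<in> L" for l
  proof -
    interpret M: comm_group "M l" using l by (rule E.comm_cod)
    define f where "f k' k = E l k' (D (src' l k') k (x (src (src' l k') k)))" for k' k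
    have f: "f k' k \<in> carrier (M l)" if "k' \<in> K' l" "k \<in> K (src' l k')" for k' k
      unfolding f_def using D.entry_closed[OF x E.src[OF l that(1)] that(2)]
        hom_in_carrier[OF E.entry_hom[OF l that(1)]] by blast
    have "E l k' (D.mmap x (src' l k')) = finprod (M l) (f k') (K (src' l k'))" if "k' \<in> K' l" for k'
      unfolding D.matrix_map_at[OF E.src[OF l that]] f_def
      using D.entry_closed[OF x E.src[OF l that]]
      by (intro hom_finprod[OF D.comm_cod[OF E.src[OF l that]] M.comm_group_axioms E.entry_hom[OF l that]])
        auto
    then have "finprod (M l) (\<lambda>k'. E l k' (D.mmap x (src' l k'))) (K' l)
        = finprod (M l) (\<lambda>k'. finprod (M l) (f k') (K (src' l k'))) (K' l)"
      using f by (intro M.finprod_cong') (auto intro!: M.finprod_closed)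
    also have "\<dots> = finprod (M l) (\<lambda>(k', k). f k' k) (SIGMA k':K' l. K (src' l k'))"
      using E.finite_K[OF l] D.finite_K[OF E.src[OF l]] f by (intro M.finprod_Sigma) auto
    also have "\<dots> = \<one>\<^bsub>M l\<^esub>"
    proof (rule M.finprod_involution[where \<iota> = "\<iota> l"])
      show "finite (SIGMA k':K' l. K (src' l k'))"
        using E.finite_K[OF l] D.finite_K[OF E.src[OF l]] by auto
      show "(\<lambda>(k', k). f k' k) \<in> (SIGMA k':K' l. K (src' l k')) \<rightarrow> carrier (M l)"
        using f by auto
      fix a assume "a \<in> (SIGMA k':K' l. K (src' l k'))"
      then obtain k' k where a: "a = (k', k)" and k: "k' \<in> K' l" "k \<in> K (src' l k')" by auto
      obtain m' m where m: "\<iota> l (k', k) = (m', m)" "\<iota> l (m', m) = (k', k)" "(m', m) \<noteq> (k', k)"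
          "m' \<in> K' l" "m \<in> K (src' l m')" "src (src' l m') m = src (src' l k') k"
        and c: "\<And>g. g \<in> carrier (G (src (src' l k') k)) \<Longrightarrow>
             E l k' (D (src' l k') k g) \<otimes>\<^bsub>M l\<^esub> E l m' (D (src' l m') m g) = \<one>\<^bsub>M l\<^esub>"
        using inv[OF l k] by blast
      show "\<iota> l a \<in> (SIGMA k':K' l. K (src' l k'))" "\<iota> l (\<iota> l a) = a" "\<iota> l a \<noteq> a"
        using a m by auto
      have "x (src (src' l k') k) \<in> carrier (G (src (src' l k') k))"
        using x D.src[OF E.src[OF l k(1)] k(2)] by (auto simp: PiE_iff)
      then show "(case a of (k', k) \<Rightarrow> f k' k) \<otimes>\<^bsub>M l\<^esub> (case \<iota> l a of (k', k) \<Rightarrow> f k' k) = \<one>\<^bsub>M l\<^esub>"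
        using c m by (simp add: a f_def)
    qed
    finally show ?thesis .
  qed
  then show ?thesis by (auto simp: matrix_map_def[of L] intro!: restrict_ext)
qed

text \<open>A matrix with at most one entry in each row and exactly one in each column, along an
  injection \<open>p\<close> of the index sets. The map of chains induced by an injective simplicial map
  has this form, with \<open>p\<close> the image of simplices, and so has the map of ueber-chains, with
  \<open>p\<close> the extension of colourings.\<close>

definition monomial_map ::
    "'i set \<Rightarrow> 'j set \<Rightarrow> ('i \<Rightarrow> 'j) \<Rightarrow> ('i \<Rightarrow> 'g \<Rightarrow> 'h) \<Rightarrow> ('j \<Rightarrow> ('h, 'm) monoid_scheme)
      \<Rightarrow> ('i \<Rightarrow> 'g) \<Rightarrow> 'j \<Rightarrow> 'h"
  where "monomial_map I J p M H = matrix_map J (\<lambda>j. {i \<in> I. p i = j}) (\<lambda>j i. i) (\<lambda>j. M) H"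

locale monomial_matrix =
  fixes I :: "'i set" and G :: "'i \<Rightarrow> ('g, 'a) monoid_scheme"
    and J :: "'j set" and H :: "'j \<Rightarrow> ('h, 'b) monoid_scheme"
    and p :: "'i \<Rightarrow> 'j" and M :: "'i \<Rightarrow> 'g \<Rightarrow> 'h"
  assumes comm_dom: "i \<in> I \<Longrightarrow> comm_group (G i)"
    and comm_cod: "j \<in> J \<Longrightarrow> comm_group (H j)"
    and p_in: "i \<in> I \<Longrightarrow> p i \<in> J"
    and p_inj: "inj_on p I"
    and entry_hom: "i \<in> I \<Longrightarrow> M i \<in> hom (G i) (H (p i))"
begin

abbreviation "mmap \<equiv> monomial_map I J p M H"

lemma fibre: "i \<in> I \<Longrightarrow> {i' \<in> I. p i' = p i} = {i}"
  using p_inj by (auto simp: inj_on_def)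

lemma group_matrix: "group_matrix I G J H (\<lambda>j. {i \<in> I. p i = j}) (\<lambda>j i. i) (\<lambda>j. M)"
proof (rule group_matrix.intro)
  fix j assume "j \<in> J"
  show "finite {i \<in> I. p i = j}"
  proof (cases "\<exists>i \<in> I. p i = j")
    case True
    then show ?thesis using fibre by (metis finite.emptyI finite_insert)
  next
    case False
    then have "{i \<in> I. p i = j} \<subseteq> {}" by blast
    then show ?thesis by (rule finite_subset) simp
  qed
qed (use comm_dom comm_cod entry_hom in auto)

lemma monomial_map_hom: "mmap \<in> hom (product_group I G) (product_group J H)"
  unfolding monomial_map_def by (rule group_matrix.matrix_map_hom[OF group_matrix])

lemma monomial_map_at:
  assumes "x \<in> carrier (product_group I G)" "i \<in> I"
  shows "mmap x (p i) = M i (x i)"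
proof -
  interpret H: comm_group "H (p i)" using assms p_in comm_cod by blast
  have "M i (x i) \<in> carrier (H (p i))"
    using assms hom_in_carrier[OF entry_hom[OF assms(2)]] by (auto simp: PiE_iff)
  then show ?thesis
    using assms p_in[OF assms(2)] by (simp add: monomial_map_def matrix_map_def fibre)
qed

lemma monomial_map_off:
  assumes "j \<in> J" "j \<notin> p ` I"
  shows "mmap x j = \<one>\<^bsub>H j\<^esub>"
proof -
  interpret H: comm_group "H j" using assms comm_cod by blast
  have "finprod (H j) (\<lambda>i. M i (x i)) {i \<in> I. p i = j} = \<one>\<^bsub>H j\<^esub>"
    by (rule H.finprod_one_eqI) (use assms in auto)
  then show ?thesis using assms(1) by (simp add: monomial_map_def matrix_map_def)
qed

text \<open>A monomial map is determined by its values on the image of \<open>p\<close>; elsewhere it is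
  trivial.\<close>

lemma monomial_map_eqI:
  assumes "x \<in> carrier (product_group I G)" "y \<in> extensional J"
    and "\<And>i. i \<in> I \<Longrightarrow> y (p i) = M i (x i)"
    and "\<And>j. j \<in> J \<Longrightarrow> j \<notin> p ` I \<Longrightarrow> y j = \<one>\<^bsub>H j\<^esub>"
  shows "mmap x = y"
proof (rule extensionalityI)
  show "mmap x \<in> extensional J" by (simp add: monomial_map_def matrix_map_def)
  fix j assume "j \<in> J"
  then show "mmap x j = y j"
    using assms monomial_map_at[OF assms(1)] monomial_map_off[of j x] by (cases "j \<in> p ` I") auto
qed (rule assms)

end

lemma monomial_map_id:
  assumes "\<And>i. i \<in> I \<Longrightarrow> comm_group (G i)"
    and "\<And>i. i \<in> I \<Longrightarrow> p i = i" "\<And>i g. i \<in> I \<Longrightarrow> g \<in> carrier (G i) \<Longrightarrow> M i g = g"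
    and "x \<in> carrier (product_group I G)"
  shows "monomial_map I I p M G x = x"
proof -
  interpret monomial_matrix I G I G p M
  proof (rule monomial_matrix.intro)
    show "M i \<in> hom (G i) (G (p i))" if "i \<in> I" for i
    proof -
      interpret comm_group "G i" using that by (rule assms(1))
      show ?thesis using that assms(2,3) by (auto simp: hom_def)
    qed
  qed (use assms(1,2) in \<open>auto simp: inj_on_def\<close>)
  show ?thesis
    by (rule monomial_map_eqI) (use assms in \<open>auto simp: PiE_iff\<close>)
qed

lemma monomial_map_comp:
  assumes "monomial_matrix I F J G p M" "monomial_matrix J G K H q N" "monomial_matrix I F K H r L"
    and r: "\<And>i. i \<in> I \<Longrightarrow> r i = q (p i)"
    and L: "\<And>i g. i \<in> I \<Longrightarrow> g \<in> carrier (F i) \<Longrightarrow> L i g = N (p i) (M i g)"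
    and x: "x \<in> carrier (product_group I F)"
  shows "monomial_map I K r L H x = monomial_map J K q N H (monomial_map I J p M G x)"
proof -
  interpret p: monomial_matrix I F J G p M by fact
  interpret q: monomial_matrix J G K H q N by fact
  interpret r: monomial_matrix I F K H r L by fact
  have y: "p.mmap x \<in> carrier (product_group J G)" using hom_in_carrier[OF p.monomial_map_hom x] .
  show ?thesis
  proof (rule r.monomial_map_eqI[OF x])
    show "q.mmap (p.mmap x) \<in> extensional K" by (simp add: monomial_map_def matrix_map_def)
    show "q.mmap (p.mmap x) (r i) = L i (x i)" if "i \<in> I" for i
      using that x p.monomial_map_at[OF x that] q.monomial_map_at[OF y p.p_in[OF that]]
      by (simp add: r L PiE_iff)
    show "q.mmap (p.mmap x) k = \<one>\<^bsub>H k\<^esub>" if k: "k \<in> K" "k \<notin> r ` I" for k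
    proof (cases "k \<in> q ` J")
      case True
      then obtain j where j: "j \<in> J" "k = q j" by auto
      then have "j \<notin> p ` I" using k r by auto
      then have "p.mmap x j = \<one>\<^bsub>G j\<^esub>" using j by (simp add: p.monomial_map_off)
      moreover have "N j \<one>\<^bsub>G j\<^esub> = \<one>\<^bsub>H k\<^esub>"
        using j k by (intro hom_one)
          (auto intro: q.entry_hom q.comm_dom q.comm_cod comm_group_imp_group)
      ultimately show ?thesis using q.monomial_map_at[OF y j(1)] j by simp
    next
      case False
      then show ?thesis using k by (simp add: q.monomial_map_off)
    qed
  qed
qed

text \<open>When a monomial map is a chain map. The entries of the row \<open>i\<close> correspond under
  \<open>q i\<close> to those entries of the row \<open>p' i\<close> whose columns lie in the image of
  \<open>p\<close>, and only such columns carry nontrivial coefficients of the image chain. The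
  assumption \<open>off\<close> is the essential one: no row outside the image of \<open>p'\<close> may
  meet a column inside the image of \<open>p\<close>, because there the other composite is trivial.\<close>

lemma monomial_map_commute:
  assumes "group_matrix I G I' G' K src D" "group_matrix J H J' H' L tgt E"
    and "monomial_matrix I G J H p M" "monomial_matrix I' G' J' H' p' M'"
    and q_in: "\<And>i k. i \<in> I' \<Longrightarrow> k \<in> K i \<Longrightarrow> q i k \<in> L (p' i)"
    and q_inj: "\<And>i. i \<in> I' \<Longrightarrow> inj_on (q i) (K i)"
    and q_src: "\<And>i k. i \<in> I' \<Longrightarrow> k \<in> K i \<Longrightarrow> tgt (p' i) (q i k) = p (src i k)"
    and q_off: "\<And>i l. i \<in> I' \<Longrightarrow> l \<in> L (p' i) \<Longrightarrow> tgt (p' i) l \<in> p ` I \<Longrightarrow> l \<in> q i ` K i"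
    and off: "\<And>j l. j \<in> J' \<Longrightarrow> l \<in> L j \<Longrightarrow> tgt j l \<in> p ` I \<Longrightarrow> j \<in> p' ` I'"
    and entry: "\<And>i k g. i \<in> I' \<Longrightarrow> k \<in> K i \<Longrightarrow> g \<in> carrier (G (src i k)) \<Longrightarrow>
      M' i (D i k g) = E (p' i) (q i k) (M (src i k) g)"
    and x: "x \<in> carrier (product_group I G)"
  shows "monomial_map I' J' p' M' H' (matrix_map I' K src D G' x)
    = matrix_map J' L tgt E H' (monomial_map I J p M H x)"
proof -
  interpret D: group_matrix I G I' G' K src D by fact
  interpret E: group_matrix J H J' H' L tgt E by fact
  interpret p: monomial_matrix I G J H p M by fact
  interpret p': monomial_matrix I' G' J' H' p' M' by fact
  have y: "p.mmap x \<in> carrier (product_group J H)" using hom_in_carrier[OF p.monomial_map_hom x] .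
  have E_off: "E j l (p.mmap x (tgt j l)) = \<one>\<^bsub>H' j\<^esub>"
    if "j \<in> J'" "l \<in> L j" "tgt j l \<notin> p ` I" for j l
    using that E.src[of j l]
    by (auto simp: p.monomial_map_off intro!: hom_one[OF E.entry_hom]
        intro: comm_group_imp_group E.comm_dom E.comm_cod)
  show ?thesis
  proof (rule p'.monomial_map_eqI[OF D.matrix_map_closed[OF x]])
    show "E.mmap (p.mmap x) \<in> extensional J'" by (simp add: matrix_map_def)
  next
    fix j assume j: "j \<in> J'" "j \<notin> p' ` I'"
    then interpret H': comm_group "H' j" by (intro E.comm_cod)
    show "E.mmap (p.mmap x) j = \<one>\<^bsub>H' j\<^esub>"
      unfolding E.matrix_map_at[OF j(1)]
      by (rule H'.finprod_one_eqI, rule E_off) (use j off in auto)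
  next
    fix i assume i: "i \<in> I'"
    have j: "p' i \<in> J'" using p'.p_in[OF i] .
    interpret G': comm_group "G' i" using i by (rule D.comm_cod)
    interpret H': comm_group "H' (p' i)" using j by (rule E.comm_cod)
    let ?e = "\<lambda>l. E (p' i) l (p.mmap x (tgt (p' i) l))"
    have e: "?e l \<in> carrier (H' (p' i))" if "l \<in> L (p' i)" for l
      using E.entry_closed[OF y j that] .
    have "E.mmap (p.mmap x) (p' i) = finprod (H' (p' i)) ?e (L (p' i))"
      by (rule E.matrix_map_at[OF j])
    also have "\<dots> = finprod (H' (p' i)) ?e (q i ` K i)"
    proof (rule H'.finprod_mono_neutral_cong_right)
      show "?e l = \<one>\<^bsub>H' (p' i)\<^esub>" if "l \<in> L (p' i) - q i ` K i" for l
        using that q_off[OF i] E_off[OF j] by blast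
    qed (use E.finite_K[OF j] q_in[OF i] e in auto)
    also have "\<dots> = finprod (H' (p' i)) (\<lambda>k. ?e (q i k)) (K i)"
      using q_inj[OF i] q_in[OF i] e by (intro H'.finprod_reindex) auto
    also have "\<dots> = finprod (H' (p' i)) (\<lambda>k. M' i (D i k (x (src i k)))) (K i)"
    proof (rule H'.finprod_cong')
      show "(\<lambda>k. M' i (D i k (x (src i k)))) \<in> K i \<rightarrow> carrier (H' (p' i))"
        using D.entry_closed[OF x i] hom_in_carrier[OF p'.entry_hom[OF i]] by auto
      show "?e (q i k) = M' i (D i k (x (src i k)))" if k: "k \<in> K i" for k
        using x D.src[OF i k] p.monomial_map_at[OF x D.src[OF i k]]
        by (simp add: q_src[OF i k] entry[OF i k] PiE_iff)
    qed simp
    also have "\<dots> = M' i (D.mmap x i)"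
      unfolding D.matrix_map_at[OF i]
      using D.entry_closed[OF x i]
      by (intro hom_finprod[symmetric, OF G'.comm_group_axioms H'.comm_group_axioms p'.entry_hom[OF i]]) auto
    finally show "E.mmap (p.mmap x) (p' i) = M' i (D.mmap x i)" .
  qed
qed

section \<open>Simplices\<close>

lemma fin_conn_complexD:
  assumes "fin_conn_complex X"
  shows "distinct (verts X)"
    and "\<sigma> \<in> simps X \<Longrightarrow> \<sigma> \<noteq> {}"
    and "\<sigma> \<in> simps X \<Longrightarrow> \<sigma> \<subseteq> set (verts X)"
    and "\<sigma> \<in> simps X \<Longrightarrow> finite \<sigma>"
    and "\<sigma> \<in> simps X \<Longrightarrow> \<tau> \<subseteq> \<sigma> \<Longrightarrow> \<tau> \<noteq> {} \<Longrightarrow> \<tau> \<in> simps X"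
proof -
  have *: "distinct (verts X)" "\<forall>\<sigma>\<in>simps X. \<sigma> \<noteq> {} \<and> \<sigma> \<subseteq> set (verts X)"
    "\<forall>\<sigma>\<in>simps X. \<forall>\<tau>. \<tau> \<subseteq> \<sigma> \<and> \<tau> \<noteq> {} \<longrightarrow> \<tau> \<in> simps X"
    using assms unfolding fin_conn_complex_def by - (elim conjE, assumption)+
  show "distinct (verts X)" by (rule *)
  show "\<sigma> \<in> simps X \<Longrightarrow> \<sigma> \<noteq> {}" "\<sigma> \<in> simps X \<Longrightarrow> \<sigma> \<subseteq> set (verts X)"
    using bspec[OF *(2), of \<sigma>] by simp_all
  then show "\<sigma> \<in> simps X \<Longrightarrow> finite \<sigma>" using finite_subset by blast
  show "\<sigma> \<in> simps X \<Longrightarrow> \<tau> \<subseteq> \<sigma> \<Longrightarrow> \<tau> \<noteq> {} \<Longrightarrow> \<tau> \<in> simps X"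
    using *(3) by simp
qed

lemma bit_add_eq_0: "(a::bit) + b = 0 \<longleftrightarrow> a = b"
  using bit_cases[of a] bit_cases[of b] by auto

section \<open>Vertex orders and permutation signs\<close>

lemma before_irrefl: "distinct (verts X) \<Longrightarrow> \<not> before X v v"
  by (auto simp: before_def nth_eq_iff_index_eq)

lemma before_total:
  assumes "distinct (verts X)" "u \<in> set (verts X)" "v \<in> set (verts X)" "u \<noteq> v"
  shows "before X v u \<longleftrightarrow> \<not> before X u v"
proof -
  obtain i j where "i < length (verts X)" "verts X ! i = u" "j < length (verts X)" "verts X ! j = v"
    using assms by (metis in_set_conv_nth)
  moreover from this have "before X u v \<longleftrightarrow> i < j" "before X v u \<longleftrightarrow> j < i"
    using assms(1) unfolding before_def by (metis nth_eq_iff_index_eq order_less_trans)+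
  ultimately show ?thesis using assms(4) by auto
qed

lemma of_nat_card_eq_sum_bit:
  "finite A \<Longrightarrow> (of_nat (card {u \<in> A. P u}) :: bit) = (\<Sum>u\<in>A. of_bool (P u))"
  by (simp add: sum_of_bool_eq Collect_conj_eq)

lemma sum_insert_square:
  fixes h :: "'a \<Rightarrow> 'a \<Rightarrow> 'b::comm_monoid_add"
  assumes "finite A" "a \<notin> A"
  shows "(\<Sum>u\<in>insert a A. \<Sum>v\<in>insert a A. h u v)
    = h a a + (\<Sum>v\<in>A. h a v + h v a) + (\<Sum>u\<in>A. \<Sum>v\<in>A. h u v)"
  using assms by (simp add: sum.distrib add_ac)

text \<open>Modulo 2, the two orders of each unordered pair cancel.\<close>

lemma sum_bit_symmetric:
  fixes h :: "'a \<Rightarrow> 'a \<Rightarrow> bit"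
  assumes "finite A" "\<And>u. u \<in> A \<Longrightarrow> h u u = 0" "\<And>u v. u \<in> A \<Longrightarrow> v \<in> A \<Longrightarrow> u \<noteq> v \<Longrightarrow> h u v + h v u = 0"
  shows "(\<Sum>u\<in>A. \<Sum>v\<in>A. h u v) = 0"
  using assms
proof (induct A rule: finite_induct)
  case (insert a A)
  have "(\<Sum>v\<in>A. h a v + h v a) = 0"
    using insert(2) insert(5)[of a] by (intro sum.neutral ballI) auto
  moreover have "(\<Sum>u\<in>A. \<Sum>v\<in>A. h u v) = 0"
    using insert(3-5) by blast
  moreover have "h a a = 0" using insert(4) by blast
  ultimately show ?case
    by (simp only: sum_insert_square[OF insert(1,2)] add_0_left)
qed simp

text \<open>The parity of the number of inversions, that is, the sign of the permutation that sorts the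
  image of \<open>\<sigma>\<close>.\<close>

definition shuffle_sign :: "'v scomplex \<Rightarrow> 'v scomplex \<Rightarrow> ('v \<Rightarrow> 'v) \<Rightarrow> 'v set \<Rightarrow> bit"
  where "shuffle_sign X Y f \<sigma> = of_nat (card {(u, v) \<in> \<sigma> \<times> \<sigma>. before X u v \<and> before Y (f v) (f u)})"

lemma shuffle_sign_sum:
  assumes "finite \<sigma>"
  shows "shuffle_sign X Y f \<sigma> = (\<Sum>u\<in>\<sigma>. \<Sum>v\<in>\<sigma>. of_bool (before X u v \<and> before Y (f v) (f u)))"
proof -
  have "{(u, v) \<in> \<sigma> \<times> \<sigma>. before X u v \<and> before Y (f v) (f u)}
      = {p \<in> \<sigma> \<times> \<sigma>. before X (fst p) (snd p) \<and> before Y (f (snd p)) (f (fst p))}" by auto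
  moreover have "finite (\<sigma> \<times> \<sigma>)" using assms by simp
  ultimately show ?thesis
    unfolding shuffle_sign_def
    by (simp only: of_nat_card_eq_sum_bit sum.cartesian_product split_def)
qed

text \<open>The sign identity behind the compatibility of \<open>f\<^sub>#\<close> with the boundary. It
  holds vertex by vertex: for \<open>u\<close> in \<open>\<rho>\<close>, the position of
  \<open>u\<close> relative to \<open>v\<close> changes under \<open>f\<close> exactly if the pair is an
  inversion.\<close>

lemma shuffle_sign_insert:
  assumes "distinct (verts X)" "distinct (verts Y)" "f ` set (verts X) \<subseteq> set (verts Y)" "inj_on f (set (verts X))"
    and "finite \<rho>" "\<rho> \<subseteq> set (verts X)" "v \<in> set (verts X)" "v \<notin> \<rho>"
  shows "shuffle_sign X Y f \<rho> + of_nat (card {u \<in> \<rho>. before X u v})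
    = of_nat (card {w \<in> f ` \<rho>. before Y w (f v)}) + shuffle_sign X Y f (insert v \<rho>)"
proof -
  let ?a = "\<lambda>u w. of_bool (before X u w \<and> before Y (f w) (f u)) :: bit"
  have "?a v v = 0" using before_irrefl[OF assms(1), of v] by simp
  then have 1: "shuffle_sign X Y f (insert v \<rho>)
      = (\<Sum>u\<in>\<rho>. ?a v u + ?a u v) + shuffle_sign X Y f \<rho>"
    by (simp only: shuffle_sign_sum[OF assms(5)] shuffle_sign_sum[OF finite.insertI[OF assms(5)]]
        sum_insert_square[OF assms(5,8)] add_0_left)
  have inj: "inj_on f \<rho>" using assms(4,6) by (rule inj_on_subset)
  have "{w \<in> f ` \<rho>. before Y w (f v)} = f ` {u \<in> \<rho>. before Y (f u) (f v)}" by auto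
  then have "card {w \<in> f ` \<rho>. before Y w (f v)} = card {u \<in> \<rho>. before Y (f u) (f v)}"
    using inj by (simp add: card_image inj_on_subset)
  then have 2: "(of_nat (card {w \<in> f ` \<rho>. before Y w (f v)}) :: bit) = (\<Sum>u\<in>\<rho>. of_bool (before Y (f u) (f v)))"
    by (simp only: of_nat_card_eq_sum_bit[OF assms(5)])
  have 3: "(of_bool (before X u v) :: bit) = of_bool (before Y (f u) (f v)) + (?a v u + ?a u v)" if "u \<in> \<rho>" for u
  proof -
    have "u \<noteq> v" "u \<in> set (verts X)" using that assms by auto
    moreover from this have "f u \<in> set (verts Y)" "f v \<in> set (verts Y)" "f u \<noteq> f v"
      using assms(3,4,7) by (auto simp: inj_on_eq_iff)
    ultimately have "before X v u \<longleftrightarrow> \<not> before X u v" "before Y (f v) (f u) \<longleftrightarrow> \<not> before Y (f u) (f v)"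
      using before_total[OF assms(1) _ assms(7), of u] before_total[OF assms(2), of "f u" "f v"] by simp_all
    then show ?thesis by (cases "before X u v"; cases "before Y (f u) (f v)"; simp)
  qed
  have "(\<Sum>u\<in>\<rho>. of_bool (before X u v)) = (\<Sum>u\<in>\<rho>. of_bool (before Y (f u) (f v))) + (\<Sum>u\<in>\<rho>. ?a v u + ?a u v)"
    using 3 by (simp only: sum.distrib[symmetric] cong: sum.cong)
  then show ?thesis
    by (simp only: 1 2 of_nat_card_eq_sum_bit[OF assms(5)] add_ac)
qed

text \<open>A pair of vertices is inverted by the composite exactly if it is inverted by one of the two
  maps but not by both. This is a statement about unordered pairs; the three summands for a single
  ordered pair need not add up to zero, so the sum is symmetrised first.\<close>

lemma shuffle_sign_comp:
  assumes "distinct (verts X)" "distinct (verts Y)" "distinct (verts Z)"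
    and f: "f ` set (verts X) \<subseteq> set (verts Y)" "inj_on f (set (verts X))"
    and g: "g ` set (verts Y) \<subseteq> set (verts Z)" "inj_on g (set (verts Y))"
    and h: "\<And>v. v \<in> set (verts X) \<Longrightarrow> h v = g (f v)"
    and \<sigma>: "finite \<sigma>" "\<sigma> \<subseteq> set (verts X)"
  shows "shuffle_sign X Z h \<sigma> = shuffle_sign Y Z g (f ` \<sigma>) + shuffle_sign X Y f \<sigma>"
proof -
  let ?a = "\<lambda>u v. of_bool (before X u v \<and> before Y (f v) (f u)) :: bit"
  let ?b = "\<lambda>u v. of_bool (before Y (f u) (f v) \<and> before Z (g (f v)) (g (f u))) :: bit"
  let ?c = "\<lambda>u v. of_bool (before X u v \<and> before Z (g (f v)) (g (f u))) :: bit"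
  have inj: "inj_on f \<sigma>" using f(2) \<sigma>(2) by (rule inj_on_subset)
  have "shuffle_sign X Z h \<sigma> = (\<Sum>u\<in>\<sigma>. \<Sum>v\<in>\<sigma>. ?c u v)"
    unfolding shuffle_sign_sum[OF \<sigma>(1)] using \<sigma>(2) h by (intro sum.cong refl) (auto simp: subset_iff)
  moreover have "shuffle_sign Y Z g (f ` \<sigma>) = (\<Sum>u\<in>\<sigma>. \<Sum>v\<in>\<sigma>. ?b u v)"
    by (simp only: shuffle_sign_sum[OF finite_imageI[OF \<sigma>(1)]] sum.reindex[OF inj] o_def)
  moreover have "shuffle_sign X Y f \<sigma> = (\<Sum>u\<in>\<sigma>. \<Sum>v\<in>\<sigma>. ?a u v)"
    using \<sigma>(1) by (rule shuffle_sign_sum)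
  moreover have "(\<Sum>u\<in>\<sigma>. \<Sum>v\<in>\<sigma>. ?c u v + (?b u v + ?a u v)) = 0"
  proof (rule sum_bit_symmetric[OF \<sigma>(1)])
    fix u assume "u \<in> \<sigma>"
    show "?c u u + (?b u u + ?a u u) = 0" using assms(1-3) by (simp add: before_irrefl)
  next
    fix u v assume uv: "u \<in> \<sigma>" "v \<in> \<sigma>" "u \<noteq> v"
    then have X: "u \<in> set (verts X)" "v \<in> set (verts X)" using \<sigma> by auto
    then have Y: "f u \<in> set (verts Y)" "f v \<in> set (verts Y)" "f u \<noteq> f v"
      using f uv by (auto simp: inj_on_eq_iff)
    then have Z: "g (f u) \<in> set (verts Z)" "g (f v) \<in> set (verts Z)" "g (f u) \<noteq> g (f v)"
      using g by (auto simp: inj_on_eq_iff)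
    note t = before_total[OF assms(1) X uv(3)] before_total[OF assms(2) Y] before_total[OF assms(3) Z]
    show "?c u v + (?b u v + ?a u v) + (?c v u + (?b v u + ?a v u)) = 0"
      using t by (cases "before X u v"; cases "before Y (f u) (f v)"; cases "before Z (g (f u)) (g (f v))"; simp)
  qed
  ultimately have "shuffle_sign X Z h \<sigma> + (shuffle_sign Y Z g (f ` \<sigma>) + shuffle_sign X Y f \<sigma>) = 0"
    by (simp only: sum.distrib)
  then show ?thesis
    by (simp only: bit_add_eq_0)
qed

lemma shuffle_sign_id:
  assumes "distinct (verts X)" "finite \<sigma>" "\<sigma> \<subseteq> set (verts X)" "\<And>v. v \<in> set (verts X) \<Longrightarrow> f v = v"
  shows "shuffle_sign X X f \<sigma> = 0"
proof -
  have "\<not> (before X u v \<and> before X (f v) (f u))" if "u \<in> \<sigma>" "v \<in> \<sigma>" for u v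
    using that assms before_irrefl[OF assms(1), of u] before_total[OF assms(1), of u v]
    by (cases "u = v") (auto simp: subset_iff)
  then show ?thesis
    unfolding shuffle_sign_sum[OF assms(2)] by (intro sum.neutral ballI) simp
qed

section \<open>Colourings\<close>

text \<open>Horizontal faces are therefore obtained by removing vertices of colour 1.\<close>

lemma weight_insert:
  assumes "finite \<tau>" "v \<notin> \<tau>"
  shows "weight \<epsilon> (insert v \<tau>) = weight \<epsilon> \<tau> \<longleftrightarrow> \<epsilon> v = 1"
  using assms by (auto simp: weight_def sdim_def)

lemma finite_colourings: "finite (colourings X)"
  by (simp add: colourings_def finite_PiE)

lemma coversD:
  assumes "covers X \<epsilon> \<epsilon>'"
  shows "\<epsilon> \<in> colourings X" "\<epsilon>' \<in> colourings X"
  using assms by (auto simp: covers_def)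

lemma covers_ell:
  assumes "covers X \<epsilon> \<epsilon>'"
  shows "ell X \<epsilon>' = ell X \<epsilon> + 1"
proof -
  obtain v where v: "v \<in> set (verts X)" "\<epsilon> v = 0" "\<epsilon>' = \<epsilon>(v := 1)"
    using assms by (auto simp: covers_def)
  have "(\<Sum>u\<in>set (verts X). int (\<epsilon>' u)) = (\<Sum>u\<in>set (verts X). int (\<epsilon> u) + (if u = v then 1 else 0))"
    using v by (intro sum.cong) auto
  then show ?thesis using v by (simp add: ell_def sum.distrib)
qed

lemma weight_upd:
  assumes "finite \<sigma>" "\<epsilon> v = 0"
  shows "weight (\<epsilon>(v := 1)) \<sigma> = weight \<epsilon> \<sigma> - (if v \<in> \<sigma> then 1 else 0)"
proof -
  have "(\<Sum>u\<in>\<sigma>. int ((\<epsilon>(v := 1)) u)) = (\<Sum>u\<in>\<sigma>. int (\<epsilon> u) + (if u = v then 1 else 0))"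
    using assms by (intro sum.cong) auto
  then show ?thesis using assms by (simp add: weight_def sum.distrib)
qed

lemma covers_weight_le:
  assumes "covers X \<epsilon> \<epsilon>'" "finite \<sigma>"
  shows "weight \<epsilon>' \<sigma> \<le> weight \<epsilon> \<sigma>"
proof -
  obtain v where "\<epsilon> v = 0" "\<epsilon>' = \<epsilon>(v := 1)" using assms(1) by (auto simp: covers_def)
  then show ?thesis using weight_upd[OF assms(2), of \<epsilon> v] by simp
qed

lemma covers_fill:
  assumes "\<epsilon> \<in> colourings X" "v \<in> set (verts X)" "\<epsilon> v = 0"
  shows "covers X \<epsilon> (\<epsilon>(v := 1))" "\<epsilon>(v := 1) \<in> colourings X"
  using assms by (auto simp: covers_def colourings_def PiE_iff extensional_def)

text \<open>The fourth vertex of a square in the Boolean poset, given by a formula so that passing from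
  one middle vertex to the other is visibly an involution.\<close>

lemma covers_square:
  assumes "covers X \<epsilon>1 \<epsilon>''" "covers X \<epsilon> \<epsilon>1"
  defines "\<epsilon>2 \<equiv> \<lambda>v\<in>set (verts X). \<epsilon> v + \<epsilon>'' v - \<epsilon>1 v"
  shows "covers X \<epsilon>2 \<epsilon>''" "covers X \<epsilon> \<epsilon>2" "\<epsilon>2 \<noteq> \<epsilon>1"
    and "(\<lambda>v\<in>set (verts X). \<epsilon> v + \<epsilon>'' v - \<epsilon>2 v) = \<epsilon>1"
proof -
  obtain v where v: "v \<in> set (verts X)" "\<epsilon> v = 0" "\<epsilon>1 = \<epsilon>(v := 1)"
    using assms(2) by (auto simp: covers_def)
  obtain w where w: "w \<in> set (verts X)" "\<epsilon>1 w = 0" "\<epsilon>'' = \<epsilon>1(w := 1)"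
    using assms(1) by (auto simp: covers_def)
  have \<epsilon>: "\<epsilon> \<in> colourings X" using assms(2) by (rule coversD)
  have vw: "v \<noteq> w" using v w by auto
  have 2: "\<epsilon>2 = \<epsilon>(w := 1)"
    using \<epsilon> v w vw by (auto simp: \<epsilon>2_def colourings_def fun_eq_iff PiE_iff extensional_def)
  then show "covers X \<epsilon> \<epsilon>2" "covers X \<epsilon>2 \<epsilon>''" "\<epsilon>2 \<noteq> \<epsilon>1"
    using covers_fill[OF \<epsilon> w(1)] covers_fill[of \<epsilon>2 X v] v w vw
    by (auto simp: fun_upd_twist dest: fun_cong[of _ _ v])
  show "(\<lambda>v\<in>set (verts X). \<epsilon> v + \<epsilon>'' v - \<epsilon>2 v) = \<epsilon>1"
    using \<epsilon> v w vw by (auto simp: 2 colourings_def fun_eq_iff PiE_iff extensional_def)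
qed

text \<open>Induction downwards from the top of the Boolean poset.\<close>

lemma colouring_filling_induct [consumes 1, case_names top fill]:
  assumes "\<epsilon> \<in> colourings X"
    and top: "P (\<lambda>v\<in>set (verts X). 1)"
    and fill: "\<And>\<epsilon> v. \<epsilon> \<in> colourings X \<Longrightarrow> v \<in> set (verts X) \<Longrightarrow> \<epsilon> v = 0 \<Longrightarrow>
      (\<And>w. w \<in> set (verts X) \<Longrightarrow> \<epsilon> w = 0 \<Longrightarrow> P (\<epsilon>(w := 1))) \<Longrightarrow> P \<epsilon>"
  shows "P \<epsilon>"
  using assms(1)
proof (induct "card {v \<in> set (verts X). \<epsilon> v = 0}" arbitrary: \<epsilon> rule: less_induct)
  case less
  show ?case
  proof (cases "\<exists>v \<in> set (verts X). \<epsilon> v = 0")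
    case True
    have "P (\<epsilon>(w := 1))" if w: "w \<in> set (verts X)" "\<epsilon> w = 0" for w
    proof (rule less.hyps)
      show "\<epsilon>(w := 1) \<in> colourings X" using covers_fill[OF less.prems w] by simp
      show "card {v \<in> set (verts X). (\<epsilon>(w := 1)) v = 0} < card {v \<in> set (verts X). \<epsilon> v = 0}"
        using w by (intro psubset_card_mono) (auto split: if_splits)
    qed
    then show ?thesis using True fill[OF less.prems] by blast
  next
    case False
    then have "\<epsilon> = (\<lambda>v\<in>set (verts X). 1)"
      using less.prems by (force simp: colourings_def fun_eq_iff PiE_iff extensional_def)
    then show ?thesis using top by simp
  qed
qed

section \<open>Colourings along injective simplicial maps\<close>

text \<open>The arrows of \<open>RegSimpl\<close>, in the form in which they are used below.\<close>

locale reg_map =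
  fixes X Y :: "'v scomplex" and f
  assumes X: "fin_conn_complex X" and Y: "fin_conn_complex Y"
    and f_Hom: "f \<in> Hom RegSimpl X Y"
begin

lemma f_PiE: "f \<in> set (verts X) \<rightarrow>\<^sub>E set (verts Y)"
  and f_inj: "inj_on f (set (verts X))"
  and f_simps: "\<sigma> \<in> simps X \<Longrightarrow> f ` \<sigma> \<in> simps Y"
  using f_Hom by (simp_all add: RegSimpl_def)

lemma f_verts: "v \<in> set (verts X) \<Longrightarrow> f v \<in> set (verts Y)"
  using f_PiE by blast

abbreviation "push \<equiv> push_colouring X Y f"

lemma push_image: "v \<in> set (verts X) \<Longrightarrow> push \<epsilon> (f v) = \<epsilon> v"
  using f_verts f_inj by (simp add: push_colouring_def)

lemma push_off: "w \<in> set (verts Y) \<Longrightarrow> w \<notin> f ` set (verts X) \<Longrightarrow> push \<epsilon> w = 1"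
  by (simp add: push_colouring_def)

lemma push_in: "\<epsilon> \<in> colourings X \<Longrightarrow> push \<epsilon> \<in> colourings Y"
  using f_inj by (auto simp: push_colouring_def colourings_def PiE_iff)

lemma push_eqI:
  assumes "\<mu> \<in> extensional (set (verts Y))"
    and "\<And>v. v \<in> set (verts X) \<Longrightarrow> \<mu> (f v) = \<epsilon> v"
    and "\<And>w. w \<in> set (verts Y) \<Longrightarrow> w \<notin> f ` set (verts X) \<Longrightarrow> \<mu> w = 1"
  shows "push \<epsilon> = \<mu>"
proof (rule extensionalityI[of _ "set (verts Y)"])
  fix w assume "w \<in> set (verts Y)"
  then show "push \<epsilon> w = \<mu> w"
    using assms(2,3) push_image push_off by (cases "w \<in> f ` set (verts X)") auto
qed (use assms(1) in \<open>simp_all add: push_colouring_def\<close>)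

lemma push_inj: "inj_on push (colourings X)"
proof (rule inj_onI)
  fix \<epsilon> \<epsilon>' assume e: "\<epsilon> \<in> colourings X" "\<epsilon>' \<in> colourings X" "push \<epsilon> = push \<epsilon>'"
  show "\<epsilon> = \<epsilon>'"
  proof (rule extensionalityI[of _ "set (verts X)"])
    show "\<epsilon> v = \<epsilon>' v" if "v \<in> set (verts X)" for v
      using push_image[OF that, of \<epsilon>] push_image[OF that, of \<epsilon>'] e(3) by simp
  qed (use e in \<open>simp_all add: colourings_def PiE_iff\<close>)
qed

text \<open>Recolouring commutes with the extension of colourings, since the recoloured vertex lies in
  the image.\<close>

lemma push_upd:
  assumes "v \<in> set (verts X)"
  shows "push (\<epsilon>(v := 1)) = (push \<epsilon>)(f v := 1)"
proof (rule push_eqI)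
  show "(push \<epsilon>)(f v := 1) \<in> extensional (set (verts Y))"
    using f_verts[OF assms] by (auto simp: push_colouring_def extensional_def)
  show "((push \<epsilon>)(f v := 1)) (f u) = (\<epsilon>(v := 1)) u" if "u \<in> set (verts X)" for u
    using that assms f_inj by (simp add: push_image inj_on_eq_iff)
  show "((push \<epsilon>)(f v := 1)) w = 1" if "w \<in> set (verts Y)" "w \<notin> f ` set (verts X)" for w
    using that by (simp add: push_off)
qed

lemma push_covers:
  assumes "covers X \<epsilon> \<epsilon>'"
  shows "covers Y (push \<epsilon>) (push \<epsilon>')"
proof -
  obtain v where v: "v \<in> set (verts X)" "\<epsilon> v = 0" "\<epsilon>' = \<epsilon>(v := 1)"
    using assms by (auto simp: covers_def)
  have "covers Y (push \<epsilon>) ((push \<epsilon>)(f v := 1))"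
    using v push_in[OF coversD(1)[OF assms]] f_verts[OF v(1)] push_image[OF v(1), of \<epsilon>]
    by (intro covers_fill(1)) simp_all
  then show ?thesis using v push_upd by simp
qed

text \<open>The step for which the colour outside the image has to be 1: a vertex of colour 0 in
  \<open>push \<epsilon>\<close> lies in the image, so going up in the poset never leaves the image of
  \<open>push\<close>.\<close>

lemma covers_push:
  assumes "\<epsilon> \<in> colourings X" "covers Y (push \<epsilon>) \<mu>"
  shows "\<exists>\<epsilon>'. covers X \<epsilon> \<epsilon>' \<and> \<mu> = push \<epsilon>'"
proof -
  obtain w where w: "w \<in> set (verts Y)" "push \<epsilon> w = 0" "\<mu> = (push \<epsilon>)(w := 1)"
    using assms(2) by (auto simp: covers_def)
  then have "w \<in> f ` set (verts X)" using push_off[of w \<epsilon>] by force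
  then obtain v where v: "v \<in> set (verts X)" "w = f v" by auto
  then have "covers X \<epsilon> (\<epsilon>(v := 1))" "\<mu> = push (\<epsilon>(v := 1))"
    using w covers_fill(1)[OF assms(1) v(1)] push_image[OF v(1), of \<epsilon>] push_upd[OF v(1), of \<epsilon>] by simp_all
  then show ?thesis by blast
qed

lemma push_covers_iff:
  assumes "\<epsilon> \<in> colourings X" "\<epsilon>' \<in> colourings X"
  shows "covers Y (push \<epsilon>) (push \<epsilon>') \<longleftrightarrow> covers X \<epsilon> \<epsilon>'"
  using push_covers covers_push[OF assms(1)] push_inj assms
  by (metis coversD(2) inj_on_eq_iff)

lemma push_top: "push (\<lambda>v\<in>set (verts X). 1) = (\<lambda>w\<in>set (verts Y). 1)"
  by (rule push_eqI) (auto simp: f_verts)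

text \<open>Each vertex outside the image contributes 1, which is where the shift of the degree comes
  from.\<close>

lemma push_ell:
  "ell Y (push \<epsilon>) = ell X \<epsilon> + vertex_excess X Y"
proof -
  let ?V = "set (verts X)" and ?W = "set (verts Y)"
  have sub: "f ` ?V \<subseteq> ?W" using f_verts by auto
  have "ell Y (push \<epsilon>) = (\<Sum>w\<in>?W - f ` ?V. int (push \<epsilon> w)) + (\<Sum>w\<in>f ` ?V. int (push \<epsilon> w))"
    unfolding ell_def by (rule sum.subset_diff[OF sub]) simp
  also have "(\<Sum>w\<in>f ` ?V. int (push \<epsilon> w)) = ell X \<epsilon>"
    unfolding ell_def using f_inj by (simp add: sum.reindex push_image)
  also have "(\<Sum>w\<in>?W - f ` ?V. int (push \<epsilon> w)) = (\<Sum>w\<in>?W - f ` ?V. 1)"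
    by (intro sum.cong) (auto simp: push_off)
  also have "\<dots> = vertex_excess X Y"
  proof -
    have "int (card (?W - f ` ?V)) = int (card ?W) - int (card ?V)"
      using sub card_mono[OF _ sub] f_inj by (simp add: card_Diff_subset card_image of_nat_diff)
    then show ?thesis
      using X Y by (simp add: vertex_excess_def distinct_card fin_conn_complexD(1))
  qed
  finally show ?thesis by simp
qed

lemma push_weight:
  assumes "\<sigma> \<subseteq> set (verts X)"
  shows "weight (push \<epsilon>) (f ` \<sigma>) = weight \<epsilon> \<sigma>"
proof -
  have inj: "inj_on f \<sigma>" using f_inj assms by (rule inj_on_subset)
  have "(\<Sum>w\<in>f ` \<sigma>. int (push \<epsilon> w)) = (\<Sum>v\<in>\<sigma>. int (\<epsilon> v))"
    using inj assms by (simp add: sum.reindex push_image subset_iff)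
  then show ?thesis using inj by (simp add: weight_def sdim_def card_image)
qed

end

lemma reg_map_comp:
  assumes "reg_map X Y f" "reg_map Y Z g"
  shows "reg_map X Z (compose (set (verts X)) g f)"
proof -
  interpret f: reg_map X Y f by fact
  interpret g: reg_map Y Z g by fact
  let ?h = "compose (set (verts X)) g f"
  have "?h ` \<sigma> \<in> simps Z" if "\<sigma> \<in> simps X" for \<sigma>
  proof -
    have "?h ` \<sigma> = g ` f ` \<sigma>"
      using fin_conn_complexD(3)[OF f.X that] by (auto simp: compose_def image_iff subset_iff)
    then show ?thesis using g.f_simps f.f_simps that by simp
  qed
  moreover have "inj_on ?h (set (verts X))"
    using f.f_inj g.f_inj f.f_verts by (auto simp: inj_on_def compose_def)
  moreover have "?h \<in> set (verts X) \<rightarrow>\<^sub>E set (verts Z)"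
    using f.f_verts g.f_verts by (auto simp: compose_def)
  ultimately show ?thesis
    by (intro reg_map.intro f.X g.Y) (simp add: RegSimpl_def)
qed

lemma reg_map_id:
  assumes "fin_conn_complex X"
  shows "reg_map X X (\<lambda>v\<in>set (verts X). v)"
proof -
  have "(\<lambda>v\<in>set (verts X). v) ` \<sigma> = \<sigma>" if "\<sigma> \<in> simps X" for \<sigma>
    using fin_conn_complexD(3)[OF assms that] by (auto simp: subset_iff image_iff)
  then show ?thesis
    using assms by (intro reg_map.intro) (auto simp: RegSimpl_def inj_on_def)
qed

lemma push_comp:
  assumes "reg_map X Y f" "reg_map Y Z g"
  shows "push_colouring X Z (compose (set (verts X)) g f) \<epsilon> = push_colouring Y Z g (push_colouring X Y f \<epsilon>)"
proof -
  interpret f: reg_map X Y f by fact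
  interpret g: reg_map Y Z g by fact
  interpret h: reg_map X Z "compose (set (verts X)) g f" using assms by (rule reg_map_comp)
  show ?thesis
  proof (rule h.push_eqI)
    show "g.push (f.push \<epsilon>) \<in> extensional (set (verts Z))" by (simp add: push_colouring_def)
    show "g.push (f.push \<epsilon>) (compose (set (verts X)) g f v) = \<epsilon> v" if "v \<in> set (verts X)" for v
      using that by (simp add: compose_eq g.push_image f.f_verts f.push_image)
    show "g.push (f.push \<epsilon>) w = 1"
      if w: "w \<in> set (verts Z)" "w \<notin> compose (set (verts X)) g f ` set (verts X)" for w
    proof (cases "w \<in> g ` set (verts Y)")
      case True
      then obtain y where y: "y \<in> set (verts Y)" "w = g y" by auto
      then have "y \<notin> f ` set (verts X)" using w by (auto simp: compose_eq image_iff)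
      then show ?thesis using y by (simp add: g.push_image f.push_off)
    qed (simp add: w g.push_off)
  qed
qed

lemma push_id:
  assumes "fin_conn_complex X" "\<epsilon> \<in> colourings X"
  shows "push_colouring X X (\<lambda>v\<in>set (verts X). v) \<epsilon> = \<epsilon>"
  by (rule reg_map.push_eqI[OF reg_map_id[OF assms(1)]])
    (use assms(2) in \<open>auto simp: colourings_def PiE_iff\<close>)

section \<open>Cocycles on the Boolean poset and sign corrections\<close>

text \<open>The sum of \<open>c\<close> along the first \<open>n\<close> steps of a chosen upward path
  from \<open>\<epsilon>\<close>. If \<open>n\<close> is the number of vertices of colour 0, the path
  ends at the top.\<close>

primrec filling_sum :: "'v scomplex \<Rightarrow> (('v \<Rightarrow> nat) \<Rightarrow> ('v \<Rightarrow> nat) \<Rightarrow> bit) \<Rightarrow> nat \<Rightarrow> ('v \<Rightarrow> nat) \<Rightarrow> bit" where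
  "filling_sum X c 0 \<epsilon> = 0"
| "filling_sum X c (Suc n) \<epsilon> =
    (let \<epsilon>' = \<epsilon>((SOME v. v \<in> set (verts X) \<and> \<epsilon> v = 0) := 1) in c \<epsilon> \<epsilon>' + filling_sum X c n \<epsilon>')"

text \<open>The Boolean poset is simply connected: if \<open>c\<close> has the same sum along both sides
  of each square, then it is a coboundary. The potential is the sum along a chosen path to the top. To
  see that the first step of the path may be replaced by another, compare the two steps through the
  square that they span and use the induction hypothesis at its two middle vertices.\<close>

lemma cocycle_potential:
  fixes c :: "('v \<Rightarrow> nat) \<Rightarrow> ('v \<Rightarrow> nat) \<Rightarrow> bit"
  assumes c: "\<And>\<epsilon> \<epsilon>1 \<epsilon>2 \<epsilon>''. covers X \<epsilon> \<epsilon>1 \<Longrightarrow> covers X \<epsilon> \<epsilon>2 \<Longrightarrow> covers X \<epsilon>1 \<epsilon>'' \<Longrightarrow> covers X \<epsilon>2 \<epsilon>''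
    \<Longrightarrow> \<epsilon>1 \<noteq> \<epsilon>2 \<Longrightarrow> c \<epsilon> \<epsilon>1 + c \<epsilon>1 \<epsilon>'' = c \<epsilon> \<epsilon>2 + c \<epsilon>2 \<epsilon>''"
  shows "\<exists>\<eta>. \<eta> (\<lambda>v\<in>set (verts X). 1) = 0 \<and> (\<forall>\<epsilon> \<epsilon>'. covers X \<epsilon> \<epsilon>' \<longrightarrow> \<eta> \<epsilon> + \<eta> \<epsilon>' = c \<epsilon> \<epsilon>')"
proof -
  define N where "N \<epsilon> = card {v \<in> set (verts X). \<epsilon> v = 0}" for \<epsilon> :: "'v \<Rightarrow> nat"
  define \<eta> where "\<eta> \<epsilon> = filling_sum X c (N \<epsilon>) \<epsilon>" for \<epsilon>
  have N: "N \<epsilon> = Suc (N (\<epsilon>(v := 1)))" if "v \<in> set (verts X)" "\<epsilon> v = 0" for \<epsilon> v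
  proof -
    have "{u \<in> set (verts X). \<epsilon> u = 0} = insert v {u \<in> set (verts X). (\<epsilon>(v := 1)) u = 0}"
      using that by auto
    then show ?thesis unfolding N_def by (simp only:) (subst card_insert_disjoint, auto)
  qed
  have step: "\<exists>v. v \<in> set (verts X) \<and> \<epsilon> v = 0 \<and> \<eta> \<epsilon> = c \<epsilon> (\<epsilon>(v := 1)) + \<eta> (\<epsilon>(v := 1))"
    if "w \<in> set (verts X)" "\<epsilon> w = 0" for \<epsilon> w
  proof -
    define v where "v = (SOME v. v \<in> set (verts X) \<and> \<epsilon> v = 0)"
    have "\<exists>v. v \<in> set (verts X) \<and> \<epsilon> v = 0" using that by blast
    then have v: "v \<in> set (verts X) \<and> \<epsilon> v = 0" unfolding v_def by (rule someI_ex)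
    then have "N \<epsilon> = Suc (N (\<epsilon>(v := 1)))" using N by blast
    then have "\<eta> \<epsilon> = c \<epsilon> (\<epsilon>(v := 1)) + \<eta> (\<epsilon>(v := 1))"
      by (simp only: \<eta>_def filling_sum.simps Let_def v_def)
    then show ?thesis using v by blast
  qed
  have "\<forall>w. w \<in> set (verts X) \<and> \<epsilon> w = 0 \<longrightarrow> \<eta> \<epsilon> = c \<epsilon> (\<epsilon>(w := 1)) + \<eta> (\<epsilon>(w := 1))" if "\<epsilon> \<in> colourings X" for \<epsilon>
    using that
  proof (induct rule: colouring_filling_induct)
    case (fill \<epsilon> u)
    show ?case
    proof (intro allI impI, elim conjE)
      fix w assume w: "w \<in> set (verts X)" "\<epsilon> w = 0"
      obtain v where v: "v \<in> set (verts X)" "\<epsilon> v = 0" "\<eta> \<epsilon> = c \<epsilon> (\<epsilon>(v := 1)) + \<eta> (\<epsilon>(v := 1))"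
        using step[of w \<epsilon>] w by blast
      show "\<eta> \<epsilon> = c \<epsilon> (\<epsilon>(w := 1)) + \<eta> (\<epsilon>(w := 1))"
      proof (cases "w = v")
        case False
        let ?vw = "\<epsilon>(v := 1, w := 1)"
        have vw: "?vw = \<epsilon>(w := 1, v := 1)" using False by (auto simp: fun_upd_twist)
        have ev: "\<eta> (\<epsilon>(v := 1)) = c (\<epsilon>(v := 1)) ?vw + \<eta> ?vw"
          using w False by (intro fill(4)[OF v(1,2), THEN spec, THEN mp]) simp
        have ew: "\<eta> (\<epsilon>(w := 1)) = c (\<epsilon>(w := 1)) ?vw + \<eta> ?vw"
          unfolding vw using v False by (intro fill(4)[OF w, THEN spec, THEN mp]) simp
        have "c \<epsilon> (\<epsilon>(v := 1)) + c (\<epsilon>(v := 1)) ?vw = c \<epsilon> (\<epsilon>(w := 1)) + c (\<epsilon>(w := 1)) ?vw"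
        proof (rule c)
          show "covers X \<epsilon> (\<epsilon>(v := 1))" "covers X \<epsilon> (\<epsilon>(w := 1))"
            using covers_fill[OF fill(1)] v w by auto
          show "covers X (\<epsilon>(v := 1)) ?vw"
            using covers_fill(2)[OF fill(1) v(1,2)] w False by (intro covers_fill(1)) simp_all
          show "covers X (\<epsilon>(w := 1)) ?vw"
            unfolding vw using covers_fill(2)[OF fill(1) w] v False by (intro covers_fill(1)) simp_all
          show "\<epsilon>(v := 1) \<noteq> \<epsilon>(w := 1)" using v w False by (auto dest: fun_cong[of _ _ v])
        qed
        then show ?thesis unfolding v(3) ev ew by (simp only: add.assoc[symmetric])
      qed (use v in simp)
    qed
  qed simp
  then have "\<eta> \<epsilon> + \<eta> \<epsilon>' = c \<epsilon> \<epsilon>'" if "covers X \<epsilon> \<epsilon>'" for \<epsilon> \<epsilon>'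
    using that by (auto simp: covers_def add.assoc)
  moreover have "\<eta> (\<lambda>v\<in>set (verts X). 1) = 0"
  proof -
    have "{v \<in> set (verts X). (\<lambda>v\<in>set (verts X). 1 :: nat) v = 0} = {}" by auto
    then show ?thesis by (simp only: \<eta>_def N_def) simp
  qed
  ultimately show ?thesis by blast
qed

lemma potential_unique:
  fixes \<eta> \<theta> :: "('v \<Rightarrow> nat) \<Rightarrow> bit"
  assumes "\<eta> (\<lambda>v\<in>set (verts X). 1) = \<theta> (\<lambda>v\<in>set (verts X). 1)"
    and "\<And>\<epsilon> \<epsilon>'. covers X \<epsilon> \<epsilon>' \<Longrightarrow> \<eta> \<epsilon> + \<eta> \<epsilon>' = \<theta> \<epsilon> + \<theta> \<epsilon>'"
    and "\<epsilon> \<in> colourings X"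
  shows "\<eta> \<epsilon> = \<theta> \<epsilon>"
  using assms(3)
proof (induct rule: colouring_filling_induct)
  case (fill \<epsilon> v)
  then have "\<eta> \<epsilon> + \<eta> (\<epsilon>(v := 1)) = \<theta> \<epsilon> + \<theta> (\<epsilon>(v := 1))"
    using covers_fill(1)[OF fill(1-3)] assms(2) by blast
  then show ?case unfolding fill(4)[OF fill(2,3)] by (simp only: add_right_cancel)
qed (rule assms)

lemma bit_add_swap: "(a::bit) + b + (c + d) = (a + c) + (b + d)"
  by (simp only: add_ac)

text \<open>The defining equations of two sign assignments add up to the equation of a cocycle, as the
  two ones cancel.\<close>

lemma bit_anticommute_add:
  fixes a b c d a' b' c' d' :: bit
  assumes "a + b = c + d + 1" "a' + b' = c' + d' + 1"
  shows "(a + a') + (b + b') = (c + c') + (d + d')"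
proof -
  have "(x + 1) + (y + 1) = x + y" for x y :: bit
    using bit_cases[of x] bit_cases[of y] by auto
  then show ?thesis
    using assms by (simp only: bit_add_swap[of a a' b b'] bit_add_swap[of c c' d d'])
qed

lemma bit_telescope_add:
  fixes a b a' b' x t u :: bit
  assumes "a + b = x + t" "a' + b' = t + u"
  shows "(a' + a) + (b' + b) = x + u"
proof -
  have "(t + u) + (x + t) = x + u"
    using bit_cases[of t] bit_cases[of u] bit_cases[of x] by auto
  then show ?thesis
    using assms by (simp only: bit_add_swap[of a' a b' b])
qed

lemma bit_add_rotate:
  fixes a b c d :: bit
  assumes "a + b = c + d"
  shows "b + c = d + a"
  using assms bit_cases[of a] bit_cases[of b] bit_cases[of c] bit_cases[of d] by auto

text \<open>The property that characterises \<open>sign_correction\<close>. As its solution is unique,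
  the identity and composition laws for sign corrections are proved by exhibiting a solution.\<close>

definition is_correction ::
    "(('v \<Rightarrow> nat) \<Rightarrow> ('v \<Rightarrow> nat) \<Rightarrow> bit) \<Rightarrow> (('v \<Rightarrow> nat) \<Rightarrow> ('v \<Rightarrow> nat) \<Rightarrow> bit)
      \<Rightarrow> 'v scomplex \<Rightarrow> 'v scomplex \<Rightarrow> ('v \<Rightarrow> 'v) \<Rightarrow> (('v \<Rightarrow> nat) \<Rightarrow> bit) \<Rightarrow> bool"
  where "is_correction s t X Y f \<eta> \<longleftrightarrow> \<eta> \<in> extensional (colourings X) \<and> \<eta> (\<lambda>v\<in>set (verts X). 1) = 0 \<and>
      (\<forall>\<epsilon> \<epsilon>'. covers X \<epsilon> \<epsilon>' \<longrightarrow>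
        \<eta> \<epsilon> + \<eta> \<epsilon>' = s \<epsilon> \<epsilon>' + t (push_colouring X Y f \<epsilon>) (push_colouring X Y f \<epsilon>'))"

lemma is_correction_unique:
  assumes "is_correction s t X Y f \<eta>" "is_correction s t X Y f \<theta>"
  shows "\<eta> = \<theta>"
proof (rule extensionalityI)
  show "\<eta> \<in> extensional (colourings X)" "\<theta> \<in> extensional (colourings X)"
    using assms by (simp_all add: is_correction_def)
  show "\<eta> \<epsilon> = \<theta> \<epsilon>" if "\<epsilon> \<in> colourings X" for \<epsilon>
  proof (rule potential_unique[where \<eta> = \<eta> and \<theta> = \<theta>, OF _ _ that])
    show "\<eta> (\<lambda>v\<in>set (verts X). 1) = \<theta> (\<lambda>v\<in>set (verts X). 1)"
      using assms unfolding is_correction_def by simp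
    show "\<eta> \<epsilon> + \<eta> \<epsilon>' = \<theta> \<epsilon> + \<theta> \<epsilon>'" if "covers X \<epsilon> \<epsilon>'" for \<epsilon> \<epsilon>'
      using assms that unfolding is_correction_def by metis
  qed
qed

lemma top_colouring: "(\<lambda>v\<in>set (verts X). 1) \<in> colourings X"
  by (simp add: colourings_def)

lemma is_correction_ex:
  assumes "reg_map X Y f" "sign_assignment X s" "sign_assignment Y t"
  shows "\<exists>\<eta>. is_correction s t X Y f \<eta>"
proof -
  interpret reg_map X Y f by fact
  have "\<exists>\<eta>. \<eta> (\<lambda>v\<in>set (verts X). 1) = 0 \<and> (\<forall>\<epsilon> \<epsilon>'. covers X \<epsilon> \<epsilon>' \<longrightarrow>
      \<eta> \<epsilon> + \<eta> \<epsilon>' = s \<epsilon> \<epsilon>' + t (push \<epsilon>) (push \<epsilon>'))"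
  proof (rule cocycle_potential)
    fix \<epsilon> \<epsilon>1 \<epsilon>2 \<epsilon>''
    assume c: "covers X \<epsilon> \<epsilon>1" "covers X \<epsilon> \<epsilon>2" "covers X \<epsilon>1 \<epsilon>''" "covers X \<epsilon>2 \<epsilon>''" "\<epsilon>1 \<noteq> \<epsilon>2"
    have "push \<epsilon>1 \<noteq> push \<epsilon>2" using c(5) push_inj coversD(2)[OF c(1)] coversD(2)[OF c(2)]
      by (simp add: inj_on_eq_iff)
    then have "s \<epsilon> \<epsilon>1 + s \<epsilon>1 \<epsilon>'' = s \<epsilon> \<epsilon>2 + s \<epsilon>2 \<epsilon>'' + 1"
      and "t (push \<epsilon>) (push \<epsilon>1) + t (push \<epsilon>1) (push \<epsilon>'') = t (push \<epsilon>) (push \<epsilon>2) + t (push \<epsilon>2) (push \<epsilon>'') + 1"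
      using assms(2,3) c c(1-4)[THEN push_covers] unfolding sign_assignment_def by blast+
    then show "s \<epsilon> \<epsilon>1 + t (push \<epsilon>) (push \<epsilon>1) + (s \<epsilon>1 \<epsilon>'' + t (push \<epsilon>1) (push \<epsilon>''))
        = s \<epsilon> \<epsilon>2 + t (push \<epsilon>) (push \<epsilon>2) + (s \<epsilon>2 \<epsilon>'' + t (push \<epsilon>2) (push \<epsilon>''))"
      by (rule bit_anticommute_add)
  qed
  then obtain \<eta> where e: "\<eta> (\<lambda>v\<in>set (verts X). 1) = 0"
      "\<And>\<epsilon> \<epsilon>'. covers X \<epsilon> \<epsilon>' \<Longrightarrow> \<eta> \<epsilon> + \<eta> \<epsilon>' = s \<epsilon> \<epsilon>' + t (push \<epsilon>) (push \<epsilon>')" by blast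
  have "is_correction s t X Y f (restrict \<eta> (colourings X))"
    unfolding is_correction_def
  proof (intro conjI allI impI)
    show "restrict \<eta> (colourings X) (\<lambda>v\<in>set (verts X). 1) = 0"
      using e(1) top_colouring[of X] by (simp only: restrict_apply' simp_thms)
    show "restrict \<eta> (colourings X) \<epsilon> + restrict \<eta> (colourings X) \<epsilon>' = s \<epsilon> \<epsilon>' + t (push \<epsilon>) (push \<epsilon>')"
      if "covers X \<epsilon> \<epsilon>'" for \<epsilon> \<epsilon>'
      using e(2)[OF that] coversD[OF that] by (simp only: restrict_apply')
  qed simp
  then show ?thesis by blast
qed

lemma sign_correction_eqI: "is_correction s t X Y f \<eta> \<Longrightarrow> sign_correction s t X Y f = \<eta>"
  unfolding sign_correction_def
  by (rule the_equality) (auto simp only: is_correction_def[symmetric] intro: is_correction_unique)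

lemma is_correction_sign_correction:
  assumes "reg_map X Y f" "sign_assignment X s" "sign_assignment Y t"
  shows "is_correction s t X Y f (sign_correction s t X Y f)"
  using is_correction_ex[OF assms] sign_correction_eqI by metis

text \<open>The form in which the correction makes the two differentials compatible.\<close>

lemma sign_correction_covers:
  assumes "reg_map X Y f" "sign_assignment X s" "sign_assignment Y t" "covers X \<epsilon> \<epsilon>'"
  shows "sign_correction s t X Y f \<epsilon>' + s \<epsilon> \<epsilon>'
    = t (push_colouring X Y f \<epsilon>) (push_colouring X Y f \<epsilon>') + sign_correction s t X Y f \<epsilon>"
proof -
  let ?\<eta> = "sign_correction s t X Y f"
  have "?\<eta> \<epsilon> + ?\<eta> \<epsilon>' = s \<epsilon> \<epsilon>' + t (push_colouring X Y f \<epsilon>) (push_colouring X Y f \<epsilon>')"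
    using is_correction_sign_correction[OF assms(1-3)] assms(4) unfolding is_correction_def by blast
  then show ?thesis by (rule bit_add_rotate)
qed

lemma sign_correction_id:
  assumes "fin_conn_complex X" "\<epsilon> \<in> colourings X"
  shows "sign_correction s s X X (\<lambda>v\<in>set (verts X). v) \<epsilon> = 0"
proof -
  have "is_correction s s X X (\<lambda>v\<in>set (verts X). v) (restrict (\<lambda>_. 0) (colourings X))"
    unfolding is_correction_def
  proof (intro conjI allI impI)
    fix \<epsilon> \<epsilon>' assume c: "covers X \<epsilon> \<epsilon>'"
    then show "restrict (\<lambda>_. 0) (colourings X) \<epsilon> + restrict (\<lambda>_. 0) (colourings X) \<epsilon>'
        = s \<epsilon> \<epsilon>' + s (push_colouring X X (\<lambda>v\<in>set (verts X). v) \<epsilon>) (push_colouring X X (\<lambda>v\<in>set (verts X). v) \<epsilon>')"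
      by (simp only: push_id[OF assms(1)] coversD[OF c] restrict_apply' bit_add_eq_0[THEN iffD2] refl)
  next
    show "restrict (\<lambda>_. 0) (colourings X) (\<lambda>v\<in>set (verts X). 1) = (0::bit)"
      using top_colouring[of X] by (simp only: restrict_apply')
  qed simp
  then show ?thesis using assms(2) by (simp add: sign_correction_eqI)
qed

text \<open>Both normalisations are at the top element, which the extension of colourings preserves, so
  the corrections add up without a constant.\<close>

lemma sign_correction_comp:
  assumes f: "reg_map X Y f" and g: "reg_map Y Z g"
    and s: "sign_assignment X s" and t: "sign_assignment Y t" and u: "sign_assignment Z u"
    and "\<epsilon> \<in> colourings X"
  shows "sign_correction s u X Z (compose (set (verts X)) g f) \<epsilon>
    = sign_correction t u Y Z g (push_colouring X Y f \<epsilon>) + sign_correction s t X Y f \<epsilon>"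
proof -
  interpret f: reg_map X Y f by fact
  interpret g: reg_map Y Z g by fact
  let ?\<eta> = "sign_correction s t X Y f" and ?\<theta> = "sign_correction t u Y Z g"
  note \<eta> = is_correction_sign_correction[OF f s t] and \<theta> = is_correction_sign_correction[OF g t u]
  let ?\<zeta> = "restrict (\<lambda>\<epsilon>. ?\<theta> (f.push \<epsilon>) + ?\<eta> \<epsilon>) (colourings X)"
  have "is_correction s u X Z (compose (set (verts X)) g f) ?\<zeta>"
    unfolding is_correction_def
  proof (intro conjI allI impI)
    have "?\<theta> (f.push (\<lambda>v\<in>set (verts X). 1)) = 0"
      using \<theta> unfolding f.push_top is_correction_def by blast
    moreover have "?\<eta> (\<lambda>v\<in>set (verts X). 1) = 0"
      using \<eta> unfolding is_correction_def by blast
    ultimately show "?\<zeta> (\<lambda>v\<in>set (verts X). 1) = 0"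
      using top_colouring[of X] by (simp only: restrict_apply' add_0_left)
  next
    fix \<epsilon> \<epsilon>' assume c: "covers X \<epsilon> \<epsilon>'"
    show "?\<zeta> \<epsilon> + ?\<zeta> \<epsilon>' = s \<epsilon> \<epsilon>' + u (push_colouring X Z (compose (set (verts X)) g f) \<epsilon>)
        (push_colouring X Z (compose (set (verts X)) g f) \<epsilon>')"
    proof -
      have "?\<eta> \<epsilon> + ?\<eta> \<epsilon>' = s \<epsilon> \<epsilon>' + t (f.push \<epsilon>) (f.push \<epsilon>')"
        using \<eta> c unfolding is_correction_def by blast
      moreover have "?\<theta> (f.push \<epsilon>) + ?\<theta> (f.push \<epsilon>')
          = t (f.push \<epsilon>) (f.push \<epsilon>') + u (g.push (f.push \<epsilon>)) (g.push (f.push \<epsilon>'))"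
        using \<theta> f.push_covers[OF c] unfolding is_correction_def by blast
      ultimately show ?thesis
        using bit_telescope_add by (simp only: push_comp[OF f g] restrict_apply' coversD[OF c])
    qed
  qed simp
  then show ?thesis using assms(6) by (simp only: sign_correction_eqI restrict_apply')
qed

section \<open>Horizontal homology\<close>

lemma comm_group_add_monoid: "cring R \<Longrightarrow> comm_group (add_monoid R)"
  by (simp add: abelian_group.a_comm_group cring.axioms(1) ring.is_abelian_group)

text \<open>The vertices \<open>v\<close> that label the row \<open>\<tau>\<close> of the horizontal
  boundary: those for which \<open>\<tau>\<close> is a horizontal face of
  \<open>insert v \<tau>\<close>.\<close>

definition h_cofaces :: "'v scomplex \<Rightarrow> ('v \<Rightarrow> nat) \<Rightarrow> 'v set \<Rightarrow> 'v set"
  where "h_cofaces X \<epsilon> \<tau> = {v \<in> set (verts X) - \<tau>. insert v \<tau> \<in> simps X \<and> weight \<epsilon> (insert v \<tau>) = weight \<epsilon> \<tau>}"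

definition face_sign :: "'v scomplex \<Rightarrow> 'v set \<Rightarrow> 'v \<Rightarrow> bit"
  where "face_sign X \<tau> v = of_nat (card {u \<in> \<tau>. before X u v})"

lemma horizontal_boundary_eq_matrix_map:
  "horizontal_boundary X R \<epsilon> = matrix_map (simps X) (h_cofaces X \<epsilon>) (\<lambda>\<tau> v. insert v \<tau>)
     (\<lambda>\<tau> v. signed (add_monoid R) (face_sign X \<tau> v)) (\<lambda>_. add_monoid R)"
  by (intro ext) (simp add: horizontal_boundary_def matrix_map_def finsum_def h_cofaces_def face_sign_def)

lemma boundary_matrix:
  assumes "cring R"
  shows "group_matrix (simps X) (\<lambda>_. add_monoid R) (simps X) (\<lambda>_. add_monoid R) (h_cofaces X \<epsilon>)
    (\<lambda>\<tau> v. insert v \<tau>) (\<lambda>\<tau> v. signed (add_monoid R) (face_sign X \<tau> v))"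
  by (rule group_matrix.intro)
    (auto simp: h_cofaces_def intro: comm_group_add_monoid[OF assms] signed_hom)

lemma comm_group_chain_group: "cring R \<Longrightarrow> comm_group (chain_group X R)"
  unfolding chain_group_def by (rule comm_group_product_group) (rule comm_group_add_monoid)

lemma horizontal_boundary_hom:
  "cring R \<Longrightarrow> horizontal_boundary X R \<epsilon> \<in> hom (chain_group X R) (chain_group X R)"
  unfolding horizontal_boundary_eq_matrix_map chain_group_def
  by (rule group_matrix.matrix_map_hom[OF boundary_matrix])

lemma face_sign_insert:
  assumes "finite \<tau>" "w \<notin> \<tau>"
  shows "face_sign X (insert w \<tau>) v = of_bool (before X w v) + face_sign X \<tau> v"
proof -
  have "{u \<in> insert w \<tau>. before X u v} = (if before X w v then insert w {u \<in> \<tau>. before X u v} else {u \<in> \<tau>. before X u v})"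
    by auto
  then show ?thesis using assms by (simp add: face_sign_def)
qed

lemma h_cofaces_swap:
  assumes X: "fin_conn_complex X" and \<tau>: "\<tau> \<in> simps X"
    and v: "v \<in> h_cofaces X \<epsilon> \<tau>" and w: "w \<in> h_cofaces X \<epsilon> (insert v \<tau>)"
  shows "w \<in> h_cofaces X \<epsilon> \<tau>" "v \<in> h_cofaces X \<epsilon> (insert w \<tau>)" "v \<noteq> w"
proof -
  have fin: "finite \<tau>" using X \<tau> by (rule fin_conn_complexD)
  have vw: "v \<notin> \<tau>" "w \<notin> \<tau>" "v \<noteq> w" "v \<in> set (verts X)" "w \<in> set (verts X)"
      "insert w (insert v \<tau>) \<in> simps X"
    using v w by (auto simp: h_cofaces_def)
  moreover have "insert w \<tau> \<in> simps X" "insert v (insert w \<tau>) \<in> simps X"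
    using fin_conn_complexD(5)[OF X vw(6), of "insert w \<tau>"] vw(6) by (auto simp: insert_commute)
  moreover have "\<epsilon> v = 1" "\<epsilon> w = 1"
    using v w fin vw weight_insert[of \<tau> v \<epsilon>] weight_insert[of "insert v \<tau>" w \<epsilon>] by (auto simp: h_cofaces_def)
  ultimately show "w \<in> h_cofaces X \<epsilon> \<tau>" "v \<in> h_cofaces X \<epsilon> (insert w \<tau>)" "v \<noteq> w"
    using fin by (auto simp: h_cofaces_def weight_insert)
qed

text \<open>Exactly one of \<open>v\<close> and \<open>w\<close> comes before the other, so the two
  orders of removing them have opposite signs.\<close>

lemma face_sign_swap:
  assumes X: "fin_conn_complex X" and \<tau>: "\<tau> \<in> simps X"
    and v: "v \<in> h_cofaces X \<epsilon> \<tau>" and w: "w \<in> h_cofaces X \<epsilon> (insert v \<tau>)"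
  shows "face_sign X \<tau> w + face_sign X (insert w \<tau>) v = face_sign X \<tau> v + face_sign X (insert v \<tau>) w + 1"
proof -
  have fin: "finite \<tau>" using X \<tau> by (rule fin_conn_complexD)
  have vw: "v \<notin> \<tau>" "w \<notin> \<tau>" "v \<in> set (verts X)" "w \<in> set (verts X)" "v \<noteq> w"
    using v w by (auto simp: h_cofaces_def)
  have "before X w v \<longleftrightarrow> \<not> before X v w"
    by (rule before_total[OF fin_conn_complexD(1)[OF X] vw(3-5)])
  then have "(of_bool (before X w v) :: bit) = of_bool (before X v w) + 1" by simp
  moreover have "a + (x + 1 + b) = b + (x + a) + 1" for a b x :: bit by (simp only: add_ac)
  ultimately show ?thesis by (simp only: face_sign_insert[OF fin vw(1)] face_sign_insert[OF fin vw(2)])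
qed

lemma horizontal_boundary_square:
  assumes X: "fin_conn_complex X" and R: "cring R" and c: "c \<in> carrier (chain_group X R)"
  shows "horizontal_boundary X R \<epsilon> (horizontal_boundary X R \<epsilon> c) = \<one>\<^bsub>chain_group X R\<^esub>"
  unfolding horizontal_boundary_eq_matrix_map chain_group_def
proof (rule matrix_map_square_zero[where \<iota> = "\<lambda>_ (v, w). (w, v)", OF boundary_matrix[OF R] boundary_matrix[OF R]])
  interpret A: comm_group "add_monoid R" using R by (rule comm_group_add_monoid)
  let ?s = "signed (add_monoid R)"
  fix \<tau> v w assume h: "\<tau> \<in> simps X" "v \<in> h_cofaces X \<epsilon> \<tau>" "w \<in> h_cofaces X \<epsilon> (insert v \<tau>)"
  have "?s (face_sign X \<tau> v) (?s (face_sign X (insert v \<tau>) w) g) \<otimes>\<^bsub>add_monoid R\<^esub>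
      ?s (face_sign X \<tau> w) (?s (face_sign X (insert w \<tau>) v) g) = \<one>\<^bsub>add_monoid R\<^esub>"
    if "g \<in> carrier (add_monoid R)" for g
    using that signed_cancel[OF A.group_axioms that]
    by (simp only: signed_signed[OF A.group_axioms that] face_sign_swap[OF X h])
  then show "\<exists>m' m. (case (v, w) of (v, w) \<Rightarrow> (w, v)) = (m', m) \<and> (case (m', m) of (v, w) \<Rightarrow> (w, v)) = (v, w) \<and>
      (m', m) \<noteq> (v, w) \<and> m' \<in> h_cofaces X \<epsilon> \<tau> \<and> m \<in> h_cofaces X \<epsilon> (insert m' \<tau>) \<and>
      insert m (insert m' \<tau>) = insert w (insert v \<tau>) \<and>
      (\<forall>g\<in>carrier (add_monoid R).
          ?s (face_sign X \<tau> v) (?s (face_sign X (insert v \<tau>) w) g) \<otimes>\<^bsub>add_monoid R\<^esub>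
          ?s (face_sign X \<tau> m') (?s (face_sign X (insert m' \<tau>) m) g) = \<one>\<^bsub>add_monoid R\<^esub>)"
    using h_cofaces_swap[OF X h] by (intro exI[of _ w] exI[of _ v]) (simp add: insert_commute)
qed (use c in \<open>simp add: chain_group_def\<close>)

lemma h_subquotient_pair:
  assumes "fin_conn_complex X" "cring R"
  shows "subquotient_pair (chain_group X R) (h_cycles X R \<epsilon>) (h_boundaries X R \<epsilon>)"
  unfolding h_cycles_def h_boundaries_def
  using comm_group_chain_group[OF assms(2)] horizontal_boundary_hom[OF assms(2)]
    horizontal_boundary_square[OF assms]
  by (intro subquotient_pair_complex) auto

lemma comm_group_h_homology:
  "fin_conn_complex X \<Longrightarrow> cring R \<Longrightarrow> comm_group (h_homology X R \<epsilon>)"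
  unfolding h_homology_def
  by (rule subquotient_pair.comm_group_subquotient[OF h_subquotient_pair])

lemma h_chain_map:
  assumes "cring R" "cring S" "F \<in> hom (chain_group X R) (chain_group Y S)"
    and "\<And>c. c \<in> carrier (chain_group X R) \<Longrightarrow>
      F (horizontal_boundary X R \<epsilon> c) = horizontal_boundary Y S \<mu> (F c)"
  shows "F ` h_cycles X R \<epsilon> \<subseteq> h_cycles Y S \<mu>" "F ` h_boundaries X R \<epsilon> \<subseteq> h_boundaries Y S \<mu>"
  unfolding h_cycles_def h_boundaries_def
  by (rule chain_map_kernel[OF _ _ assms(3) assms(3)] chain_map_image[OF assms(3)];
      use assms comm_group_chain_group in blast)+

section \<open>Connecting maps\<close>

lemma connecting_chain_hom:
  assumes "cring R"
  shows "connecting_chain X R \<epsilon> \<epsilon>' \<in> hom (chain_group X R) (chain_group X R)"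
proof -
  interpret A: comm_group "add_monoid R" using assms by (rule comm_group_add_monoid)
  show ?thesis
    using A.one_closed A.r_one[OF A.one_closed]
    by (intro homI) (auto simp: chain_group_def connecting_chain_def PiE_iff intro!: restrict_ext)
qed

text \<open>Recolouring \<open>v\<close> from 0 to 1 makes the removal of \<open>v\<close> horizontal.
  The additional term of the new boundary involves only simplices that contain \<open>v\<close>, and
  these are killed by the connecting map.\<close>

lemma connecting_chain_boundary:
  assumes X: "fin_conn_complex X" and R: "cring R" and c: "c \<in> carrier (chain_group X R)"
    and cov: "covers X \<epsilon> \<epsilon>'"
  shows "connecting_chain X R \<epsilon> \<epsilon>' (horizontal_boundary X R \<epsilon> c)
    = horizontal_boundary X R \<epsilon>' (connecting_chain X R \<epsilon> \<epsilon>' c)"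
proof (rule extensionalityI[of _ "simps X"])
  obtain v where v: "v \<in> set (verts X)" "\<epsilon> v = 0" "\<epsilon>' = \<epsilon>(v := 1)"
    using cov by (auto simp: covers_def)
  interpret A: comm_group "add_monoid R" using R by (rule comm_group_add_monoid)
  let ?s = "\<lambda>\<tau> w. signed (add_monoid R) (face_sign X \<tau> w)"
  have c': "c \<sigma> \<in> carrier (add_monoid R)" if "\<sigma> \<in> simps X" for \<sigma>
    using c that by (auto simp: chain_group_def PiE_iff)
  have W: "weight \<epsilon> \<sigma> = weight \<epsilon>' \<sigma> \<longleftrightarrow> v \<notin> \<sigma>" if "\<sigma> \<in> simps X" for \<sigma>
    using weight_upd[OF fin_conn_complexD(4)[OF X that], of \<epsilon> v] v(2,3) by simp
  have conn: "connecting_chain X R \<epsilon> \<epsilon>' b \<sigma> = (if v \<in> \<sigma> then \<one>\<^bsub>add_monoid R\<^esub> else b \<sigma>)"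
    if "\<sigma> \<in> simps X" for \<sigma> b
    using that W[OF that] by (simp add: connecting_chain_def)
  fix \<tau> assume \<tau>: "\<tau> \<in> simps X"
  have fin: "finite \<tau>" using X \<tau> by (rule fin_conn_complexD)
  have b: "horizontal_boundary X R \<mu> b \<tau>
      = finprod (add_monoid R) (\<lambda>w. ?s \<tau> w (b (insert w \<tau>))) (h_cofaces X \<mu> \<tau>)" for \<mu> b
    using \<tau> by (simp add: horizontal_boundary_eq_matrix_map matrix_map_def)
  have ins: "insert w \<tau> \<in> simps X" if "w \<in> h_cofaces X \<mu> \<tau>" for w \<mu> using that by (simp add: h_cofaces_def)
  show "connecting_chain X R \<epsilon> \<epsilon>' (horizontal_boundary X R \<epsilon> c) \<tau>
    = horizontal_boundary X R \<epsilon>' (connecting_chain X R \<epsilon> \<epsilon>' c) \<tau>"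
  \<comment> \<open>If \<open>v \<in> \<tau>\<close>, both sides vanish; otherwise the two sums differ by the label \<open>v\<close>, whose term is trivial.\<close>
  proof (cases "v \<in> \<tau>")
    case True
    have "finprod (add_monoid R) (\<lambda>w. ?s \<tau> w (connecting_chain X R \<epsilon> \<epsilon>' c (insert w \<tau>))) (h_cofaces X \<epsilon>' \<tau>)
        = \<one>\<^bsub>add_monoid R\<^esub>"
    proof (rule A.finprod_one_eqI)
      fix w assume "w \<in> h_cofaces X \<epsilon>' \<tau>"
      then have "connecting_chain X R \<epsilon> \<epsilon>' c (insert w \<tau>) = \<one>\<^bsub>add_monoid R\<^esub>"
        using conn[OF ins] True by simp
      then show "?s \<tau> w (connecting_chain X R \<epsilon> \<epsilon>' c (insert w \<tau>)) = \<one>\<^bsub>add_monoid R\<^esub>"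
        using signed_one[OF A.group_axioms] by (simp only:)
    qed
    then show ?thesis unfolding b conn[OF \<tau>] using True by (simp only: if_True)
  next
    case False
    have sub: "h_cofaces X \<epsilon> \<tau> \<subseteq> h_cofaces X \<epsilon>' \<tau>"
      using v fin by (auto simp: h_cofaces_def weight_insert)
    have "finprod (add_monoid R) (\<lambda>w. ?s \<tau> w (connecting_chain X R \<epsilon> \<epsilon>' c (insert w \<tau>))) (h_cofaces X \<epsilon>' \<tau>)
        = finprod (add_monoid R) (\<lambda>w. ?s \<tau> w (c (insert w \<tau>))) (h_cofaces X \<epsilon> \<tau>)"
    proof (rule A.finprod_mono_neutral_cong_right[OF _ sub])
      show "finite (h_cofaces X \<epsilon>' \<tau>)" by (simp add: h_cofaces_def)
      show "?s \<tau> w (connecting_chain X R \<epsilon> \<epsilon>' c (insert w \<tau>)) = \<one>\<^bsub>add_monoid R\<^esub>"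
        if "w \<in> h_cofaces X \<epsilon>' \<tau> - h_cofaces X \<epsilon> \<tau>" for w
      proof -
        have "w = v" using that v fin by (auto simp: h_cofaces_def weight_insert split: if_splits)
        then have "connecting_chain X R \<epsilon> \<epsilon>' c (insert w \<tau>) = \<one>\<^bsub>add_monoid R\<^esub>"
          using conn[OF ins[of w \<epsilon>'], of c] that by simp
        then show ?thesis using signed_one[OF A.group_axioms] by (simp only:)
      qed
      show "?s \<tau> w (connecting_chain X R \<epsilon> \<epsilon>' c (insert w \<tau>)) = ?s \<tau> w (c (insert w \<tau>))"
        if "w \<in> h_cofaces X \<epsilon> \<tau>" for w
      proof -
        have "w \<noteq> v" using that v fin by (auto simp: h_cofaces_def weight_insert)
        then show ?thesis using conn[OF ins[OF that]] False by simp
      qed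
      show "(\<lambda>w. ?s \<tau> w (connecting_chain X R \<epsilon> \<epsilon>' c (insert w \<tau>))) \<in> h_cofaces X \<epsilon>' \<tau> \<rightarrow> carrier (add_monoid R)"
      proof
        fix w assume "w \<in> h_cofaces X \<epsilon>' \<tau>"
        then show "?s \<tau> w (connecting_chain X R \<epsilon> \<epsilon>' c (insert w \<tau>)) \<in> carrier (add_monoid R)"
          using c'[OF ins] A.one_closed
          by (intro signed_closed[OF A.group_axioms]) (simp only: conn[OF ins] split: if_splits, simp)
      qed
    qed
    then show ?thesis unfolding b conn[OF \<tau>] using False by (simp only: if_False)
  qed
qed (simp_all add: connecting_chain_def horizontal_boundary_def)

lemma connecting_chain_preserves:
  assumes "fin_conn_complex X" "cring R" "covers X \<epsilon> \<epsilon>'"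
  shows "connecting_chain X R \<epsilon> \<epsilon>' ` h_cycles X R \<epsilon> \<subseteq> h_cycles X R \<epsilon>'"
    "connecting_chain X R \<epsilon> \<epsilon>' ` h_boundaries X R \<epsilon> \<subseteq> h_boundaries X R \<epsilon>'"
  using connecting_chain_boundary[OF assms(1,2) _ assms(3)]
  by (intro h_chain_map assms(2) connecting_chain_hom; blast)+

lemma connecting_map_hom:
  assumes "fin_conn_complex X" "cring R" "covers X \<epsilon> \<epsilon>'"
  shows "connecting_map X R \<epsilon> \<epsilon>' \<in> hom (h_homology X R \<epsilon>) (h_homology X R \<epsilon>')"
  unfolding connecting_map_def h_homology_def
  by (intro subquotient_pair.subquotient_map_hom h_subquotient_pair connecting_chain_hom
      connecting_chain_preserves assms)

text \<open>The composite keeps the simplices whose weight is the same for \<open>\<epsilon>\<close> and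
  \<open>\<epsilon>''\<close>. As the middle colouring does not appear in this description, squares of
  connecting maps commute.\<close>

lemma connecting_map_comp:
  assumes X: "fin_conn_complex X" and R: "cring R" and c1: "covers X \<epsilon> \<epsilon>1" and c2: "covers X \<epsilon>1 \<epsilon>''"
    and x: "x \<in> carrier (h_homology X R \<epsilon>)"
  shows "connecting_map X R \<epsilon>1 \<epsilon>'' (connecting_map X R \<epsilon> \<epsilon>1 x) = connecting_map X R \<epsilon> \<epsilon>'' x"
  unfolding connecting_map_def
proof (rule subquotient_map_comp[symmetric, OF h_subquotient_pair[OF X R] h_subquotient_pair[OF X R]
      h_subquotient_pair[OF X R] connecting_chain_hom[OF R] connecting_chain_preserves[OF X R c1]
      connecting_chain_hom[OF R] connecting_chain_preserves(2)[OF X R c2]])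
  fix c assume "c \<in> carrier (chain_group X R)"
  show "connecting_chain X R \<epsilon> \<epsilon>'' c = connecting_chain X R \<epsilon>1 \<epsilon>'' (connecting_chain X R \<epsilon> \<epsilon>1 c)"
  proof (rule extensionalityI[of _ "simps X"])
    fix \<sigma> assume \<sigma>: "\<sigma> \<in> simps X"
    have "weight \<epsilon>1 \<sigma> \<le> weight \<epsilon> \<sigma>" "weight \<epsilon>'' \<sigma> \<le> weight \<epsilon>1 \<sigma>"
      using covers_weight_le[OF c1] covers_weight_le[OF c2] fin_conn_complexD(4)[OF X \<sigma>] by blast+
    then show "connecting_chain X R \<epsilon> \<epsilon>'' c \<sigma> = connecting_chain X R \<epsilon>1 \<epsilon>'' (connecting_chain X R \<epsilon> \<epsilon>1 c) \<sigma>"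
      using \<sigma> by (auto simp: connecting_chain_def)
  qed (simp_all add: connecting_chain_def)
qed (use x in \<open>simp add: h_homology_def\<close>)

section \<open>Induced maps on horizontal homology\<close>

locale reg_ring_map = reg_map X Y f for X Y :: "'v scomplex" and f +
  fixes R S :: "'r ring" and \<phi>
  assumes R: "cring R" and S: "cring S" and \<phi>: "\<phi> \<in> ring_hom R S"
begin

lemma \<phi>_hom: "\<phi> \<in> hom (add_monoid R) (add_monoid S)"
  using \<phi> by (simp add: ring_hom_def hom_def)

lemma comm_group_R: "comm_group (add_monoid R)" and comm_group_S: "comm_group (add_monoid S)"
  and group_R: "group (add_monoid R)" and group_S: "group (add_monoid S)"
  using R S comm_group_add_monoid comm_group_imp_group by blast+

abbreviation "entry \<sigma> r \<equiv> signed (add_monoid S) (shuffle_sign X Y f \<sigma>) (\<phi> r)"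

lemma induced_chain_eq_monomial_map:
  "induced_chain X Y S f \<phi> = monomial_map (simps X) (simps Y) (image f) entry (\<lambda>_. add_monoid S)"
  by (intro ext) (simp add: induced_chain_def monomial_map_def matrix_map_def finsum_def shuffle_sign_def)

lemma image_f_inj: "inj_on (image f) (simps X)"
  by (rule inj_onI) (metis X f_inj fin_conn_complexD(3) inj_on_image_eq_iff)

lemma induced_matrix:
  "monomial_matrix (simps X) (\<lambda>_. add_monoid R) (simps Y) (\<lambda>_. add_monoid S) (image f) entry"
proof (rule monomial_matrix.intro)
  show "entry \<sigma> \<in> hom (add_monoid R) (add_monoid S)" for \<sigma>
    using Group.hom_compose[OF \<phi>_hom signed_hom[OF comm_group_add_monoid[OF S]]]
    by (simp add: o_def)
qed (rule comm_group_R comm_group_S f_simps image_f_inj; assumption?)+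

lemma induced_chain_hom: "induced_chain X Y S f \<phi> \<in> hom (chain_group X R) (chain_group Y S)"
  unfolding induced_chain_eq_monomial_map chain_group_def
  by (rule monomial_matrix.monomial_map_hom[OF induced_matrix])

text \<open>The only cofaces of \<open>f ` \<rho>\<close> that matter come from cofaces of
  \<open>\<rho>\<close>. A simplex of \<open>Y\<close> on image vertices need not be the image of a
  simplex, hence the second conjunct on the left.\<close>

lemma h_cofaces_push:
  assumes "\<rho> \<in> simps X" "v \<in> set (verts X)"
  shows "f v \<in> h_cofaces Y (push \<epsilon>) (f ` \<rho>) \<and> insert (f v) (f ` \<rho>) \<in> image f ` simps X \<longleftrightarrow> v \<in> h_cofaces X \<epsilon> \<rho>"
proof -
  have \<rho>: "\<rho> \<subseteq> set (verts X)" using X assms(1) by (rule fin_conn_complexD)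
  have out: "f v \<notin> f ` \<rho> \<longleftrightarrow> v \<notin> \<rho>" using assms \<rho> f_inj by (simp add: inj_on_image_mem_iff)
  have "insert v \<rho> \<in> simps X" if im: "insert (f v) (f ` \<rho>) \<in> image f ` simps X"
  proof -
    obtain \<sigma> where \<sigma>: "\<sigma> \<in> simps X" "f ` insert v \<rho> = f ` \<sigma>" using im by auto
    then have "insert v \<rho> = \<sigma>"
      using f_inj \<rho> assms fin_conn_complexD(3)[OF X \<sigma>(1)] by (metis inj_on_image_eq_iff insert_subset)
    then show ?thesis using \<sigma> by simp
  qed
  moreover have "insert (f v) (f ` \<rho>) \<in> image f ` simps X" "insert (f v) (f ` \<rho>) \<in> simps Y"
    if "insert v \<rho> \<in> simps X"
    using that f_simps[OF that] by (auto intro!: image_eqI[of _ _ "insert v \<rho>"])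
  moreover have "weight (push \<epsilon>) (insert (f v) (f ` \<rho>)) = weight \<epsilon> (insert v \<rho>)"
    using push_weight[of "insert v \<rho>" \<epsilon>] \<rho> assms by simp
  ultimately show ?thesis
    using out assms(2) f_verts[OF assms(2)] push_weight[OF \<rho>, of \<epsilon>] by (auto simp: h_cofaces_def)
qed

lemma induced_chain_boundary:
  assumes c: "c \<in> carrier (chain_group X R)"
  shows "induced_chain X Y S f \<phi> (horizontal_boundary X R \<epsilon> c)
    = horizontal_boundary Y S (push \<epsilon>) (induced_chain X Y S f \<phi> c)"
  unfolding induced_chain_eq_monomial_map horizontal_boundary_eq_matrix_map
proof (rule monomial_map_commute[OF boundary_matrix[OF R] boundary_matrix[OF S] induced_matrix induced_matrix,
      where q = "\<lambda>_. f"])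
  show "c \<in> carrier (product_group (simps X) (\<lambda>_. add_monoid R))" using c by (simp add: chain_group_def)
next
  fix \<rho> v assume h: "\<rho> \<in> simps X" "v \<in> h_cofaces X \<epsilon> \<rho>"
  then have v: "v \<in> set (verts X)" "v \<notin> \<rho>" by (auto simp: h_cofaces_def)
  show "f v \<in> h_cofaces Y (push \<epsilon>) (f ` \<rho>)" using h_cofaces_push[OF h(1) v(1)] h(2) by blast
  show "insert (f v) (f ` \<rho>) = f ` insert v \<rho>" by simp
  fix g assume "g \<in> carrier (add_monoid R)"
  then have pg: "\<phi> g \<in> carrier (add_monoid S)" by (rule hom_in_carrier[OF \<phi>_hom])
  have "shuffle_sign X Y f \<rho> + face_sign X \<rho> v = face_sign Y (f ` \<rho>) (f v) + shuffle_sign X Y f (insert v \<rho>)"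
    unfolding face_sign_def
    using f_verts f_inj v fin_conn_complexD(3,4)[OF X h(1)] fin_conn_complexD(1)[OF X]
      fin_conn_complexD(1)[OF Y]
    by (intro shuffle_sign_insert) (simp_all add: image_subset_iff)
  moreover have "\<phi> (signed (add_monoid R) (face_sign X \<rho> v) g) = signed (add_monoid S) (face_sign X \<rho> v) (\<phi> g)"
    by (rule hom_signed[OF group_R group_S \<phi>_hom]) fact
  ultimately show "entry \<rho> (signed (add_monoid R) (face_sign X \<rho> v) g)
      = signed (add_monoid S) (face_sign Y (f ` \<rho>) (f v)) (entry (insert v \<rho>) g)"
    using signed_signed[OF group_S pg] by (simp only:)
next
  fix \<rho> assume "\<rho> \<in> simps X"
  show "inj_on f (h_cofaces X \<epsilon> \<rho>)" using f_inj by (rule inj_on_subset) (auto simp: h_cofaces_def)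
next
  fix \<rho> l assume h: "\<rho> \<in> simps X" "l \<in> h_cofaces Y (push \<epsilon>) (f ` \<rho>)" "insert l (f ` \<rho>) \<in> image f ` simps X"
  then obtain \<sigma> where "\<sigma> \<in> simps X" "insert l (f ` \<rho>) = f ` \<sigma>" by blast
  moreover from this obtain v where "v \<in> \<sigma>" "l = f v" by blast
  ultimately have "v \<in> set (verts X)" "l = f v" using fin_conn_complexD(3)[OF X] by auto
  then show "l \<in> f ` h_cofaces X \<epsilon> \<rho>" using h_cofaces_push[OF h(1)] h(2,3) by blast
next
  fix \<tau> l assume h: "\<tau> \<in> simps Y" "l \<in> h_cofaces Y (push \<epsilon>) \<tau>" "insert l \<tau> \<in> image f ` simps X"
  then obtain \<sigma> where \<sigma>: "\<sigma> \<in> simps X" "insert l \<tau> = f ` \<sigma>" by auto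
  have "\<tau> \<subseteq> f ` \<sigma>" using \<sigma> by auto
  \<comment> \<open>Passing to a face of \<open>f ` \<sigma>\<close> stays in the image, as \<open>X\<close> is closed under nonempty faces.\<close>
  then obtain \<rho> where \<rho>: "\<rho> \<subseteq> \<sigma>" "\<tau> = f ` \<rho>" by (auto simp: subset_image_iff)
  then have "\<rho> \<in> simps X" using fin_conn_complexD(5)[OF X \<sigma>(1)] fin_conn_complexD(2)[OF Y h(1)] by auto
  then show "\<tau> \<in> image f ` simps X" using \<rho> by blast
qed

lemma induced_chain_preserves:
  "induced_chain X Y S f \<phi> ` h_cycles X R \<epsilon> \<subseteq> h_cycles Y S (push \<epsilon>)"
  "induced_chain X Y S f \<phi> ` h_boundaries X R \<epsilon> \<subseteq> h_boundaries Y S (push \<epsilon>)"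
  using h_chain_map[OF R S induced_chain_hom induced_chain_boundary] by blast+

lemma induced_h_hom:
  "induced_h X Y R S f \<phi> \<epsilon> \<in> hom (h_homology X R \<epsilon>) (h_homology Y S (push \<epsilon>))"
  unfolding induced_h_def h_homology_def
  by (intro subquotient_pair.subquotient_map_hom h_subquotient_pair induced_chain_hom
      induced_chain_preserves X Y R S)

lemma induced_chain_connecting:
  assumes c: "c \<in> carrier (chain_group X R)"
  shows "induced_chain X Y S f \<phi> (connecting_chain X R \<epsilon> \<epsilon>' c)
    = connecting_chain Y S (push \<epsilon>) (push \<epsilon>') (induced_chain X Y S f \<phi> c)"
proof -
  interpret M: monomial_matrix "simps X" "\<lambda>_. add_monoid R" "simps Y" "\<lambda>_. add_monoid S" "image f" entry
    by (rule induced_matrix)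
  have c': "c \<in> carrier (product_group (simps X) (\<lambda>_. add_monoid R))" using c by (simp add: chain_group_def)
  have cc: "connecting_chain X R \<epsilon> \<epsilon>' c \<in> carrier (product_group (simps X) (\<lambda>_. add_monoid R))"
    using hom_in_carrier[OF connecting_chain_hom[OF R] c] by (simp add: chain_group_def)
  show ?thesis
    unfolding induced_chain_eq_monomial_map
  proof (rule M.monomial_map_eqI[OF cc])
    fix \<sigma> assume \<sigma>: "\<sigma> \<in> simps X"
    have w: "weight (push \<mu>) (f ` \<sigma>) = weight \<mu> \<sigma>" for \<mu>
      using push_weight fin_conn_complexD(3)[OF X \<sigma>] .
    have "entry \<sigma> \<one>\<^bsub>add_monoid R\<^esub> = \<one>\<^bsub>add_monoid S\<^esub>"
      by (rule hom_one[OF M.entry_hom[OF \<sigma>] group_R group_S])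
    then show "connecting_chain Y S (push \<epsilon>) (push \<epsilon>') (M.mmap c) (f ` \<sigma>)
        = entry \<sigma> (connecting_chain X R \<epsilon> \<epsilon>' c \<sigma>)"
      using \<sigma> f_simps[OF \<sigma>] M.monomial_map_at[OF c' \<sigma>]
      by (simp add: connecting_chain_def w)
  next
    fix \<tau> assume \<tau>: "\<tau> \<in> simps Y" "\<tau> \<notin> image f ` simps X"
    then show "connecting_chain Y S (push \<epsilon>) (push \<epsilon>') (M.mmap c) \<tau> = \<one>\<^bsub>add_monoid S\<^esub>"
      using M.monomial_map_off[OF \<tau>, of c] by (simp add: connecting_chain_def)
  qed (simp add: connecting_chain_def)
qed

lemma induced_h_connecting:
  assumes cov: "covers X \<epsilon> \<epsilon>'" and x: "x \<in> carrier (h_homology X R \<epsilon>)"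
  shows "induced_h X Y R S f \<phi> \<epsilon>' (connecting_map X R \<epsilon> \<epsilon>' x)
    = connecting_map Y S (push \<epsilon>) (push \<epsilon>') (induced_h X Y R S f \<phi> \<epsilon> x)"
proof -
  let ?F = "\<lambda>c. induced_chain X Y S f \<phi> (connecting_chain X R \<epsilon> \<epsilon>' c)"
  let ?m = "subquotient_map (chain_group X R) (h_cycles X R \<epsilon>) (h_boundaries X R \<epsilon>)
      (chain_group Y S) (h_boundaries Y S (push \<epsilon>')) ?F"
  note x' = x[unfolded h_homology_def]
  have "?m x = induced_h X Y R S f \<phi> \<epsilon>' (connecting_map X R \<epsilon> \<epsilon>' x)"
    unfolding induced_h_def connecting_map_def
    by (rule subquotient_map_comp[OF h_subquotient_pair[OF X R] h_subquotient_pair[OF X R]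
          h_subquotient_pair[OF Y S] connecting_chain_hom[OF R] connecting_chain_preserves[OF X R cov]
          induced_chain_hom induced_chain_preserves(2) refl x'])
  moreover have "?m x = connecting_map Y S (push \<epsilon>) (push \<epsilon>') (induced_h X Y R S f \<phi> \<epsilon> x)"
    unfolding induced_h_def connecting_map_def
    by (rule subquotient_map_comp[OF h_subquotient_pair[OF X R] h_subquotient_pair[OF Y S]
          h_subquotient_pair[OF Y S] induced_chain_hom induced_chain_preserves
          connecting_chain_hom[OF S] connecting_chain_preserves(2)[OF Y S push_covers[OF cov]]])
      (simp_all only: induced_chain_connecting x')
  ultimately show ?thesis by simp
qed

end

lemma reg_ring_map_comp:
  assumes "reg_ring_map X Y f R S \<phi>" "reg_ring_map Y Z g S T \<psi>"
  shows "reg_ring_map X Z (compose (set (verts X)) g f) R T (compose (carrier R) \<psi> \<phi>)"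
proof -
  interpret f: reg_ring_map X Y f R S \<phi> by fact
  interpret g: reg_ring_map Y Z g S T \<psi> by fact
  have "(\<lambda>r. \<psi> (\<phi> r)) \<in> ring_hom R T"
    using ring_hom_trans[OF f.\<phi> g.\<phi>] by (simp add: o_def)
  then have "compose (carrier R) \<psi> \<phi> \<in> ring_hom R T"
    using f.R by (auto simp: ring_hom_def compose_def cring_def ring.ring_simprules)
  then show ?thesis
    by (intro reg_ring_map.intro reg_ring_map_axioms.intro reg_map_comp[OF f.reg_map_axioms g.reg_map_axioms] f.R g.S)
qed

lemma reg_ring_map_id:
  assumes "fin_conn_complex X" "cring R"
  shows "reg_ring_map X X (\<lambda>v\<in>set (verts X). v) R R (\<lambda>r\<in>carrier R. r)"
proof -
  have "(\<lambda>r\<in>carrier R. r) \<in> ring_hom R R"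
    using assms(2) by (auto simp: ring_hom_def cring_def ring.ring_simprules)
  then show ?thesis
    by (intro reg_ring_map.intro reg_ring_map_axioms.intro reg_map_id assms)
qed

lemma induced_h_id:
  assumes X: "fin_conn_complex X" and R: "cring R" and \<epsilon>: "\<epsilon> \<in> colourings X"
    and x: "x \<in> carrier (h_homology X R \<epsilon>)"
  shows "induced_h X X R R (\<lambda>v\<in>set (verts X). v) (\<lambda>r\<in>carrier R. r) \<epsilon> x = x"
proof -
  interpret reg_ring_map X X "\<lambda>v\<in>set (verts X). v" R R "\<lambda>r\<in>carrier R. r"
    using X R by (rule reg_ring_map_id)
  show ?thesis
    unfolding induced_h_def push_id[OF X \<epsilon>]
  proof (rule subquotient_pair.subquotient_map_id[OF h_subquotient_pair[OF X R]])
    fix c assume c: "c \<in> carrier (chain_group X R)"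
    show "induced_chain X X R (\<lambda>v\<in>set (verts X). v) (\<lambda>r\<in>carrier R. r) c = c"
      unfolding induced_chain_eq_monomial_map
    proof (rule monomial_map_id)
      fix \<sigma> assume \<sigma>: "\<sigma> \<in> simps X"
      have sub: "\<sigma> \<subseteq> set (verts X)" using fin_conn_complexD(3)[OF X \<sigma>] .
      then show "(\<lambda>v\<in>set (verts X). v) ` \<sigma> = \<sigma>" by (auto simp: subset_iff image_iff)
      have "shuffle_sign X X (\<lambda>v\<in>set (verts X). v) \<sigma> = 0"
        using fin_conn_complexD(1)[OF X] fin_conn_complexD(4)[OF X \<sigma>] sub by (intro shuffle_sign_id) simp_all
      then show "entry \<sigma> r = r" if "r \<in> carrier (add_monoid R)" for r using that by simp
    qed (use c comm_group_R in \<open>simp_all only: chain_group_def\<close>)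
  qed (use x in \<open>simp add: h_homology_def\<close>)
qed

lemma induced_h_comp:
  assumes f: "reg_ring_map X Y f R S \<phi>" and g: "reg_ring_map Y Z g S T \<psi>"
    and x: "x \<in> carrier (h_homology X R \<epsilon>)"
  shows "induced_h X Z R T (compose (set (verts X)) g f) (compose (carrier R) \<psi> \<phi>) \<epsilon> x
    = induced_h Y Z S T g \<psi> (push_colouring X Y f \<epsilon>) (induced_h X Y R S f \<phi> \<epsilon> x)"
proof -
  interpret f: reg_ring_map X Y f R S \<phi> by fact
  interpret g: reg_ring_map Y Z g S T \<psi> by fact
  let ?gf = "compose (set (verts X)) g f"
  interpret h: reg_ring_map X Z ?gf R T "compose (carrier R) \<psi> \<phi>"
    using f g by (rule reg_ring_map_comp)
  show ?thesis
    unfolding induced_h_def push_comp[OF f.reg_map_axioms g.reg_map_axioms]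
  proof (rule subquotient_map_comp[OF h_subquotient_pair[OF f.X f.R] h_subquotient_pair[OF g.X g.R]
        h_subquotient_pair[OF g.Y g.S] f.induced_chain_hom f.induced_chain_preserves
        g.induced_chain_hom g.induced_chain_preserves(2)])
    fix c assume c: "c \<in> carrier (chain_group X R)"
    show "induced_chain X Z T ?gf (compose (carrier R) \<psi> \<phi>) c
        = induced_chain Y Z T g \<psi> (induced_chain X Y S f \<phi> c)"
      unfolding h.induced_chain_eq_monomial_map f.induced_chain_eq_monomial_map g.induced_chain_eq_monomial_map
    proof (rule monomial_map_comp[OF f.induced_matrix g.induced_matrix h.induced_matrix])
      fix \<sigma> assume \<sigma>: "\<sigma> \<in> simps X"
      have sub: "\<sigma> \<subseteq> set (verts X)" using fin_conn_complexD(3)[OF f.X \<sigma>] .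
      show "?gf ` \<sigma> = g ` f ` \<sigma>" using sub by (auto simp: compose_def subset_iff image_iff)
      fix r assume r: "r \<in> carrier (add_monoid R)"
      have gS: "group (add_monoid S)" "group (add_monoid T)"
        using comm_group_add_monoid[OF f.S] comm_group_add_monoid[OF g.S] by (simp_all add: comm_group_imp_group)
      have pr: "\<phi> r \<in> carrier (add_monoid S)" using hom_in_carrier[OF f.\<phi>_hom r] .
      then have ppr: "\<psi> (\<phi> r) \<in> carrier (add_monoid T)" by (rule hom_in_carrier[OF g.\<phi>_hom])
      have "shuffle_sign X Z ?gf \<sigma> = shuffle_sign Y Z g (f ` \<sigma>) + shuffle_sign X Y f \<sigma>"
        using f.f_verts f.f_inj g.f_verts g.f_inj sub fin_conn_complexD(4)[OF f.X \<sigma>]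
          fin_conn_complexD(1)[OF f.X] fin_conn_complexD(1)[OF f.Y] fin_conn_complexD(1)[OF g.Y]
        by (intro shuffle_sign_comp) (simp_all add: image_subset_iff compose_eq)
      moreover have "\<psi> (signed (add_monoid S) b (\<phi> r)) = signed (add_monoid T) b (\<psi> (\<phi> r))" for b
        using gS g.\<phi>_hom pr by (rule hom_signed)
      moreover have "compose (carrier R) \<psi> \<phi> r = \<psi> (\<phi> r)" using r by (simp add: compose_eq)
      ultimately show "h.entry \<sigma> r = g.entry (f ` \<sigma>) (f.entry \<sigma> r)"
        by (simp only: signed_signed[OF gS(2) ppr])
    qed (use c in \<open>simp add: chain_group_def\<close>)
  qed (use x in \<open>simp add: h_homology_def\<close>)
qed

section \<open>Ueberhomology\<close>

definition colourings_at :: "'v scomplex \<Rightarrow> int \<Rightarrow> ('v \<Rightarrow> nat) set"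
  where "colourings_at X j = {\<epsilon> \<in> colourings X. ell X \<epsilon> = j}"

lemma uber_chains_colourings_at: "uber_chains X R j = product_group (colourings_at X j) (h_homology X R)"
  by (simp add: uber_chains_def colourings_at_def)

lemma comm_group_uber_chains:
  "fin_conn_complex X \<Longrightarrow> cring R \<Longrightarrow> comm_group (uber_chains X R j)"
  unfolding uber_chains_colourings_at by (intro comm_group_product_group comm_group_h_homology)

abbreviation diff_entry ::
    "(('v \<Rightarrow> nat) \<Rightarrow> ('v \<Rightarrow> nat) \<Rightarrow> bit) \<Rightarrow> 'v scomplex \<Rightarrow> 'r ring \<Rightarrow> ('v \<Rightarrow> nat) \<Rightarrow> ('v \<Rightarrow> nat)
      \<Rightarrow> ('v set \<Rightarrow> 'r) set \<Rightarrow> ('v set \<Rightarrow> 'r) set"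
  where "diff_entry s X R \<epsilon>' \<epsilon> h \<equiv> signed (h_homology X R \<epsilon>') (s \<epsilon> \<epsilon>') (connecting_map X R \<epsilon> \<epsilon>' h)"

lemma uber_diff_eq_matrix_map:
  assumes "k = j + 1"
  shows "uber_diff s X R j
    = matrix_map (colourings_at X k) (\<lambda>\<epsilon>'. {\<epsilon>. covers X \<epsilon> \<epsilon>'}) (\<lambda>_ \<epsilon>. \<epsilon>) (diff_entry s X R) (h_homology X R)"
  by (intro ext) (simp add: uber_diff_def matrix_map_def colourings_at_def assms)

lemma diff_entry_hom:
  assumes "fin_conn_complex X" "cring R" "covers X \<epsilon> \<epsilon>'"
  shows "diff_entry s X R \<epsilon>' \<epsilon> \<in> hom (h_homology X R \<epsilon>) (h_homology X R \<epsilon>')"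
  using Group.hom_compose[OF connecting_map_hom[OF assms] signed_hom[OF comm_group_h_homology[OF assms(1,2)]]]
  by (simp add: o_def)

lemma uber_matrix:
  assumes "fin_conn_complex X" "cring R" "k = j + 1"
  shows "group_matrix (colourings_at X j) (h_homology X R) (colourings_at X k) (h_homology X R)
    (\<lambda>\<epsilon>'. {\<epsilon>. covers X \<epsilon> \<epsilon>'}) (\<lambda>_ \<epsilon>. \<epsilon>) (diff_entry s X R)"
proof (rule group_matrix.intro)
  show "finite {\<epsilon>. covers X \<epsilon> \<epsilon>'}" for \<epsilon>'
    by (rule finite_subset[OF _ finite_colourings[of X]]) (auto dest: coversD)
  show "\<epsilon> \<in> colourings_at X j" if "\<epsilon>' \<in> colourings_at X k" "\<epsilon> \<in> {\<epsilon>. covers X \<epsilon> \<epsilon>'}" for \<epsilon> \<epsilon>'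
    using that assms(3) covers_ell[of X \<epsilon> \<epsilon>'] coversD(1)[of X \<epsilon> \<epsilon>'] by (simp add: colourings_at_def)
qed (simp_all only: mem_Collect_eq comm_group_h_homology[OF assms(1,2)] diff_entry_hom[OF assms(1,2)])

lemma uber_diff_hom:
  assumes "fin_conn_complex X" "cring R" "k = j + 1"
  shows "uber_diff s X R j \<in> hom (uber_chains X R j) (uber_chains X R k)"
  unfolding uber_diff_eq_matrix_map[OF assms(3)] uber_chains_colourings_at
  by (rule group_matrix.matrix_map_hom[OF uber_matrix[OF assms]])

text \<open>Connecting maps commute around each square and the signs anticommute.\<close>

lemma uber_diff_square:
  assumes X: "fin_conn_complex X" and R: "cring R" and s: "sign_assignment X s"
    and k: "k = j + 1" "l = k + 1" and x: "x \<in> carrier (uber_chains X R j)"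
  shows "uber_diff s X R k (uber_diff s X R j x) = \<one>\<^bsub>uber_chains X R l\<^esub>"
  unfolding uber_diff_eq_matrix_map[OF k(1)] uber_diff_eq_matrix_map[OF k(2)] uber_chains_colourings_at
proof (rule matrix_map_square_zero[OF uber_matrix[OF X R k(1)] uber_matrix[OF X R k(2)],
      where \<iota> = "\<lambda>\<epsilon>'' (\<epsilon>1, \<epsilon>). (\<lambda>v\<in>set (verts X). \<epsilon> v + \<epsilon>'' v - \<epsilon>1 v, \<epsilon>)"])
  fix \<epsilon>'' \<epsilon>1 \<epsilon> assume "\<epsilon>1 \<in> {\<epsilon>. covers X \<epsilon> \<epsilon>''}" "\<epsilon> \<in> {\<epsilon>. covers X \<epsilon> \<epsilon>1}"
  then have c: "covers X \<epsilon>1 \<epsilon>''" "covers X \<epsilon> \<epsilon>1" by simp_all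
  \<comment> \<open>Paths through \<open>\<epsilon>1\<close> are paired with paths through the other middle colouring \<open>\<epsilon>2\<close>.\<close>
  define \<epsilon>2 where "\<epsilon>2 = (\<lambda>v\<in>set (verts X). \<epsilon> v + \<epsilon>'' v - \<epsilon>1 v)"
  note sq = covers_square[OF c, folded \<epsilon>2_def]
  have gr: "group (h_homology X R \<mu>)" for \<mu>
    using comm_group_h_homology[OF X R] by (rule comm_group_imp_group)
  have two: "diff_entry s X R \<epsilon>'' \<mu> (diff_entry s X R \<mu> \<epsilon> g)
      = signed (h_homology X R \<epsilon>'') (s \<mu> \<epsilon>'' + s \<epsilon> \<mu>) (connecting_map X R \<epsilon> \<epsilon>'' g)"
    and cl: "connecting_map X R \<epsilon> \<epsilon>'' g \<in> carrier (h_homology X R \<epsilon>'')"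
    if "covers X \<epsilon> \<mu>" "covers X \<mu> \<epsilon>''" "g \<in> carrier (h_homology X R \<epsilon>)" for g \<mu>
  proof -
    have 1: "connecting_map X R \<epsilon> \<mu> g \<in> carrier (h_homology X R \<mu>)"
      using hom_in_carrier[OF connecting_map_hom[OF X R that(1)] that(3)] .
    show 2: "connecting_map X R \<epsilon> \<epsilon>'' g \<in> carrier (h_homology X R \<epsilon>'')"
      using hom_in_carrier[OF connecting_map_hom[OF X R that(2)] 1]
      unfolding connecting_map_comp[OF X R that] .
    show "diff_entry s X R \<epsilon>'' \<mu> (diff_entry s X R \<mu> \<epsilon> g)
      = signed (h_homology X R \<epsilon>'') (s \<mu> \<epsilon>'' + s \<epsilon> \<mu>) (connecting_map X R \<epsilon> \<epsilon>'' g)"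
      by (simp only: hom_signed[OF gr gr connecting_map_hom[OF X R that(2)] 1]
          connecting_map_comp[OF X R that] signed_signed[OF gr 2])
  qed
  have "s \<epsilon> \<epsilon>2 + s \<epsilon>2 \<epsilon>'' = s \<epsilon> \<epsilon>1 + s \<epsilon>1 \<epsilon>'' + 1"
    using s c sq(1-3) unfolding sign_assignment_def by blast
  then have sg: "s \<epsilon>2 \<epsilon>'' + s \<epsilon> \<epsilon>2 = s \<epsilon>1 \<epsilon>'' + s \<epsilon> \<epsilon>1 + 1" by (simp only: add.commute)
  have "diff_entry s X R \<epsilon>'' \<epsilon>1 (diff_entry s X R \<epsilon>1 \<epsilon> g) \<otimes>\<^bsub>h_homology X R \<epsilon>''\<^esub>
      diff_entry s X R \<epsilon>'' \<epsilon>2 (diff_entry s X R \<epsilon>2 \<epsilon> g) = \<one>\<^bsub>h_homology X R \<epsilon>''\<^esub>"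
    if g: "g \<in> carrier (h_homology X R \<epsilon>)" for g
    by (simp only: two[OF c(2,1) g] two[OF sq(2,1) g] sg signed_cancel[OF gr cl[OF c(2,1) g]])
  then show "\<exists>m' m. (case (\<epsilon>1, \<epsilon>) of (\<epsilon>1, \<epsilon>) \<Rightarrow> (\<lambda>v\<in>set (verts X). \<epsilon> v + \<epsilon>'' v - \<epsilon>1 v, \<epsilon>)) = (m', m)
      \<and> (case (m', m) of (\<epsilon>1, \<epsilon>) \<Rightarrow> (\<lambda>v\<in>set (verts X). \<epsilon> v + \<epsilon>'' v - \<epsilon>1 v, \<epsilon>)) = (\<epsilon>1, \<epsilon>)
      \<and> (m', m) \<noteq> (\<epsilon>1, \<epsilon>) \<and> m' \<in> {\<epsilon>. covers X \<epsilon> \<epsilon>''} \<and> m \<in> {\<epsilon>. covers X \<epsilon> m'} \<and> m = \<epsilon>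
      \<and> (\<forall>g\<in>carrier (h_homology X R \<epsilon>).
          diff_entry s X R \<epsilon>'' \<epsilon>1 (diff_entry s X R \<epsilon>1 \<epsilon> g) \<otimes>\<^bsub>h_homology X R \<epsilon>''\<^esub>
          diff_entry s X R \<epsilon>'' m' (diff_entry s X R m' m g) = \<one>\<^bsub>h_homology X R \<epsilon>''\<^esub>)"
    using sq by (intro exI[of _ \<epsilon>2] exI[of _ \<epsilon>]) (simp only: prod.case \<epsilon>2_def[symmetric] mem_Collect_eq, simp)
qed (use x in \<open>simp only: uber_chains_colourings_at\<close>)

lemma uber_subquotient_pair:
  assumes "fin_conn_complex X" "cring R" "sign_assignment X s"
  shows "subquotient_pair (uber_chains X R j) (uber_cycles s X R j) (uber_boundaries s X R j)"
  unfolding uber_cycles_def uber_boundaries_def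
  by (rule subquotient_pair_complex[OF comm_group_uber_chains comm_group_uber_chains comm_group_uber_chains])
    (use assms in \<open>auto intro: uber_diff_hom uber_diff_square\<close>)

lemma comm_group_uberhomology:
  assumes "fin_conn_complex X" "cring R" "sign_assignment X s"
  shows "comm_group (uberhomology s X R j)"
  unfolding uberhomology_def
  by (rule subquotient_pair.comm_group_subquotient[OF uber_subquotient_pair[OF assms]])

section \<open>Induced maps on ueberhomology\<close>

locale uber_map_data = reg_ring_map X Y f R S \<phi>
  for X Y :: "'v scomplex" and f and R S :: "'r ring" and \<phi> +
  fixes s t
  assumes s: "sign_assignment X s" and t: "sign_assignment Y t"
begin

abbreviation "\<eta> \<equiv> sign_correction s t X Y f"

abbreviation "ind_entry \<epsilon> h \<equiv> signed (h_homology Y S (push \<epsilon>)) (\<eta> \<epsilon>) (induced_h X Y R S f \<phi> \<epsilon> h)"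

lemma group_h_X: "group (h_homology X R \<epsilon>)" and group_h_Y: "group (h_homology Y S \<mu>)"
  using comm_group_h_homology X Y R S comm_group_imp_group by blast+

lemma ind_entry_hom: "ind_entry \<epsilon> \<in> hom (h_homology X R \<epsilon>) (h_homology Y S (push \<epsilon>))"
  using Group.hom_compose[OF induced_h_hom signed_hom[OF comm_group_h_homology[OF Y S]]]
  by (simp add: o_def)

lemma ind_matrix:
  assumes "k = j + vertex_excess X Y"
  shows "monomial_matrix (colourings_at X j) (h_homology X R) (colourings_at Y k) (h_homology Y S) push ind_entry"
proof (rule monomial_matrix.intro)
  show "push \<epsilon> \<in> colourings_at Y k" if "\<epsilon> \<in> colourings_at X j" for \<epsilon>
    using that assms push_in[of \<epsilon>] push_ell[of \<epsilon>] by (simp add: colourings_at_def)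
  show "inj_on push (colourings_at X j)"
    using push_inj by (rule inj_on_subset) (auto simp: colourings_at_def)
qed (rule comm_group_h_homology X Y R S ind_entry_hom)+

text \<open>The identity concerns chains only, since a product in a group is meaningful only if its
  factors lie in the group.\<close>

lemma induced_uchain_eq_monomial_map:
  assumes k: "k = j + vertex_excess X Y" and x: "x \<in> carrier (uber_chains X R j)"
  shows "induced_uchain s t X Y R S f \<phi> j x
    = monomial_map (colourings_at X j) (colourings_at Y k) push ind_entry (h_homology Y S) x"
proof (rule extensionalityI[of _ "colourings_at Y k"])
  fix \<mu> assume \<mu>: "\<mu> \<in> colourings_at Y k"
  interpret H: comm_group "h_homology Y S \<mu>" using Y S by (rule comm_group_h_homology)
  have fib: "{\<epsilon> \<in> colourings X. push \<epsilon> = \<mu>} = {\<epsilon> \<in> colourings_at X j. push \<epsilon> = \<mu>}"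
    using \<mu> k push_ell by (auto simp: colourings_at_def)
  have "finprod (h_homology Y S \<mu>) (\<lambda>\<epsilon>. signed (h_homology Y S \<mu>) (\<eta> \<epsilon>) (induced_h X Y R S f \<phi> \<epsilon> (x \<epsilon>)))
        {\<epsilon> \<in> colourings X. push \<epsilon> = \<mu>}
      = finprod (h_homology Y S \<mu>) (\<lambda>\<epsilon>. ind_entry \<epsilon> (x \<epsilon>)) {\<epsilon> \<in> colourings_at X j. push \<epsilon> = \<mu>}"
  proof (rule H.finprod_cong'[OF fib])
    show "(\<lambda>\<epsilon>. ind_entry \<epsilon> (x \<epsilon>)) \<in> {\<epsilon> \<in> colourings_at X j. push \<epsilon> = \<mu>} \<rightarrow> carrier (h_homology Y S \<mu>)"
    proof
      fix \<epsilon> assume "\<epsilon> \<in> {\<epsilon> \<in> colourings_at X j. push \<epsilon> = \<mu>}"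
      moreover from this have "x \<epsilon> \<in> carrier (h_homology X R \<epsilon>)"
        using x by (auto simp: uber_chains_colourings_at PiE_iff)
      ultimately show "ind_entry \<epsilon> (x \<epsilon>) \<in> carrier (h_homology Y S \<mu>)"
        using hom_in_carrier[OF ind_entry_hom, of "x \<epsilon>" \<epsilon>] by simp
    qed
  qed simp
  then show "induced_uchain s t X Y R S f \<phi> j x \<mu>
      = monomial_map (colourings_at X j) (colourings_at Y k) push ind_entry (h_homology Y S) x \<mu>"
    using \<mu> k by (simp add: induced_uchain_def monomial_map_def matrix_map_def colourings_at_def)
qed (use k in \<open>simp_all add: induced_uchain_def monomial_map_def matrix_map_def colourings_at_def\<close>)

lemma induced_uchain_hom:
  assumes k: "k = j + vertex_excess X Y"
  shows "induced_uchain s t X Y R S f \<phi> j \<in> hom (uber_chains X R j) (uber_chains Y S k)"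
proof -
  interpret X: comm_group "uber_chains X R j" using X R by (rule comm_group_uber_chains)
  have "monomial_map (colourings_at X j) (colourings_at Y k) push ind_entry (h_homology Y S)
      \<in> hom (uber_chains X R j) (uber_chains Y S k)"
    unfolding uber_chains_colourings_at by (rule monomial_matrix.monomial_map_hom[OF ind_matrix[OF k]])
  then show ?thesis
    by (rule X.hom_eq) (simp add: induced_uchain_eq_monomial_map[OF k])
qed

lemma induced_uchain_diff:
  assumes j': "j' = j + 1" and k: "k = j + vertex_excess X Y" and x: "x \<in> carrier (uber_chains X R j)"
  shows "induced_uchain s t X Y R S f \<phi> j' (uber_diff s X R j x)
    = uber_diff t Y S k (induced_uchain s t X Y R S f \<phi> j x)"
proof -
  define k' where "k' = k + 1"
  then have k': "k' = j' + vertex_excess X Y" using j' k by simp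
  have dx: "uber_diff s X R j x \<in> carrier (uber_chains X R j')"
    using hom_in_carrier[OF uber_diff_hom[OF X R j'] x] .
  show ?thesis
    unfolding induced_uchain_eq_monomial_map[OF k x] induced_uchain_eq_monomial_map[OF k' dx]
    unfolding uber_diff_eq_matrix_map[OF j'] uber_diff_eq_matrix_map[OF k'_def]
  proof (rule monomial_map_commute[OF uber_matrix[OF X R j'] uber_matrix[OF Y S k'_def]
        ind_matrix[OF k] ind_matrix[OF k'], where q = "\<lambda>_. push"])
    fix \<epsilon>' \<epsilon> assume "\<epsilon> \<in> {\<epsilon>. covers X \<epsilon> \<epsilon>'}"
    then have c: "covers X \<epsilon> \<epsilon>'" by simp
    show "push \<epsilon> \<in> {\<epsilon>. covers Y \<epsilon> (push \<epsilon>')}" using push_covers[OF c] by simp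
    fix h assume h: "h \<in> carrier (h_homology X R \<epsilon>)"
    have 1: "connecting_map X R \<epsilon> \<epsilon>' h \<in> carrier (h_homology X R \<epsilon>')"
      using hom_in_carrier[OF connecting_map_hom[OF X R c] h] .
    have 2: "induced_h X Y R S f \<phi> \<epsilon> h \<in> carrier (h_homology Y S (push \<epsilon>))"
      using hom_in_carrier[OF induced_h_hom h] .
    note conn_hom = connecting_map_hom[OF Y S push_covers[OF c]]
    have 3: "connecting_map Y S (push \<epsilon>) (push \<epsilon>') (induced_h X Y R S f \<phi> \<epsilon> h)
        \<in> carrier (h_homology Y S (push \<epsilon>'))"
      using hom_in_carrier[OF conn_hom 2] .
    show "ind_entry \<epsilon>' (diff_entry s X R \<epsilon>' \<epsilon> h) = diff_entry t Y S (push \<epsilon>') (push \<epsilon>) (ind_entry \<epsilon> h)"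
      by (simp only: hom_signed[OF group_h_X group_h_Y induced_h_hom 1] induced_h_connecting[OF c h]
          hom_signed[OF group_h_Y group_h_Y conn_hom 2] signed_signed[OF group_h_Y 3]
          sign_correction_covers[OF reg_map_axioms s t c])
  next
    fix \<epsilon>'
    show "inj_on push {\<epsilon>. covers X \<epsilon> \<epsilon>'}"
      using push_inj by (rule inj_on_subset) (auto dest: coversD)
  next
    fix \<epsilon>' \<mu> assume h: "\<epsilon>' \<in> colourings_at X j'" "\<mu> \<in> {\<epsilon>. covers Y \<epsilon> (push \<epsilon>')}" "\<mu> \<in> push ` colourings_at X j"
    then obtain \<epsilon> where "\<epsilon> \<in> colourings X" "\<mu> = push \<epsilon>" by (auto simp: colourings_at_def)
    then show "\<mu> \<in> push ` {\<epsilon>. covers X \<epsilon> \<epsilon>'}"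
      using h(1,2) push_covers_iff[of \<epsilon> \<epsilon>'] by (auto simp: colourings_at_def)
  next
    fix \<mu>' \<mu> assume h: "\<mu> \<in> {\<epsilon>. covers Y \<epsilon> \<mu>'}" "\<mu> \<in> push ` colourings_at X j"
    then obtain \<epsilon> where \<epsilon>: "\<epsilon> \<in> colourings X" "ell X \<epsilon> = j" "\<mu> = push \<epsilon>" by (auto simp: colourings_at_def)
    then obtain \<epsilon>' where "covers X \<epsilon> \<epsilon>'" "\<mu>' = push \<epsilon>'" using covers_push[of \<epsilon> \<mu>'] h(1) by auto
    then show "\<mu>' \<in> push ` colourings_at X j'"
      using \<epsilon> j' covers_ell[of X \<epsilon> \<epsilon>'] coversD(2)[of X \<epsilon> \<epsilon>'] by (simp add: colourings_at_def)
  qed (use x in \<open>simp_all only: uber_chains_colourings_at\<close>)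
qed

lemma induced_uchain_preserves:
  assumes k: "k = j + vertex_excess X Y"
  shows "induced_uchain s t X Y R S f \<phi> j ` uber_cycles s X R j \<subseteq> uber_cycles t Y S k"
    and "induced_uchain s t X Y R S f \<phi> j ` uber_boundaries s X R j \<subseteq> uber_boundaries t Y S k"
proof -
  have k1: "k + 1 = (j + 1) + vertex_excess X Y" and k2: "k - 1 = (j - 1) + vertex_excess X Y"
    using k by simp_all
  show "induced_uchain s t X Y R S f \<phi> j ` uber_cycles s X R j \<subseteq> uber_cycles t Y S k"
    unfolding uber_cycles_def
    by (rule chain_map_kernel[OF comm_group_uber_chains[OF X R] comm_group_uber_chains[OF Y S]
          induced_uchain_hom[OF k] induced_uchain_hom[OF k1]])
      (rule induced_uchain_diff[OF refl k])
  show "induced_uchain s t X Y R S f \<phi> j ` uber_boundaries s X R j \<subseteq> uber_boundaries t Y S k"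
    unfolding uber_boundaries_def
    by (rule chain_map_image[OF induced_uchain_hom[OF k2]])
      (rule induced_uchain_diff[OF _ k2], simp_all)
qed

lemma uber_map_hom:
  "subquotient_map (uber_chains X R j) (uber_cycles s X R j) (uber_boundaries s X R j)
     (uber_chains Y S (j + vertex_excess X Y)) (uber_boundaries t Y S (j + vertex_excess X Y))
     (induced_uchain s t X Y R S f \<phi> j)
   \<in> hom (uberhomology s X R j) (uberhomology t Y S (j + vertex_excess X Y))"
  unfolding uberhomology_def
  by (intro subquotient_pair.subquotient_map_hom uber_subquotient_pair induced_uchain_hom
      induced_uchain_preserves X Y R S s t refl)

end

lemma induced_uchain_id:
  assumes X: "fin_conn_complex X" and R: "cring R" and s: "sign_assignment X s"
    and x: "x \<in> carrier (uber_chains X R j)"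
  shows "induced_uchain s s X X R R (\<lambda>v\<in>set (verts X). v) (\<lambda>r\<in>carrier R. r) j x = x"
proof -
  interpret uber_map_data X X "\<lambda>v\<in>set (verts X). v" R R "\<lambda>r\<in>carrier R. r" s s
    by (intro uber_map_data.intro uber_map_data_axioms.intro reg_ring_map_id X R s)
  have j: "j = j + vertex_excess X X" by (simp add: vertex_excess_def)
  show ?thesis
    unfolding induced_uchain_eq_monomial_map[OF j x]
  proof (rule monomial_map_id)
    fix \<epsilon> assume "\<epsilon> \<in> colourings_at X j"
    then have \<epsilon>: "\<epsilon> \<in> colourings X" by (simp add: colourings_at_def)
    show "push \<epsilon> = \<epsilon>" using X \<epsilon> by (rule push_id)
    show "ind_entry \<epsilon> h = h" if "h \<in> carrier (h_homology X R \<epsilon>)" for h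
      by (simp only: sign_correction_id[OF X \<epsilon>] induced_h_id[OF X R \<epsilon> that] signed_zero)
  qed (use x comm_group_h_homology[OF X R] in \<open>simp_all only: uber_chains_colourings_at\<close>)
qed

lemma induced_uchain_comp:
  assumes f: "uber_map_data X Y f R S \<phi> s t" and g: "uber_map_data Y Z g S T \<psi> t u"
    and k: "k = j + vertex_excess X Y" and x: "x \<in> carrier (uber_chains X R j)"
  shows "induced_uchain s u X Z R T (compose (set (verts X)) g f) (compose (carrier R) \<psi> \<phi>) j x
    = induced_uchain t u Y Z S T g \<psi> k (induced_uchain s t X Y R S f \<phi> j x)"
proof -
  interpret f: uber_map_data X Y f R S \<phi> s t by fact
  interpret g: uber_map_data Y Z g S T \<psi> t u by fact
  let ?gf = "compose (set (verts X)) g f"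
  interpret h: uber_map_data X Z ?gf R T "compose (carrier R) \<psi> \<phi>" s u
    by (intro uber_map_data.intro uber_map_data_axioms.intro f.s g.t
        reg_ring_map_comp[OF f.reg_ring_map_axioms g.reg_ring_map_axioms])
  define l where "l = k + vertex_excess Y Z"
  then have l: "l = j + vertex_excess X Z" using k by (simp add: vertex_excess_def)
  have y: "induced_uchain s t X Y R S f \<phi> j x \<in> carrier (uber_chains Y S k)"
    using hom_in_carrier[OF f.induced_uchain_hom[OF k] x] .
  show ?thesis
    unfolding h.induced_uchain_eq_monomial_map[OF l x] g.induced_uchain_eq_monomial_map[OF l_def y]
    unfolding f.induced_uchain_eq_monomial_map[OF k x]
  proof (rule monomial_map_comp[OF f.ind_matrix[OF k] g.ind_matrix[OF l_def] h.ind_matrix[OF l]])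
    fix \<epsilon> assume "\<epsilon> \<in> colourings_at X j"
    then have \<epsilon>: "\<epsilon> \<in> colourings X" by (simp add: colourings_at_def)
    show p: "h.push \<epsilon> = g.push (f.push \<epsilon>)" by (rule push_comp[OF f.reg_map_axioms g.reg_map_axioms])
    fix h assume h: "h \<in> carrier (h_homology X R \<epsilon>)"
    have 1: "induced_h X Y R S f \<phi> \<epsilon> h \<in> carrier (h_homology Y S (f.push \<epsilon>))"
      using hom_in_carrier[OF f.induced_h_hom h] .
    have 2: "induced_h Y Z S T g \<psi> (f.push \<epsilon>) (induced_h X Y R S f \<phi> \<epsilon> h)
        \<in> carrier (h_homology Z T (g.push (f.push \<epsilon>)))"
      using hom_in_carrier[OF g.induced_h_hom 1] .
    show "h.ind_entry \<epsilon> h = g.ind_entry (f.push \<epsilon>) (f.ind_entry \<epsilon> h)"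
      by (simp only: p sign_correction_comp[OF f.reg_map_axioms g.reg_map_axioms f.s f.t g.t \<epsilon>]
          induced_h_comp[OF f.reg_ring_map_axioms g.reg_ring_map_axioms h]
          hom_signed[OF g.group_h_X g.group_h_Y g.induced_h_hom 1] signed_signed[OF g.group_h_Y 2])
  qed (use x in \<open>simp only: uber_chains_colourings_at\<close>)
qed

section \<open>Functoriality\<close>

lemma RegSimpl_simps:
  "X \<in> Obj RegSimpl \<longleftrightarrow> fin_conn_complex X"
  "Idt RegSimpl X = (\<lambda>v\<in>set (verts X). v)"
  "Comp RegSimpl X Y Z g f = compose (set (verts X)) g f"
  by (simp_all add: RegSimpl_def)

lemma CRing_simps:
  "R \<in> Obj CRing \<longleftrightarrow> cring R"
  "\<phi> \<in> Hom CRing R S \<longleftrightarrow> \<phi> \<in> ring_hom R S \<and> \<phi> \<in> extensional (carrier R)"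
  "Idt CRing R = (\<lambda>r\<in>carrier R. r)"
  "Comp CRing R S T \<psi> \<phi> = compose (carrier R) \<psi> \<phi>"
  by (simp_all add: CRing_def)

lemma reg_ring_mapI:
  assumes "X \<in> Obj RegSimpl" "Y \<in> Obj RegSimpl" "f \<in> Hom RegSimpl X Y"
    and "R \<in> Obj CRing" "S \<in> Obj CRing" "\<phi> \<in> Hom CRing R S"
  shows "reg_ring_map X Y f R S \<phi>"
  using assms unfolding RegSimpl_simps CRing_simps
  by (intro reg_ring_map.intro reg_ring_map_axioms.intro reg_map.intro) blast+

lemma compose_Idt_right: "f \<in> extensional A \<Longrightarrow> compose A f (\<lambda>x\<in>A. x) = f"
  by (auto simp: compose_def extensional_def fun_eq_iff)

lemma compose_Idt_left: "f \<in> extensional A \<Longrightarrow> f \<in> A \<rightarrow> B \<Longrightarrow> compose A (\<lambda>x\<in>B. x) f = f"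
  by (auto simp: compose_def extensional_def fun_eq_iff)

lemma compose_compose:
  "f \<in> A \<rightarrow> B \<Longrightarrow> compose A (compose B h g) f = compose A h (compose A g f)"
  by (auto simp: compose_def fun_eq_iff)

lemma category_RegSimpl: "category (RegSimpl :: ('v scomplex, 'v \<Rightarrow> 'v) cat)"
proof -
  have rm: "reg_map X Y f" if "X \<in> Obj RegSimpl" "Y \<in> Obj RegSimpl" "f \<in> Hom RegSimpl X Y"
    for X Y :: "'v scomplex" and f
    using that unfolding RegSimpl_simps by (intro reg_map.intro)
  have ext: "f \<in> extensional (set (verts X))" "f \<in> set (verts X) \<rightarrow> set (verts Y)"
    if "f \<in> Hom RegSimpl X Y" for X Y :: "'v scomplex" and f
    using that by (auto simp: RegSimpl_def PiE_iff)
  show ?thesis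
    by (rule category.intro)
      (simp_all only: RegSimpl_simps(2,3) reg_map.f_Hom[OF reg_map_id] reg_map.f_Hom[OF reg_map_comp[OF rm rm]]
        compose_Idt_right compose_Idt_left ext compose_compose RegSimpl_simps(1)[THEN iffD1])
qed

lemma category_CRing: "category (CRing :: ('r ring, 'r \<Rightarrow> 'r) cat)"
proof (rule category.intro)
  fix R :: "'r ring" assume "R \<in> Obj CRing"
  then show "Idt CRing R \<in> Hom CRing R R"
    by (auto simp: CRing_simps ring_hom_def cring_def ring.ring_simprules)
next
  fix R S T :: "'r ring" and \<phi> \<psi>
  assume "R \<in> Obj CRing" "S \<in> Obj CRing" "T \<in> Obj CRing" "\<phi> \<in> Hom CRing R S" "\<psi> \<in> Hom CRing S T"
  then show "Comp CRing R S T \<psi> \<phi> \<in> Hom CRing R T"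
    by (auto simp: CRing_simps ring_hom_def compose_def cring_def ring.ring_simprules Pi_iff)
next
  fix R S :: "'r ring" and \<phi> assume "\<phi> \<in> Hom CRing R S"
  then have "\<phi> \<in> extensional (carrier R)" "\<phi> \<in> carrier R \<rightarrow> carrier S"
    by (auto simp: CRing_simps ring_hom_def)
  then show "Comp CRing R R S \<phi> (Idt CRing R) = \<phi>" "Comp CRing R S S (Idt CRing S) \<phi> = \<phi>"
    by (simp_all only: CRing_simps compose_Idt_right compose_Idt_left)
next
  fix R S T U :: "'r ring" and \<phi> \<psi> \<theta> assume "\<phi> \<in> Hom CRing R S"
  then have "\<phi> \<in> carrier R \<rightarrow> carrier S" by (auto simp: CRing_simps ring_hom_def)
  then show "Comp CRing R S U (Comp CRing S T U \<theta> \<psi>) \<phi> = Comp CRing R T U \<theta> (Comp CRing R S T \<psi> \<phi>)"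
    by (simp only: CRing_simps compose_compose)
qed

lemma category_prod_cat:
  assumes "category C" "category D"
  shows "category (prod_cat C D)"
  using assms unfolding category_def prod_cat_def by auto

lemma category_GrAbHomog: "category (GrAbHomog :: (int \<Rightarrow> 'g monoid, int \<times> (int \<Rightarrow> 'g \<Rightarrow> 'g)) cat)"
proof (rule category.intro)
  fix G :: "int \<Rightarrow> 'g monoid" assume "G \<in> Obj GrAbHomog"
  then show "Idt GrAbHomog G \<in> Hom GrAbHomog G G"
    by (auto simp: GrAbHomog_def hom_def comm_group_def group.is_monoid monoid.m_closed)
next
  fix G H K :: "int \<Rightarrow> 'g monoid" and h h'
  assume "h \<in> Hom GrAbHomog G H" "h' \<in> Hom GrAbHomog H K"
  then have h: "snd h j \<in> hom (G j) (H (j + fst h))" and h': "snd h' j \<in> hom (H j) (K (j + fst h'))" for j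
    by (auto simp: GrAbHomog_def)
  have "compose (carrier (G j)) (snd h' (j + fst h)) (snd h j) \<in> hom (G j) (K (j + (fst h + fst h')))"
    if "comm_group (G j)" for j
    using Group.group.hom_compose[OF comm_group_imp_group[OF that] h h'[of "j + fst h"]] by (simp only: add.assoc)
  moreover assume "G \<in> Obj GrAbHomog"
  ultimately show "Comp GrAbHomog G H K h' h \<in> Hom GrAbHomog G K"
    by (simp add: GrAbHomog_def)
next
  fix G H :: "int \<Rightarrow> 'g monoid" and h assume "h \<in> Hom GrAbHomog G H"
  then have "snd h j \<in> extensional (carrier (G j))" "snd h j \<in> carrier (G j) \<rightarrow> carrier (H (j + fst h))" for j
    by (auto simp: GrAbHomog_def hom_def Pi_iff)
  then show "Comp GrAbHomog G G H h (Idt GrAbHomog G) = h" "Comp GrAbHomog G H H (Idt GrAbHomog H) h = h"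
    by (simp_all add: GrAbHomog_def compose_Idt_right compose_Idt_left)
next
  fix G H K L :: "int \<Rightarrow> 'g monoid" and h h' h'' assume "h \<in> Hom GrAbHomog G H"
  then have "snd h j \<in> carrier (G j) \<rightarrow> carrier (H (j + fst h))" for j
    by (auto simp: GrAbHomog_def hom_def Pi_iff)
  then show "Comp GrAbHomog G H L (Comp GrAbHomog H K L h'' h') h
      = Comp GrAbHomog G K L h'' (Comp GrAbHomog G H K h' h)"
    by (simp add: GrAbHomog_def compose_compose add.assoc)
qed

lemma category_GrAb: "category (GrAb :: (int \<Rightarrow> 'g monoid, int \<Rightarrow> 'g \<Rightarrow> 'g) cat)"
proof (rule category.intro)
  fix G :: "int \<Rightarrow> 'g monoid" assume "G \<in> Obj GrAb"
  then show "Idt GrAb G \<in> Hom GrAb G G"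
    by (auto simp: GrAb_def hom_def comm_group_def group.is_monoid monoid.m_closed)
next
  fix G H K :: "int \<Rightarrow> 'g monoid" and h h'
  assume "G \<in> Obj GrAb" "h \<in> Hom GrAb G H" "h' \<in> Hom GrAb H K"
  then show "Comp GrAb G H K h' h \<in> Hom GrAb G K"
    by (simp add: GrAb_def) (meson Group.group.hom_compose comm_group_imp_group)
next
  fix G H :: "int \<Rightarrow> 'g monoid" and h assume "h \<in> Hom GrAb G H"
  then have "h j \<in> extensional (carrier (G j))" "h j \<in> carrier (G j) \<rightarrow> carrier (H j)" for j
    by (auto simp: GrAb_def hom_def)
  then show "Comp GrAb G G H h (Idt GrAb G) = h" "Comp GrAb G H H (Idt GrAb H) h = h"
    by (simp_all add: GrAb_def compose_Idt_right compose_Idt_left)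
next
  fix G H K L :: "int \<Rightarrow> 'g monoid" and h h' h'' assume "h \<in> Hom GrAb G H"
  then have "h j \<in> carrier (G j) \<rightarrow> carrier (H j)" for j by (auto simp: GrAb_def hom_def)
  then show "Comp GrAb G H L (Comp GrAb H K L h'' h') h = Comp GrAb G K L h'' (Comp GrAb G H K h' h)"
    by (simp add: GrAb_def compose_compose)
qed

text \<open>Discarding the arrows of nonzero degree is functorial as soon as degrees cannot cancel: if
  all degrees are nonnegative, a composite has degree zero only if both factors have.\<close>

lemma degree_zero_part_functor:
  assumes F: "cat_functor C GrAbHomog Fo Fm"
    and nonneg: "\<And>X Y f. X \<in> Obj C \<Longrightarrow> Y \<in> Obj C \<Longrightarrow> f \<in> Hom C X Y \<Longrightarrow> 0 \<le> fst (Fm X Y f)"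
  shows "cat_functor C GrAb Fo (\<lambda>X Y f. degree_zero_part (Fo X) (Fo Y) (Fm X Y f))"
proof -
  interpret F: cat_functor C GrAbHomog Fo Fm by fact
  interpret GrAb: category GrAb by (rule category_GrAb)
  have cg: "comm_group (Fo X j)" if "X \<in> Obj C" for X j
    using F.Fo_in_Obj[OF that] by (simp add: GrAbHomog_def)
  have one: "\<one>\<^bsub>Fo X j\<^esub> \<in> carrier (Fo X j)" "\<one>\<^bsub>Fo X j\<^esub> \<otimes>\<^bsub>Fo X j\<^esub> \<one>\<^bsub>Fo X j\<^esub> = \<one>\<^bsub>Fo X j\<^esub>" if "X \<in> Obj C" for X j
  proof -
    interpret comm_group "Fo X j" using that by (rule cg)
    show "\<one>\<^bsub>Fo X j\<^esub> \<in> carrier (Fo X j)" "\<one>\<^bsub>Fo X j\<^esub> \<otimes>\<^bsub>Fo X j\<^esub> \<one>\<^bsub>Fo X j\<^esub> = \<one>\<^bsub>Fo X j\<^esub>" by simp_all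
  qed
  have hm: "snd (Fm X Y f) j \<in> hom (Fo X j) (Fo Y (j + fst (Fm X Y f)))"
    "snd (Fm X Y f) j \<in> extensional (carrier (Fo X j))"
    if "X \<in> Obj C" "Y \<in> Obj C" "f \<in> Hom C X Y" for X Y f j
    using F.Fm_in_Hom[OF that] by (auto simp: GrAbHomog_def)
  have dz: "degree_zero_part (Fo X) (Fo Y) (Fm X Y f) j \<in> hom (Fo X j) (Fo Y j)"
    "degree_zero_part (Fo X) (Fo Y) (Fm X Y f) j \<in> extensional (carrier (Fo X j))"
    if "X \<in> Obj C" "Y \<in> Obj C" "f \<in> Hom C X Y" for X Y f j
  proof -
    have "(\<lambda>x\<in>carrier (Fo X j). \<one>\<^bsub>Fo Y j\<^esub>) \<in> hom (Fo X j) (Fo Y j)"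
    proof (rule homI)
      interpret comm_group "Fo X j" using that(1) by (rule cg)
      fix x y assume "x \<in> carrier (Fo X j)" "y \<in> carrier (Fo X j)"
      then show "(\<lambda>x\<in>carrier (Fo X j). \<one>\<^bsub>Fo Y j\<^esub>) (x \<otimes>\<^bsub>Fo X j\<^esub> y)
          = (\<lambda>x\<in>carrier (Fo X j). \<one>\<^bsub>Fo Y j\<^esub>) x \<otimes>\<^bsub>Fo Y j\<^esub> (\<lambda>x\<in>carrier (Fo X j). \<one>\<^bsub>Fo Y j\<^esub>) y"
        using one(2)[OF that(2)] by simp
    qed (use one(1)[OF that(2)] in simp)
    then show "degree_zero_part (Fo X) (Fo Y) (Fm X Y f) j \<in> hom (Fo X j) (Fo Y j)"
      "degree_zero_part (Fo X) (Fo Y) (Fm X Y f) j \<in> extensional (carrier (Fo X j))"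
      using hm[OF that, of j] by (cases "fst (Fm X Y f) = 0"; simp add: degree_zero_part_def)+
  qed
  show ?thesis
  proof (intro cat_functor.intro cat_functor_axioms.intro F.dom.category_axioms category_GrAb)
    show "Fo X \<in> Obj GrAb" if "X \<in> Obj C" for X using cg[OF that] by (simp add: GrAb_def)
    show "degree_zero_part (Fo X) (Fo Y) (Fm X Y f) \<in> Hom GrAb (Fo X) (Fo Y)"
      if "X \<in> Obj C" "Y \<in> Obj C" "f \<in> Hom C X Y" for X Y f
      using dz[OF that] by (simp add: GrAb_def)
    show "degree_zero_part (Fo X) (Fo X) (Fm X X (Idt C X)) = Idt GrAb (Fo X)" if "X \<in> Obj C" for X
      using F.Fm_Idt[OF that] by (simp add: degree_zero_part_def GrAb_def GrAbHomog_def)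
  next
    fix X Y Z f g
    assume h: "X \<in> Obj C" "Y \<in> Obj C" "Z \<in> Obj C" "f \<in> Hom C X Y" "g \<in> Hom C Y Z"
    let ?f = "Fm X Y f" and ?g = "Fm Y Z g" and ?gf = "Fm X Z (Comp C X Y Z g f)"
    have gf: "?gf = (fst ?f + fst ?g, \<lambda>j. compose (carrier (Fo X j)) (snd ?g (j + fst ?f)) (snd ?f j))"
      using F.Fm_Comp[OF h] by (simp add: GrAbHomog_def)
    have pos: "0 \<le> fst ?f" "0 \<le> fst ?g" using nonneg h by simp_all
    show "degree_zero_part (Fo X) (Fo Z) ?gf
        = Comp GrAb (Fo X) (Fo Y) (Fo Z) (degree_zero_part (Fo Y) (Fo Z) ?g) (degree_zero_part (Fo X) (Fo Y) ?f)"
    proof (cases "fst ?f = 0 \<and> fst ?g = 0")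
      case True
      then show ?thesis by (simp add: degree_zero_part_def GrAb_def gf)
    next
      case False
      then have ne: "fst ?gf \<noteq> 0" using pos by (auto simp: gf)
      have "degree_zero_part (Fo Y) (Fo Z) ?g j (degree_zero_part (Fo X) (Fo Y) ?f j x) = \<one>\<^bsub>Fo Z j\<^esub>"
        if x: "x \<in> carrier (Fo X j)" for j x
      proof (cases "fst ?f = 0")
        case True
        then have "fst ?g \<noteq> 0" using False by simp
        then show ?thesis
          using hom_in_carrier[OF dz(1)[OF h(1,2,4)] x] by (simp add: degree_zero_part_def[of "Fo Y"])
      next
        case False
        then have "degree_zero_part (Fo X) (Fo Y) ?f j x = \<one>\<^bsub>Fo Y j\<^esub>"
          using x by (simp add: degree_zero_part_def)
        then show ?thesis
          using hom_one[OF dz(1)[OF h(2,3,5)] comm_group_imp_group[OF cg[OF h(2)]]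
              comm_group_imp_group[OF cg[OF h(3)]]] by simp
      qed
      then show ?thesis
        using ne by (auto simp: degree_zero_part_def[of "Fo X" "Fo Z"] GrAb_def compose_def intro!: ext)
    qed
  qed
qed

lemma uber_map_apply:
  "uber_map s (X, R) (Y, S) (f, \<phi>) = (vertex_excess X Y,
     \<lambda>j. subquotient_map (uber_chains X R j) (uber_cycles (s X) X R j) (uber_boundaries (s X) X R j)
           (uber_chains Y S (j + vertex_excess X Y)) (uber_boundaries (s Y) Y S (j + vertex_excess X Y))
           (induced_uchain (s X) (s Y) X Y R S f \<phi> j))"
  by (simp add: uber_map_def)

lemma uber_functor:
  fixes s :: "'v scomplex \<Rightarrow> ('v \<Rightarrow> nat) \<Rightarrow> ('v \<Rightarrow> nat) \<Rightarrow> bit"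
  assumes s: "\<And>X. X \<in> Obj RegSimpl \<Longrightarrow> sign_assignment X (s X)"
  shows "cat_functor (prod_cat RegSimpl (CRing :: ('r ring, 'r \<Rightarrow> 'r) cat)) GrAbHomog (uber_obj s) (uber_map s)"
proof -
  let ?C = "prod_cat (RegSimpl :: ('v scomplex, 'v \<Rightarrow> 'v) cat) (CRing :: ('r ring, 'r \<Rightarrow> 'r) cat)"
  have data: "uber_map_data X Y f R S \<phi> (s X) (s Y)"
    if "(X, R) \<in> Obj ?C" "(Y, S) \<in> Obj ?C" "(f, \<phi>) \<in> Hom ?C (X, R) (Y, S)" for X Y f and R S :: "'r ring" and \<phi>
    using that s by (intro uber_map_data.intro uber_map_data_axioms.intro reg_ring_mapI) (simp_all add: prod_cat_def)
  have obj: "fin_conn_complex X" "cring R" "sign_assignment X (s X)" if "(X, R) \<in> Obj ?C" for X and R :: "'r ring"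
    using that s by (simp_all add: prod_cat_def RegSimpl_simps CRing_simps)
  show ?thesis
  proof (intro cat_functor.intro cat_functor_axioms.intro category_prod_cat category_RegSimpl
      category_CRing category_GrAbHomog)
    fix A assume "A \<in> Obj ?C"
    then show "uber_obj s A \<in> Obj GrAbHomog"
      using comm_group_uberhomology[OF obj] by (cases A) (simp add: uber_obj_def GrAbHomog_def)
  next
    fix A B m assume h: "A \<in> Obj ?C" "B \<in> Obj ?C" "m \<in> Hom ?C A B"
    obtain X R Y S f \<phi> where e: "A = (X, R)" "B = (Y, S)" "m = (f, \<phi>)" by (metis surj_pair)
    interpret uber_map_data X Y f R S \<phi> "s X" "s Y" using h unfolding e by (rule data)
    show "uber_map s A B m \<in> Hom GrAbHomog (uber_obj s A) (uber_obj s B)"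
      using uber_map_hom unfolding e uber_map_apply
      by (simp add: uber_obj_def GrAbHomog_def uberhomology_def subquotient_map_def)
  next
    fix A assume h: "A \<in> Obj ?C"
    obtain X R where e: "A = (X, R)" by (metis surj_pair)
    note o = obj[OF h[unfolded e]]
    have ve: "vertex_excess X X = 0" by (simp add: vertex_excess_def)
    have "subquotient_map (uber_chains X R j) (uber_cycles (s X) X R j) (uber_boundaries (s X) X R j)
           (uber_chains X R j) (uber_boundaries (s X) X R j)
           (induced_uchain (s X) (s X) X X R R (\<lambda>v\<in>set (verts X). v) (\<lambda>r\<in>carrier R. r) j)
        = (\<lambda>x\<in>carrier (uberhomology (s X) X R j). x)" for j
    proof (rule extensionalityI[of _ "carrier (uberhomology (s X) X R j)"])
      fix x assume "x \<in> carrier (uberhomology (s X) X R j)"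
      then show "subquotient_map (uber_chains X R j) (uber_cycles (s X) X R j) (uber_boundaries (s X) X R j)
           (uber_chains X R j) (uber_boundaries (s X) X R j)
           (induced_uchain (s X) (s X) X X R R (\<lambda>v\<in>set (verts X). v) (\<lambda>r\<in>carrier R. r) j) x
        = (\<lambda>x\<in>carrier (uberhomology (s X) X R j). x) x"
        using subquotient_pair.subquotient_map_id[OF uber_subquotient_pair[OF o] induced_uchain_id[OF o]]
        by (simp add: uberhomology_def)
    qed (simp_all add: subquotient_map_def uberhomology_def)
    then show "uber_map s A A (Idt ?C A) = Idt GrAbHomog (uber_obj s A)"
      by (simp add: e prod_cat_def RegSimpl_simps CRing_simps uber_map_apply ve GrAbHomog_def uber_obj_def)
  next
    fix A B D m n
    assume h: "A \<in> Obj ?C" "B \<in> Obj ?C" "D \<in> Obj ?C" "m \<in> Hom ?C A B" "n \<in> Hom ?C B D"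
    obtain X R Y S Z T f \<phi> g \<psi> where e: "A = (X, R)" "B = (Y, S)" "D = (Z, T)" "m = (f, \<phi>)" "n = (g, \<psi>)"
      by (metis surj_pair)
    have df: "uber_map_data X Y f R S \<phi> (s X) (s Y)" and dg: "uber_map_data Y Z g S T \<psi> (s Y) (s Z)"
      using data h unfolding e by blast+
    interpret f: uber_map_data X Y f R S \<phi> "s X" "s Y" by (rule df)
    interpret g: uber_map_data Y Z g S T \<psi> "s Y" "s Z" by (rule dg)
    let ?gf = "compose (set (verts X)) g f" and ?pp = "compose (carrier R) \<psi> \<phi>"
    have ve: "vertex_excess X Z = vertex_excess X Y + vertex_excess Y Z" by (simp add: vertex_excess_def)
    define F where "F j = snd (uber_map s A B m) j" for j
    define G where "G j = snd (uber_map s B D n) j" for j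
    define H where "H j = snd (uber_map s A D (?gf, ?pp)) j" for j
    have "H j = compose (carrier (uberhomology (s X) X R j)) (G (j + vertex_excess X Y)) (F j)" for j
    proof (rule extensionalityI[of _ "carrier (uberhomology (s X) X R j)"])
      show "H j \<in> extensional (carrier (uberhomology (s X) X R j))"
        by (simp add: H_def e uber_map_apply subquotient_map_def uberhomology_def)
      fix x assume x: "x \<in> carrier (uberhomology (s X) X R j)"
      have k: "j + vertex_excess X Z = (j + vertex_excess X Y) + vertex_excess Y Z" by (simp add: ve)
      have "H j x = G (j + vertex_excess X Y) (F j x)"
        unfolding H_def F_def G_def e uber_map_apply snd_conv k
        by (rule subquotient_map_comp[OF uber_subquotient_pair[OF f.X f.R f.s]
              uber_subquotient_pair[OF g.X g.R g.s] uber_subquotient_pair[OF g.Y g.S g.t]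
              f.induced_uchain_hom[OF refl] f.induced_uchain_preserves[OF refl]
              g.induced_uchain_hom[OF refl] g.induced_uchain_preserves(2)[OF refl]])
          (simp_all only: induced_uchain_comp[OF df dg refl] x[unfolded uberhomology_def])
      then show "H j x = compose (carrier (uberhomology (s X) X R j)) (G (j + vertex_excess X Y)) (F j) x"
        using x by (simp add: compose_eq)
    qed simp
    then have "uber_map s A D (?gf, ?pp) = (vertex_excess X Y + vertex_excess Y Z,
        \<lambda>j. compose (carrier (uberhomology (s X) X R j)) (G (j + vertex_excess X Y)) (F j))"
      by (intro prod_eqI ext) (simp_all add: H_def[symmetric], simp add: e uber_map_apply ve)
    moreover have "Comp ?C A B D n m = (?gf, ?pp)"
      by (simp add: e prod_cat_def RegSimpl_simps CRing_simps)
    ultimately show "uber_map s A D (Comp ?C A B D n m)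
        = Comp GrAbHomog (uber_obj s A) (uber_obj s B) (uber_obj s D) (uber_map s B D n) (uber_map s A B m)"
      by (simp add: GrAbHomog_def F_def G_def uber_obj_def e) (simp add: uber_map_apply)
  qed
qed

lemma vertex_excess_nonneg:
  assumes "reg_map X Y f"
  shows "0 \<le> vertex_excess X Y"
proof -
  interpret reg_map X Y f by fact
  have "card (set (verts X)) \<le> card (set (verts Y))"
    using f_inj f_verts by (intro card_inj_on_le) auto
  then show ?thesis
    using fin_conn_complexD(1)[OF X] fin_conn_complexD(1)[OF Y]
    by (simp add: vertex_excess_def distinct_card)
qed

theorem theorem1p1:
  fixes s :: "'v scomplex \<Rightarrow> ('v \<Rightarrow> nat) \<Rightarrow> ('v \<Rightarrow> nat) \<Rightarrow> bit"
  assumes "\<And>X. X \<in> Obj RegSimpl \<Longrightarrow> sign_assignment X (s X)"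
  shows
    "cat_functor (prod_cat RegSimpl (CRing :: ('r ring, 'r \<Rightarrow> 'r) cat)) GrAbHomog
       (uber_obj s) (uber_map s)
     \<and> cat_functor (prod_cat RegSimpl (CRing :: ('r ring, 'r \<Rightarrow> 'r) cat)) GrAb
       (uber_obj s) (\<lambda>A B m. degree_zero_part (uber_obj s A) (uber_obj s B) (uber_map s A B m))"
proof (intro conjI)
  show *: "cat_functor (prod_cat RegSimpl (CRing :: ('r ring, 'r \<Rightarrow> 'r) cat)) GrAbHomog
       (uber_obj s) (uber_map s)"
    using assms by (rule uber_functor)
  show "cat_functor (prod_cat RegSimpl (CRing :: ('r ring, 'r \<Rightarrow> 'r) cat)) GrAb
       (uber_obj s) (\<lambda>A B m. degree_zero_part (uber_obj s A) (uber_obj s B) (uber_map s A B m))"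
  proof (rule degree_zero_part_functor[OF *])
    fix A B m
    assume h: "A \<in> Obj (prod_cat (RegSimpl :: ('v scomplex, 'v \<Rightarrow> 'v) cat) (CRing :: ('r ring, 'r \<Rightarrow> 'r) cat))"
      "B \<in> Obj (prod_cat RegSimpl (CRing :: ('r ring, 'r \<Rightarrow> 'r) cat))"
      "m \<in> Hom (prod_cat RegSimpl (CRing :: ('r ring, 'r \<Rightarrow> 'r) cat)) A B"
    then have "reg_map (fst A) (fst B) (fst m)"
      by (intro reg_map.intro) (auto simp: prod_cat_def RegSimpl_simps)
    then show "0 \<le> fst (uber_map s A B m)"
      using vertex_excess_nonneg by (auto simp: uber_map_def split: prod.splits)
  qed
qed

end
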